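(* Let $p,q,r$ and $T$ satisfy the standing assumptions listed in the context; in particular $T\ge\varepsilon I$ for some $\varepsilon>0$ and $\operatorname{dom}(T^{1/2})=H^1(\mathbb{R})$. (i) One has $|r|^{1/2}T^{-1/2}\in\mathcal{B}(L^2(\mathbb{R};dx))$ if and only if $r\in L^1_{\mathrm{loc\,unif}}(\mathbb{R};dx)$. In particular, if $r\in L^1_{\mathrm{loc\,unif}}(\mathbb{R};dx)$, then, introducing $$\underline{T^{-1/2}rT^{-1/2}}=\big[|r|^{1/2}T^{-1/2}\big]^*\operatorname{sgn}(r)\big[|r|^{1/2}T^{-1/2}\big],$$ one has $\underline{T^{-1/2}rT^{-1/2}}\in\mathcal{B}(L^2(\mathbb{R};dx))$. (ii) Let $r_0\in\mathbb{R}$. Then $|r-r_0|^{1/2}T^{-1/2}\in\mathcal{B}_\infty(L^2(\mathbb{R};dx))$ if and only if $$\lim_{|a|\to\infty}\Big(\int_a^{a+1}dx\,|r(x)-r_0|\Big)=0.$$ In particular, if this limit relation holds, then, introducing $$\underline{T^{-1/2}(r-r_0)T^{-1/2}}=\big[|r-r_0|^{1/2}T^{-1/2}\big]^*\operatorname{sgn}(r-r_0)\big[|r-r_0|^{1/2}T^{-1/2}\big],$$ one has $\underline{T^{-1/2}(r-r_0)T^{-1/2}}\in\mathcal{B}_\infty(L^2(\mathbb{R};dx))$. (iii) Let $r_0\in\mathbb{R}$. Then $|r-r_0|^{1/2}T^{-1/2}\in\mathcal{B}_2(L^2(\mathbb{R};dx))$ if and only if $\int_{\mathbb{R}}dx\,|r(x)-r_0|<\infty$.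 In particular, if $\int_{\mathbb{R}}dx\,|r(x)-r_0|<\infty$, then the operator $\underline{T^{-1/2}(r-r_0)T^{-1/2}}$ (given by the formula in (ii)) belongs to $\mathcal{B}_1(L^2(\mathbb{R};dx))$.
   Context: Notation: $\mathcal{B}(\mathcal H)$, $\mathcal{B}_\infty(\mathcal H)$, $\mathcal{B}_2(\mathcal H)$, $\mathcal{B}_1(\mathcal H)$ are the bounded, compact, Hilbert--Schmidt and trace class operators in $\mathcal H$. $I$ is the identity in $L^2(\mathbb{R};dx)$. $H^1(\mathbb{R})$ is the usual Sobolev space. $AC_{\mathrm{loc}}(\mathbb{R})$ denotes the locally absolutely continuous functions. For $V\in L^1_{\mathrm{loc}}(\mathbb{R};dx)$ or $V\in L^2_{\mathrm{loc}}(\mathbb{R};dx)$, the symbol $V$ also denotes the operator of multiplication by $V$ with maximal domain $\{f\in L^2:Vf\in L^2\}$. $$L^1_{\mathrm{loc\,unif}}(\mathbb{R};dx)=\Big\{f\in L^1_{\mathrm{loc}}(\mathbb{R};dx)\;\Big|\;\sup_{a\in\mathbb{R}}\int_a^{a+1}dx\,|f(x)|<\infty\Big\}.$$ Standing assumptions. (1) $p>0$ a.e. on $\mathbb{R}$, $p^{-1}\in L^1_{\mathrm{loc}}(\mathbb{R};dx)$, and $q,r\in L^1_{\mathrm{loc}}(\mathbb{R};dx)$ are real-valued a.e.; $r\neq0$ on a set of positive Lebesgue measure; and $\pm\lim_{x\to\pm\infty}\int^x dx'\,p(x')^{-1/2}=\infty$. (The function $r$ may change sign.) (2) With $\tau f=-(pf')'+qf$,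 let $T_{\min}f=\tau f$ on $\operatorname{dom}(T_{\min})=\{g\in L^2(\mathbb{R};dx)\mid g,pg'\in AC_{\mathrm{loc}}(\mathbb{R});\ \operatorname{supp}(g)\text{ compact};\ \tau g\in L^2(\mathbb{R};dx)\}$. Assume $T_{\min}\ge\varepsilon I$ for some $\varepsilon>0$. Under these assumptions the operator $Tf=\tau f$ with $\operatorname{dom}(T)=\{g\in L^2(\mathbb{R};dx)\mid g,pg'\in AC_{\mathrm{loc}}(\mathbb{R});\ \tau g\in L^2(\mathbb{R};dx)\}$ is self-adjoint, $T=\overline{T_{\min}}$, and $T\ge\varepsilon I$. (3) The form domain of $T$ is $\operatorname{dom}(T^{1/2})=H^1(\mathbb{R})$. *)

theory Defs
  imports "HOL-Analysis.Analysis"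
begin

section \<open>The complex Hilbert space of square integrable functions on the line\<close>

definition square_integrable :: "(real \<Rightarrow> complex) \<Rightarrow> bool" where
  "square_integrable f \<longleftrightarrow>
     f \<in> borel_measurable lebesgue \<and> integrable lebesgue (\<lambda>x. (cmod (f x))\<^sup>2)"

definition l2_eq :: "(real \<Rightarrow> complex) \<Rightarrow> (real \<Rightarrow> complex) \<Rightarrow> bool" where
  "l2_eq f g \<longleftrightarrow>
     square_integrable f \<and> square_integrable g \<and> (AE x in lebesgue. f x = g x)"

lemma square_integrable_zero: "square_integrable (\<lambda>_. 0)"
  by (simp add: square_integrable_def)

lemma square_integrable_scale:
  assumes "square_integrable f"
  shows "square_integrable (\<lambda>x. c * f x)"
  using assms by (auto simp: square_integrable_def norm_mult power_mult_distrib)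

lemma square_integrable_add:
  assumes "square_integrable f" "square_integrable g"
  shows "square_integrable (\<lambda>x. f x + g x)"
proof -
  have [measurable]: "f \<in> borel_measurable lebesgue" "g \<in> borel_measurable lebesgue"
    using assms by (auto simp: square_integrable_def)
  have "integrable lebesgue (\<lambda>x. 2 * (cmod (f x))\<^sup>2 + 2 * (cmod (g x))\<^sup>2)"
    using assms by (auto simp: square_integrable_def)
  moreover have "(cmod (f x + g x))\<^sup>2 \<le> 2 * (cmod (f x))\<^sup>2 + 2 * (cmod (g x))\<^sup>2" for x
  proof -
    have "(cmod (f x + g x))\<^sup>2 \<le> (cmod (f x) + cmod (g x))\<^sup>2"
      by (intro power_mono norm_triangle_ineq) auto
    also have "\<dots> \<le> 2 * (cmod (f x))\<^sup>2 + 2 * (cmod (g x))\<^sup>2"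
      using zero_le_power2[of "cmod (f x) - cmod (g x)"]
      by (simp add: power2_eq_square algebra_simps)
    finally show ?thesis .
  qed
  ultimately have "integrable lebesgue (\<lambda>x. (cmod (f x + g x))\<^sup>2)"
    by (elim Bochner_Integration.integrable_bound) auto
  then show ?thesis
    by (simp add: square_integrable_def)
qed

lemma square_integrable_minus:
  "square_integrable f \<Longrightarrow> square_integrable (\<lambda>x. - f x)"
  using square_integrable_scale[of f "-1"] by simp

lemma square_integrable_diff:
  "square_integrable f \<Longrightarrow> square_integrable g \<Longrightarrow> square_integrable (\<lambda>x. f x - g x)"
  using square_integrable_add[OF _ square_integrable_minus, of f g] by simp

lemma square_integrable_cnj_mult:
  assumes "square_integrable f" "square_integrable g"
  shows "integrable lebesgue (\<lambda>x. cnj (f x) * g x)"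
proof -
  have [measurable]: "f \<in> borel_measurable lebesgue" "g \<in> borel_measurable lebesgue"
    using assms by (auto simp: square_integrable_def)
  have [measurable]: "(\<lambda>x. cnj (f x)) \<in> borel_measurable lebesgue"
    by (rule borel_measurable_continuous_on[OF continuous_on_cnj[OF continuous_on_id]]) simp
  have "integrable lebesgue (\<lambda>x. (cmod (f x))\<^sup>2 + (cmod (g x))\<^sup>2)"
    using assms by (auto simp: square_integrable_def)
  moreover have "cmod (cnj (f x) * g x) \<le> (cmod (f x))\<^sup>2 + (cmod (g x))\<^sup>2" for x
  proof -
    have "0 \<le> cmod (f x) * cmod (g x)"
      by simp
    then show ?thesis
      using sum_squares_bound[of "cmod (f x)" "cmod (g x)"]
      unfolding norm_mult complex_mod_cnj by linarith
  qed
  ultimately show ?thesis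
    by (elim Bochner_Integration.integrable_bound) auto
qed

quotient_type l2 = "real \<Rightarrow> complex" / partial: l2_eq
proof (rule part_equivpI)
  show "\<exists>f. l2_eq f f"
    by (rule exI[of _ "\<lambda>_. 0"]) (simp add: l2_eq_def square_integrable_zero)
  show "symp l2_eq"
    by (auto simp: symp_def l2_eq_def)
  show "transp l2_eq"
    by (auto simp: transp_def l2_eq_def)
qed

lift_definition scaleC :: "complex \<Rightarrow> l2 \<Rightarrow> l2" (infixr "*\<^sub>C" 75) is "\<lambda>c f x. c * f x"
  by (auto simp: l2_eq_def square_integrable_scale)

lift_definition cinner :: "l2 \<Rightarrow> l2 \<Rightarrow> complex" is
  "\<lambda>f g. LINT x|lebesgue. cnj (f x) * g x"
proof -
  fix f f' g g' assume *: "l2_eq f f'" "l2_eq g g'"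
  then have "AE x in lebesgue. cnj (f x) * g x = cnj (f' x) * g' x"
    unfolding l2_eq_def by (auto elim: eventually_elim2)
  moreover have "integrable lebesgue (\<lambda>x. cnj (f x) * g x)"
    "integrable lebesgue (\<lambda>x. cnj (f' x) * g' x)"
    using * by (auto simp: l2_eq_def intro: square_integrable_cnj_mult)
  ultimately show "(LINT x|lebesgue. cnj (f x) * g x) = (LINT x|lebesgue. cnj (f' x) * g' x)"
    by (intro integral_cong_AE) auto
qed

instantiation l2 :: real_inner
begin

lift_definition zero_l2 :: l2 is "\<lambda>_. 0"
  by (simp add: l2_eq_def square_integrable_zero)

lift_definition plus_l2 :: "l2 \<Rightarrow> l2 \<Rightarrow> l2" is "\<lambda>f g x. f x + g x"
  unfolding l2_eq_def by (auto simp: square_integrable_add elim: eventually_elim2)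

lift_definition uminus_l2 :: "l2 \<Rightarrow> l2" is "\<lambda>f x. - f x"
  unfolding l2_eq_def by (auto simp: square_integrable_minus elim: eventually_elim2)

lift_definition minus_l2 :: "l2 \<Rightarrow> l2 \<Rightarrow> l2" is "\<lambda>f g x. f x - g x"
  unfolding l2_eq_def by (auto simp: square_integrable_diff elim: eventually_elim2)

definition scaleR_l2 :: "real \<Rightarrow> l2 \<Rightarrow> l2" where
  "scaleR_l2 a f = complex_of_real a *\<^sub>C f"

definition inner_l2 :: "l2 \<Rightarrow> l2 \<Rightarrow> real" where
  "inner_l2 f g = Re (cinner f g)"

definition norm_l2 :: "l2 \<Rightarrow> real" where
  "norm_l2 f = sqrt (inner f f)"

definition sgn_l2 :: "l2 \<Rightarrow> l2" where
  "sgn_l2 f = scaleR (inverse (norm f)) f"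

definition dist_l2 :: "l2 \<Rightarrow> l2 \<Rightarrow> real" where
  "dist_l2 f g = norm (f - g)"

definition uniformity_l2 :: "(l2 \<times> l2) filter" where
  "uniformity_l2 = (INF e\<in>{0 <..}. principal {(f, g). dist f g < e})"

definition open_l2 :: "l2 set \<Rightarrow> bool" where
  "open_l2 U \<longleftrightarrow> (\<forall>f\<in>U. eventually (\<lambda>(f', g). f' = f \<longrightarrow> g \<in> U) uniformity)"

instance
proof
  fix f g h :: l2 and a b :: real
  show "f + g + h = f + (g + h)"
    by transfer (auto simp: l2_eq_def add.assoc square_integrable_add)
  show "f + g = g + f"
    by transfer (auto simp: l2_eq_def add.commute square_integrable_add)
  show "0 + f = f"
    by transfer (auto simp: l2_eq_def)
  show "- f + f = 0"
    by transfer (auto simp: l2_eq_def square_integrable_zero)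
  show "f - g = f + - g"
    by transfer (auto simp: l2_eq_def square_integrable_diff)
  show "a *\<^sub>R (f + g) = a *\<^sub>R f + a *\<^sub>R g"
    unfolding scaleR_l2_def by transfer
      (auto simp: l2_eq_def distrib_left intro!: square_integrable_scale square_integrable_add)
  show "(a + b) *\<^sub>R f = a *\<^sub>R f + b *\<^sub>R f"
    unfolding scaleR_l2_def by transfer
      (auto simp: l2_eq_def distrib_right intro!: square_integrable_scale square_integrable_add)
  show "a *\<^sub>R b *\<^sub>R f = (a * b) *\<^sub>R f"
    unfolding scaleR_l2_def by transfer
      (auto simp: l2_eq_def mult.assoc intro!: square_integrable_scale)
  show "1 *\<^sub>R f = f"
    unfolding scaleR_l2_def by transfer (auto simp: l2_eq_def)
  show "dist f g = norm (f - g)"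
    by (simp add: dist_l2_def)
  show "sgn f = scaleR (inverse (norm f)) f"
    by (simp add: sgn_l2_def)
  show "(uniformity :: (l2 \<times> l2) filter) = (INF e\<in>{0 <..}. principal {(f, g). dist f g < e})"
    by (rule uniformity_l2_def)
  show "open U \<longleftrightarrow> (\<forall>f\<in>U. eventually (\<lambda>(f', g). f' = f \<longrightarrow> g \<in> U) uniformity)"
    for U :: "l2 set"
    by (rule open_l2_def)
  show "norm f = sqrt (inner f f)"
    by (simp add: norm_l2_def)
  show "inner f g = inner g f"
    unfolding inner_l2_def
  proof transfer
    fix f g assume "l2_eq f f" "l2_eq g g"
    have "(LINT x|lebesgue. cnj (g x) * f x) = (LINT x|lebesgue. cnj (cnj (f x) * g x))"
      by (simp add: mult.commute)
    also have "\<dots> = cnj (LINT x|lebesgue. cnj (f x) * g x)"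
      by (rule Bochner_Integration.integral_cnj)
    finally show "Re (LINT x|lebesgue. cnj (f x) * g x) = Re (LINT x|lebesgue. cnj (g x) * f x)"
      by simp
  qed
  show "inner (f + g) h = inner f h + inner g h"
    unfolding inner_l2_def
    by transfer
      (auto simp: l2_eq_def distrib_right square_integrable_cnj_mult)
  show "inner (a *\<^sub>R f) g = a * inner f g"
    unfolding inner_l2_def scaleR_l2_def by transfer (simp add: mult.assoc)
  have self: "(LINT x|lebesgue. cnj (h x) * h x)
      = complex_of_real (LINT x|lebesgue. (cmod (h x))\<^sup>2)" for h
    unfolding integral_complex_of_real[symmetric] complex_norm_square by (simp add: mult.commute)
  show "0 \<le> inner f f"
    unfolding inner_l2_def by transfer (simp add: self)
  show "inner f f = 0 \<longleftrightarrow> f = 0"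
    unfolding inner_l2_def
  proof transfer
    fix h assume "l2_eq h h"
    then show "Re (LINT x|lebesgue. cnj (h x) * h x) = 0 \<longleftrightarrow> l2_eq h (\<lambda>_. 0)"
      using integral_nonneg_eq_0_iff_AE[of lebesgue "\<lambda>x. (cmod (h x))\<^sup>2"]
      by (auto simp: self l2_eq_def square_integrable_def)
  qed
qed

end


section \<open>Operators\<close>

text \<open>
  A possibly unbounded operator is its graph, so that its domain is \<^const>\<open>Domain\<close> and its
  inverse \<^const>\<open>converse\<close>, and two operators are equal iff their domains and values agree.
\<close>

type_synonym l2_op = "(l2 \<times> l2) set"

definition linear_op :: "l2_op \<Rightarrow> bool" where
  "linear_op A \<longleftrightarrow> single_valued A \<and> (0, 0) \<in> A \<and>
     (\<forall>f f' g g'. (f, f') \<in> A \<longrightarrow> (g, g') \<in> A \<longrightarrow> (f + g, f' + g') \<in> A) \<and>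
     (\<forall>c f f'. (f, f') \<in> A \<longrightarrow> (c *\<^sub>C f, c *\<^sub>C f') \<in> A)"

text \<open>Only meaningful for \<open>f\<close> in the domain of \<open>A\<close>.\<close>

definition op_apply :: "l2_op \<Rightarrow> l2 \<Rightarrow> l2" where
  "op_apply A f = (THE g. (f, g) \<in> A)"

text \<open>Composition on the maximal domain; \<^const>\<open>relcomp\<close> applies its left argument first.\<close>

abbreviation op_comp :: "l2_op \<Rightarrow> l2_op \<Rightarrow> l2_op" (infixr "\<circ>\<^sub>o" 75) where
  "A \<circ>\<^sub>o B \<equiv> B O A"

text \<open>For \<open>A\<close> densely defined this is the graph of the Hilbert space adjoint.\<close>

definition adjoint_op :: "l2_op \<Rightarrow> l2_op" where
  "adjoint_op A = {(g, h). \<forall>f f'. (f, f') \<in> A \<longrightarrow> cinner g f' = cinner h f}"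

definition self_adjoint_op :: "l2_op \<Rightarrow> bool" where
  "self_adjoint_op A \<longleftrightarrow> linear_op A \<and> closure (Domain A) = UNIV \<and> adjoint_op A = A"

text \<open>\<open>A \<ge> c I\<close> in the sense of quadratic forms.\<close>

definition op_ge :: "l2_op \<Rightarrow> real \<Rightarrow> bool" where
  "op_ge A c \<longleftrightarrow>
     (\<forall>f g. (f, g) \<in> A \<longrightarrow> cinner f g \<in> \<real> \<and> Re (cinner f g) \<ge> c * (norm f)\<^sup>2)"

text \<open>
  The square root of a nonnegative self-adjoint operator: its unique nonnegative
  self-adjoint square root.
\<close>

definition op_sqrt :: "l2_op \<Rightarrow> l2_op" where
  "op_sqrt A = (THE S. self_adjoint_op S \<and> op_ge S 0 \<and> S \<circ>\<^sub>o S = A)"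

definition bounded_ops :: "l2_op set" where
  "bounded_ops = {A. linear_op A \<and> Domain A = UNIV \<and>
     (\<exists>K. \<forall>f g. (f, g) \<in> A \<longrightarrow> norm g \<le> K * norm f)}"

definition compact_ops :: "l2_op set" where
  "compact_ops = {A \<in> bounded_ops. compact (closure (A `` cball 0 1))}"

definition orthonormal_basis :: "l2 set \<Rightarrow> bool" where
  "orthonormal_basis E \<longleftrightarrow>
     (\<forall>e\<in>E. \<forall>e'\<in>E. cinner e e' = (if e = e' then 1 else 0)) \<and>
     (\<forall>f. (\<forall>e\<in>E. cinner e f = 0) \<longrightarrow> f = 0)"

text \<open>
  In the next two definitions the sum does not depend on the choice of the basis.
\<close>

definition hilbert_schmidt_ops :: "l2_op set" where
  "hilbert_schmidt_ops = {A \<in> bounded_ops.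
     \<exists>E. orthonormal_basis E \<and> (\<lambda>e. (norm (op_apply A e))\<^sup>2) summable_on E}"

definition abs_op :: "l2_op \<Rightarrow> l2_op" where
  "abs_op A = op_sqrt (adjoint_op A \<circ>\<^sub>o A)"

definition trace_class_ops :: "l2_op set" where
  "trace_class_ops = {A \<in> bounded_ops.
     \<exists>E. orthonormal_basis E \<and> (\<lambda>e. cinner e (op_apply (abs_op A) e)) summable_on E}"

definition mult_op :: "(real \<Rightarrow> real) \<Rightarrow> l2_op" where
  "mult_op V =
     {(f, g). AE x in lebesgue. rep_l2 g x = complex_of_real (V x) * rep_l2 f x}"

text \<open>
  With \<open>K\<close> in the role of the inverse square root of \<open>T\<close>, the following are the operator
  \<open>|V|\<^sup>1\<^sup>/\<^sup>2 K\<close> and the symmetrised product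
  \<open>[|V|\<^sup>1\<^sup>/\<^sup>2 K]* sgn(V) [|V|\<^sup>1\<^sup>/\<^sup>2 K]\<close>.
\<close>

definition sqrt_abs_mult :: "(real \<Rightarrow> real) \<Rightarrow> l2_op \<Rightarrow> l2_op" where
  "sqrt_abs_mult V K = mult_op (\<lambda>x. sqrt \<bar>V x\<bar>) \<circ>\<^sub>o K"

definition sym_product :: "(real \<Rightarrow> real) \<Rightarrow> l2_op \<Rightarrow> l2_op" where
  "sym_product V K =
     adjoint_op (sqrt_abs_mult V K) \<circ>\<^sub>o mult_op (\<lambda>x. sgn (V x)) \<circ>\<^sub>o sqrt_abs_mult V K"


section \<open>Function spaces on the line\<close>

definition L1_loc :: "(real \<Rightarrow> real) set" where
  "L1_loc = {f. \<forall>a b. set_integrable lebesgue {a..b} f}"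

definition L1_loc_unif :: "(real \<Rightarrow> real) set" where
  "L1_loc_unif =
     {f \<in> L1_loc. bdd_above (range (\<lambda>a. LINT x:{a..a+1}|lebesgue. \<bar>f x\<bar>))}"

definition AC_on :: "real \<Rightarrow> real \<Rightarrow> (real \<Rightarrow> complex) \<Rightarrow> bool" where
  "AC_on a b f \<longleftrightarrow>
     (\<forall>e>0. \<exists>d>0. \<forall>(n::nat) s t.
        (\<forall>i<n. a \<le> s i \<and> s i \<le> t i \<and> t i \<le> b) \<longrightarrow>
        (\<forall>i<n. \<forall>j<n. i \<noteq> j \<longrightarrow> {s i<..<t i} \<inter> {s j<..<t j} = {}) \<longrightarrow>
        (\<Sum>i<n. t i - s i) < d \<longrightarrow>
        (\<Sum>i<n. cmod (f (t i) - f (s i))) < e)"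

definition AC_loc :: "(real \<Rightarrow> complex) set" where
  "AC_loc = {f. \<forall>a b. a < b \<longrightarrow> AC_on a b f}"

definition test_function :: "(real \<Rightarrow> real) \<Rightarrow> bool" where
  "test_function \<phi> \<longleftrightarrow>
     (\<forall>k x. ((deriv ^^ k) \<phi>) field_differentiable (at x)) \<and> compact (closure {x. \<phi> x \<noteq> 0})"

text \<open>
  The Sobolev space \<open>H\<^sup>1\<close>: a weak derivative exists and is square integrable. Real test
  functions suffice, since complex ones are complex linear combinations of them.
\<close>

definition H1 :: "l2 set" where
  "H1 = {f. \<exists>g::l2. \<forall>\<phi>. test_function \<phi> \<longrightarrow>
     (LINT x|lebesgue. rep_l2 f x * complex_of_real (deriv \<phi> x)) =
     - (LINT x|lebesgue. rep_l2 g x * complex_of_real (\<phi> x))}"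


section \<open>Sturm--Liouville operators\<close>

text \<open>
  \<open>sturm_liouville p q u h\<close>: \<open>u\<close> and \<open>p u'\<close> are locally absolutely continuous and
  \<open>h = - (p u')' + q u\<close> almost everywhere. As \<open>p\<close> and \<open>u'\<close> are only given almost everywhere,
  \<open>w\<close> is the continuous version of \<open>p u'\<close>.
\<close>

definition sturm_liouville ::
    "(real \<Rightarrow> real) \<Rightarrow> (real \<Rightarrow> real) \<Rightarrow> (real \<Rightarrow> complex) \<Rightarrow> (real \<Rightarrow> complex) \<Rightarrow> bool" where
  "sturm_liouville p q u h \<longleftrightarrow> u \<in> AC_loc \<and>
     (\<exists>w\<in>AC_loc.
        (AE x in lebesgue. w x = complex_of_real (p x) * vector_derivative u (at x)) \<and>
        (AE x in lebesgue. h x = - vector_derivative w (at x) + complex_of_real (q x) * u x))"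

definition SL_op :: "(real \<Rightarrow> real) \<Rightarrow> (real \<Rightarrow> real) \<Rightarrow> l2_op" where
  "SL_op p q = {(f, g). \<exists>u. (AE x in lebesgue. rep_l2 f x = u x) \<and>
     sturm_liouville p q u (rep_l2 g)}"

definition SL_min :: "(real \<Rightarrow> real) \<Rightarrow> (real \<Rightarrow> real) \<Rightarrow> l2_op" where
  "SL_min p q = {(f, g). \<exists>u. (AE x in lebesgue. rep_l2 f x = u x) \<and>
     sturm_liouville p q u (rep_l2 g) \<and> compact (closure {x. u x \<noteq> 0})}"

end

theory Submission
  imports Defs "HOL-Library.Nat_Bijection"
begin

text \<open>
  Everything reduces to estimates for functions in \<open>H\<^sup>1\<close>. Put \<open>R = T\<^sup>-\<^sup>1\<^sup>/\<^sup>2\<close>. It is a bounded operator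
  whose range is the form domain \<open>H\<^sup>1\<close>. The graphs of \<open>T\<^sup>1\<^sup>/\<^sup>2\<close> and of the weak derivative are closed and
  have the same domain, so the closed graph theorem makes the form norm \<open>\<parallel>T\<^sup>1\<^sup>/\<^sup>2 f\<parallel>\<close> and the Sobolev
  norm equivalent: \<open>R h\<close> has a weak derivative \<open>g\<close> with \<open>\<parallel>R h\<parallel>\<^sup>2 + \<parallel>g\<parallel>\<^sup>2 \<le> C \<parallel>h\<parallel>\<^sup>2\<close> (\<open>H1_bound\<close>), and all
  translates of a smooth bump equal to one on a unit interval are of the form \<open>R h\<close> with the norms
  of the \<open>h\<close> bounded uniformly (\<open>bumps\<close>).

  The upper estimates rest on the Sobolev inequality on unit cells (\<open>local_sobolev_inequality\<close>): an
  \<open>H\<^sup>1\<close> function is continuous, and on a unit cell its square is bounded by twice the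
  integral of \<open>|f|\<^sup>2 + |f'|\<^sup>2\<close> over that cell. Multiplying by \<open>|V|\<close> and summing over the cells gives
  \<open>\<integral> |V| |f|\<^sup>2 \<le> 2 M \<parallel>f\<parallel>\<^sup>2\<close> in the norm of \<open>H\<^sup>1\<close>, where \<open>M\<close> bounds the integrals of \<open>|V|\<close> over unit cells
  (\<open>H1_weighted_bound\<close>). For \<open>V = r\<close> or
  \<open>V = r - r\<^sub>0\<close> this is boundedness of \<open>F = |V|\<^sup>1\<^sup>/\<^sup>2 R\<close>. If the cell integrals tend to zero at
  infinity, the part of \<open>F\<close> outside a large interval is small in norm, and inside the interval the
  Hoelder continuity of \<open>H\<^sup>1\<close> functions makes \<open>F\<close> a norm limit of finite-rank step approximations
  (\<open>weighted_approximation\<close>), so \<open>F\<close> is compact. If \<open>V\<close> is integrable, point evaluations of \<open>R h\<close> are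
  uniformly bounded functionals of \<open>h\<close>, and Bessel's inequality at every point followed by
  integration against \<open>|V|\<close> bounds the Hilbert--Schmidt norm (\<open>hilbert_schmidt_bound\<close>).

  The converses test \<open>F\<close> on the bumps. The bump over a unit interval has an image of squared norm at
  least the integral of \<open>|V|\<close> there. This settles boundedness. For compactness, bumps escaping to
  infinity have mutually orthogonal images, which cannot accumulate unless they tend to zero
  (\<open>compact_imp_averages_vanish\<close>). For the Hilbert--Schmidt property the adjoint is tested on the
  orthonormal pieces of \<open>|V|\<^sup>1\<^sup>/\<^sup>2\<close> over the cells (\<open>hilbert_schmidt_imp_integrable\<close>).

  The symmetrised product is \<open>B = F\<^sup>* U F\<close> with \<open>U\<close> multiplication by \<open>sgn V\<close>; it inherits boundedness
  and compactness. Its trace norm is controlled by two Hilbert--Schmidt norms through an approximate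
  polar decomposition (\<open>abs_trace_estimate\<close>).

  Both \<open>T\<^sup>1\<^sup>/\<^sup>2\<close> and \<open>|B|\<close> are given as the unique nonnegative self-adjoint square root, so existence and
  uniqueness of square roots come first. They are proved for bounded operators by a fixed point
  iteration (\<open>positive_sqrt\<close>) and transferred to \<open>T\<close> through its bounded inverse (\<open>op_sqrt_coercive\<close>).
\<close>

section \<open>Completeness of the space of square integrable functions\<close>

lemma square_integrable_rep_l2: "square_integrable (rep_l2 f)"
  using Quotient_rep_reflp[OF Quotient_l2, of f] by (simp add: l2_eq_def)

lemma rep_l2_measurable [measurable]: "rep_l2 f \<in> borel_measurable lebesgue"
  using square_integrable_rep_l2[of f] by (simp add: square_integrable_def)

lemma integrable_rep_l2_square: "integrable lebesgue (\<lambda>x. (cmod (rep_l2 f x))\<^sup>2)"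
  using square_integrable_rep_l2[of f] by (simp add: square_integrable_def)

lemma abs_rep_l2: "abs_l2 (rep_l2 f) = f"
  by (rule Quotient_abs_rep[OF Quotient_l2])

lemma rep_abs_l2:
  assumes "square_integrable f"
  shows "AE x in lebesgue. rep_l2 (abs_l2 f) x = f x"
  using Quotient_rep_abs[OF Quotient_l2, of f] assms by (simp add: l2_eq_def)

lemma l2_eqI:
  assumes "AE x in lebesgue. rep_l2 f x = rep_l2 g x"
  shows "f = g"
proof -
  have "l2_eq (rep_l2 f) (rep_l2 g)"
    using assms by (simp add: l2_eq_def square_integrable_rep_l2)
  then have "abs_l2 (rep_l2 f) = abs_l2 (rep_l2 g)"
    by (rule Quotient_rel_abs[OF Quotient_l2])
  then show ?thesis
    by (simp add: abs_rep_l2)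
qed

lemma l2_eq_rep_l2: "l2_eq (rep_l2 f) (rep_l2 f)"
  by (simp add: l2_eq_def square_integrable_rep_l2)

lemma rep_l2_scaleC: "AE x in lebesgue. rep_l2 (c *\<^sub>C f) x = c * rep_l2 f x"
  using rep_abs_l2[OF square_integrable_scale[OF square_integrable_rep_l2[of f]], of c]
    scaleC.abs_eq[OF l2_eq_rep_l2[of f], of c]
  by (simp add: abs_rep_l2)

lemma rep_l2_add: "AE x in lebesgue. rep_l2 (f + g) x = rep_l2 f x + rep_l2 g x"
  using rep_abs_l2[OF square_integrable_add[OF square_integrable_rep_l2[of f] square_integrable_rep_l2[of g]]]
    plus_l2.abs_eq[OF l2_eq_rep_l2[of f] l2_eq_rep_l2[of g]]
  by (simp add: abs_rep_l2)

lemma rep_l2_diff: "AE x in lebesgue. rep_l2 (f - g) x = rep_l2 f x - rep_l2 g x"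
  using rep_abs_l2[OF square_integrable_diff[OF square_integrable_rep_l2[of f] square_integrable_rep_l2[of g]]]
    minus_l2.abs_eq[OF l2_eq_rep_l2[of f] l2_eq_rep_l2[of g]]
  by (simp add: abs_rep_l2)

lemma rep_l2_zero: "AE x in lebesgue. rep_l2 0 x = 0"
  using rep_abs_l2[OF square_integrable_zero] by (simp add: zero_l2_def)

lemma rep_l2_sum:
  "AE x in lebesgue. rep_l2 (\<Sum>i\<in>I. f i) x = (\<Sum>i\<in>I. rep_l2 (f i) x)"
proof (induction I rule: infinite_finite_induct)
  case (insert i I)
  show ?case
    using rep_l2_add[of "f i" "sum f I"] insert(3)
    by eventually_elim (simp add: insert(1,2))
qed (simp_all add: rep_l2_zero)

lemma cinner_rep_l2: "cinner f g = (LINT x|lebesgue. cnj (rep_l2 f x) * rep_l2 g x)"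
  using cinner.abs_eq[OF l2_eq_rep_l2[of f] l2_eq_rep_l2[of g]] by (simp add: abs_rep_l2)

lemma cinner_add_left: "cinner (f + g) h = cinner f h + cinner g h"
  by transfer (auto simp: l2_eq_def distrib_right square_integrable_cnj_mult)

lemma cinner_add_right: "cinner h (f + g) = cinner h f + cinner h g"
  by transfer (auto simp: l2_eq_def distrib_left square_integrable_cnj_mult)

lemma cinner_scaleC_left: "cinner (c *\<^sub>C f) g = cnj c * cinner f g"
  by transfer (simp add: mult.assoc)

lemma cinner_scaleC_right: "cinner f (c *\<^sub>C g) = c * cinner f g"
  by transfer (simp add: mult.left_commute)

lemma cinner_commute: "cinner f g = cnj (cinner g f)"
proof transfer
  fix f g assume "l2_eq f f" "l2_eq g g"
  have "(LINT x|lebesgue. cnj (f x) * g x) = (LINT x|lebesgue. cnj (cnj (g x) * f x))"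
    by (simp add: mult.commute)
  also have "\<dots> = cnj (LINT x|lebesgue. cnj (g x) * f x)"
    by (rule Bochner_Integration.integral_cnj)
  finally show "(LINT x|lebesgue. cnj (f x) * g x) = cnj (LINT x|lebesgue. cnj (g x) * f x)" .
qed

lemma scaleC_of_real: "complex_of_real a *\<^sub>C f = a *\<^sub>R f"
  by (simp add: scaleR_l2_def)

lemma scaleC_scaleC: "a *\<^sub>C b *\<^sub>C f = (a * b) *\<^sub>C f"
  by transfer (auto simp: l2_eq_def mult.assoc intro!: square_integrable_scale)

lemma scaleC_one [simp]: "1 *\<^sub>C f = f"
  using scaleC_of_real[of 1 f] by simp

lemma scaleC_zero_left [simp]: "0 *\<^sub>C f = 0"
  using scaleC_of_real[of 0 f] by simp

lemma scaleC_minus_one: "(-1) *\<^sub>C f = - f"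
  using scaleC_of_real[of "-1" f] by simp

lemma scaleC_add_right: "c *\<^sub>C (f + g) = c *\<^sub>C f + c *\<^sub>C g"
  by transfer
    (auto simp: l2_eq_def distrib_left intro!: square_integrable_scale square_integrable_add)

lemma scaleC_add_left: "(a + b) *\<^sub>C f = a *\<^sub>C f + b *\<^sub>C f"
  by transfer
    (auto simp: l2_eq_def distrib_right intro!: square_integrable_scale square_integrable_add)

lemma cinner_zero_left [simp]: "cinner 0 f = 0"
  using cinner_scaleC_left[of 0 0 f] by simp

lemma cinner_zero_right [simp]: "cinner f 0 = 0"
  using cinner_scaleC_right[of f 0 0] by simp

lemma cinner_diff_left: "cinner (f - g) h = cinner f h - cinner g h"
  using cinner_add_left[of f "- g" h] cinner_scaleC_left[of "-1" g h]
  by (simp add: scaleC_minus_one)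

lemma cinner_diff_right: "cinner h (f - g) = cinner h f - cinner h g"
  using cinner_add_right[of h f "- g"] cinner_scaleC_right[of h "-1" g]
  by (simp add: scaleC_minus_one)

lemma cinner_sum_left: "cinner (\<Sum>i\<in>I. f i) g = (\<Sum>i\<in>I. cinner (f i) g)"
  by (induction I rule: infinite_finite_induct) (simp_all add: cinner_add_left)

lemma cinner_sum_right: "cinner f (\<Sum>i\<in>I. g i) = (\<Sum>i\<in>I. cinner f (g i))"
  by (induction I rule: infinite_finite_induct) (simp_all add: cinner_add_right)

lemma cinner_self: "cinner f f = complex_of_real ((norm f)\<^sup>2)"
proof -
  have "Im (cinner f f) = 0"
    using arg_cong[OF cinner_commute[of f f], of Im] by simp
  moreover have "Re (cinner f f) = (norm f)\<^sup>2"
    by (simp add: power2_norm_eq_inner inner_l2_def)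
  ultimately show ?thesis
    by (simp add: complex_eq_iff)
qed

lemma cinner_eq_inner:
  "cinner f g = complex_of_real (inner f g) - \<i> * complex_of_real (inner f (\<i> *\<^sub>C g))"
  by (simp add: inner_l2_def cinner_scaleC_right complex_eq_iff)

lemma norm_l2_square: "(norm f)\<^sup>2 = (LINT x|lebesgue. (cmod (rep_l2 f x))\<^sup>2)"
proof -
  have "complex_of_real ((norm f)\<^sup>2) = (LINT x|lebesgue. cnj (rep_l2 f x) * rep_l2 f x)"
    by (simp only: cinner_rep_l2 [symmetric] cinner_self)
  also have "\<dots> = complex_of_real (LINT x|lebesgue. (cmod (rep_l2 f x))\<^sup>2)"
    unfolding integral_complex_of_real[symmetric] complex_norm_square by (simp add: mult.commute)
  finally show ?thesis
    using of_real_eq_iff by blast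
qed

lemma nn_integral_rep_l2_square:
  "(\<integral>\<^sup>+x. ennreal ((cmod (rep_l2 f x))\<^sup>2) \<partial>lebesgue) = ennreal ((norm f)\<^sup>2)"
  by (simp add: norm_l2_square integrable_rep_l2_square nn_integral_eq_integral)

lemma norm_scaleC: "norm (c *\<^sub>C f) = cmod c * norm f"
proof -
  have "complex_of_real ((norm (c *\<^sub>C f))\<^sup>2) = complex_of_real ((cmod c * norm f)\<^sup>2)"
    unfolding cinner_self[symmetric] cinner_scaleC_left cinner_scaleC_right
    using complex_norm_square[of c]
    by (simp add: cinner_self power_mult_distrib mult.commute mult.left_commute)
  then have "(norm (c *\<^sub>C f))\<^sup>2 = (cmod c * norm f)\<^sup>2"
    using of_real_eq_iff by blast
  then show ?thesis
    by (simp add: power2_eq_iff_nonneg)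
qed

lemma cinner_cauchy_schwarz: "cmod (cinner f g) \<le> norm f * norm g"
proof (cases "cinner f g = 0")
  case False
  \<comment> \<open>Rotating \<open>g\<close> makes the inner product real, so that the real inequality applies.\<close>
  define c where "c = cnj (cinner f g) / complex_of_real (cmod (cinner f g))"
  have "cmod c = 1"
    using False by (simp add: c_def norm_divide)
  have "c * cinner f g = complex_of_real (cmod (cinner f g))"
    using False complex_norm_square[of "cinner f g"]
    by (simp add: c_def field_simps power2_eq_square)
  then have "cmod (cinner f g) = inner f (c *\<^sub>C g)"
    by (simp add: inner_l2_def cinner_scaleC_right)
  also have "\<dots> \<le> norm f * norm (c *\<^sub>C g)"
    by (rule norm_cauchy_schwarz)
  finally show ?thesis
    by (simp add: norm_scaleC \<open>cmod c = 1\<close>)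
qed simp

lemma bounded_bilinear_cinner: "bounded_bilinear cinner"
proof
  fix a a' b b' :: l2 and r :: real
  show "cinner (r *\<^sub>R a) b = r *\<^sub>R cinner a b"
    unfolding scaleC_of_real[symmetric] cinner_scaleC_left by (simp add: scaleR_conv_of_real)
  show "cinner a (r *\<^sub>R b) = r *\<^sub>R cinner a b"
    unfolding scaleC_of_real[symmetric] cinner_scaleC_right by (simp add: scaleR_conv_of_real)
  show "\<exists>K. \<forall>a b. norm (cinner a b) \<le> norm a * norm b * K"
    by (rule exI[of _ 1]) (simp add: cinner_cauchy_schwarz)
qed (simp_all add: cinner_add_left cinner_add_right)

lemmas tendsto_cinner = bounded_bilinear.tendsto[OF bounded_bilinear_cinner]

lemma bounded_linear_scaleC: "bounded_linear (\<lambda>f. c *\<^sub>C f)"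
proof (rule bounded_linear_intro[of _ "cmod c"])
  show "c *\<^sub>C r *\<^sub>R f = r *\<^sub>R c *\<^sub>C f" for r f
    by (simp only: scaleC_of_real[symmetric] scaleC_scaleC mult.commute)
qed (simp_all add: scaleC_add_right norm_scaleC)

lemmas tendsto_scaleC = bounded_linear.tendsto[OF bounded_linear_scaleC]

lemma l2_eq_if_cinner_eq:
  assumes "\<And>h. cinner h f = cinner h g"
  shows "f = g"
  using assms[of "f - g"] cinner_self[of "f - g"] by (simp add: cinner_diff_right)

text \<open>
  Riesz--Fischer. Along a subsequence with \<open>\<parallel>d\<^sub>n\<parallel> \<le> 2\<^sup>-\<^sup>n\<close> for the increments \<open>d\<^sub>n\<close>, the function
  \<open>\<Sum>\<^sub>n 2\<^sup>n |d\<^sub>n|\<^sup>2\<close> is integrable, hence finite almost everywhere; there \<open>|d\<^sub>n|\<close> decays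
  geometrically, so the subsequence converges pointwise, and Fatou's lemma upgrades this to
  convergence in norm.
\<close>

instance l2 :: complete_space
proof
  fix X :: "nat \<Rightarrow> l2" assume "Cauchy X"
  then have ex: "\<exists>N. \<forall>m\<ge>N. \<forall>n\<ge>N. norm (X m - X n) < e" if "e > 0" for e
    using that by (auto simp: Cauchy_def dist_norm)
  have "\<forall>k. \<exists>N. \<forall>m\<ge>N. \<forall>n\<ge>N. norm (X m - X n) < (1/2)^k"
    by (intro allI ex) simp
  then obtain N where N: "\<And>k m n. m \<ge> N k \<Longrightarrow> n \<ge> N k \<Longrightarrow> norm (X m - X n) < (1/2)^k"
    unfolding choice_iff by blast
  define s where "s k = (\<Sum>i\<le>k. N i)" for k
  have sN: "N k \<le> s l" if "k \<le> l" for k l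
    unfolding s_def using that by (intro member_le_sum) auto
  define f where "f k = rep_l2 (X (s k))" for k
  define d where "d k x = rep_l2 (X (s (Suc k)) - X (s k)) x" for k x
  have [measurable]: "f k \<in> borel_measurable lebesgue" "d k \<in> borel_measurable lebesgue" for k
    unfolding f_def d_def by measurable
  have "AE x in lebesgue. d k x = f (Suc k) x - f k x" for k
    unfolding d_def f_def by (rule rep_l2_diff)
  then have AE_d: "AE x in lebesgue. \<forall>k. d k x = f (Suc k) x - f k x"
    by (simp add: AE_all_countable)
  have norm_d: "(\<integral>\<^sup>+x. ennreal (2^k * (cmod (d k x))\<^sup>2) \<partial>lebesgue) \<le> ennreal ((1/2)^k)" for k
  proof -
    have "norm (X (s (Suc k)) - X (s k)) \<le> (1/2)^k"
      by (intro less_imp_le[OF N] sN) auto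
    then have "(norm (X (s (Suc k)) - X (s k)))\<^sup>2 \<le> ((1/2)^k)\<^sup>2"
      by (intro power_mono) auto
    then have le: "2^k * (norm (X (s (Suc k)) - X (s k)))\<^sup>2 \<le> 2^k * ((1/2)^k)\<^sup>2"
      by (intro mult_left_mono) auto
    have "(2::real)^k * ((1/2)^k)\<^sup>2 = (2 * (1/2))^k * (1/2)^k"
      by (simp only: power_mult_distrib power2_eq_square mult.assoc)
    then have le: "2^k * (norm (X (s (Suc k)) - X (s k)))\<^sup>2 \<le> (1/2)^k"
      using le by simp
    have "(\<integral>\<^sup>+x. ennreal (2^k * (cmod (d k x))\<^sup>2) \<partial>lebesgue)
        = ennreal (2^k) * (\<integral>\<^sup>+x. ennreal ((cmod (d k x))\<^sup>2) \<partial>lebesgue)"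
      by (simp add: ennreal_mult nn_integral_cmult)
    also have "\<dots> = ennreal (2^k * (norm (X (s (Suc k)) - X (s k)))\<^sup>2)"
      unfolding d_def nn_integral_rep_l2_square by (simp add: ennreal_mult)
    finally show ?thesis
      using le by (simp add: ennreal_leI)
  qed
  have "(\<integral>\<^sup>+x. (\<Sum>k. ennreal (2^k * (cmod (d k x))\<^sup>2)) \<partial>lebesgue)
      = (\<Sum>k. \<integral>\<^sup>+x. ennreal (2^k * (cmod (d k x))\<^sup>2) \<partial>lebesgue)"
    by (rule nn_integral_suminf) measurable
  also have "\<dots> \<le> (\<Sum>k. ennreal ((1/2)^k))"
    by (intro suminf_le norm_d) auto
  also have "\<dots> < \<infinity>"
    using summable_geometric[of "1/2::real"] by (subst suminf_ennreal_eq) (auto simp: sums_iff)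
  finally have "AE x in lebesgue. (\<Sum>k. ennreal (2^k * (cmod (d k x))\<^sup>2)) \<noteq> \<infinity>"
    by (intro nn_integral_PInf_AE) auto
  then have AE_conv: "AE x in lebesgue. convergent (\<lambda>k. f k x)"
    using AE_d
  proof eventually_elim
    case (elim x)
    have finite: "\<exists>M\<ge>0. S = ennreal M" if "S \<noteq> \<infinity>" for S :: ennreal
      using that by (cases S) auto
    have term_le: "a k \<le> suminf a" for a :: "nat \<Rightarrow> ennreal" and k
      using sum_le_suminf[of a "{k}"] by simp
    obtain M where M: "0 \<le> M" "(\<Sum>k. ennreal (2^k * (cmod (d k x))\<^sup>2)) = ennreal M"
      using finite[OF elim(1)] by blast
    have bound: "cmod (d k x) \<le> sqrt M * (sqrt (1/2))^k" for k
    proof -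
      have "ennreal (2^k * (cmod (d k x))\<^sup>2) \<le> ennreal M"
        using term_le[of "\<lambda>k. ennreal (2^k * (cmod (d k x))\<^sup>2)" k] unfolding M(2) .
      then have "2^k * (cmod (d k x))\<^sup>2 \<le> M"
        using M(1) by (simp only: ennreal_le_iff)
      then have "(cmod (d k x))\<^sup>2 \<le> M * (1/2)^k"
        by (simp add: field_simps power_divide)
      then have "cmod (d k x) \<le> sqrt (M * (1/2)^k)"
        by (rule real_le_rsqrt)
      then show ?thesis
        by (simp add: real_sqrt_mult real_sqrt_power)
    qed
    have "summable (\<lambda>k. sqrt M * (sqrt (1/2))^k)"
      by (intro summable_mult summable_geometric) simp
    then have "summable (\<lambda>k. d k x)"
      by (rule summable_comparison_test'[where N=0]) (use bound in auto)
    then have "convergent (\<lambda>n. \<Sum>k<n. d k x)"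
      by (simp add: summable_iff_convergent)
    moreover have "(\<Sum>k<n. d k x) = f n x - f 0 x" for n
      using elim(2) by (induction n) auto
    ultimately have "convergent (\<lambda>n. (f n x - f 0 x) + f 0 x)"
      by (intro convergent_add convergent_const) simp
    then show ?case
      by simp
  qed
  define g where "g x = lim (\<lambda>k. f k x)" for x
  have [measurable]: "g \<in> borel_measurable lebesgue"
    unfolding g_def by measurable
  have dist_g: "(\<integral>\<^sup>+x. ennreal ((cmod (g x - rep_l2 (X n) x))\<^sup>2) \<partial>lebesgue) \<le> ennreal (((1/2)^k)\<^sup>2)"
    if "n \<ge> N k" for n k
  proof -
    have "(\<integral>\<^sup>+x. ennreal ((cmod (g x - rep_l2 (X n) x))\<^sup>2) \<partial>lebesgue)
        = (\<integral>\<^sup>+x. liminf (\<lambda>m. ennreal ((cmod (f m x - rep_l2 (X n) x))\<^sup>2)) \<partial>lebesgue)"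
    proof (rule nn_integral_cong_AE)
      show "AE x in lebesgue. ennreal ((cmod (g x - rep_l2 (X n) x))\<^sup>2)
          = liminf (\<lambda>m. ennreal ((cmod (f m x - rep_l2 (X n) x))\<^sup>2))"
        using AE_conv
      proof eventually_elim
        case (elim x)
        then have "(\<lambda>m. f m x) \<longlonglongrightarrow> g x"
          by (simp add: g_def convergent_LIMSEQ_iff)
        then have "(\<lambda>m. ennreal ((cmod (f m x - rep_l2 (X n) x))\<^sup>2))
            \<longlonglongrightarrow> ennreal ((cmod (g x - rep_l2 (X n) x))\<^sup>2)"
          by (intro tendsto_ennrealI tendsto_intros)
        then show ?case
          by (intro lim_imp_Liminf[symmetric]) auto
      qed
    qed
    also have "\<dots> \<le> liminf (\<lambda>m. \<integral>\<^sup>+x. ennreal ((cmod (f m x - rep_l2 (X n) x))\<^sup>2) \<partial>lebesgue)"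
      by (rule nn_integral_liminf) measurable
    also have "\<dots> \<le> liminf (\<lambda>m. ennreal (((1/2)^k)\<^sup>2))"
    proof (rule Liminf_mono)
      show "\<forall>\<^sub>F m in sequentially. (\<integral>\<^sup>+x. ennreal ((cmod (f m x - rep_l2 (X n) x))\<^sup>2) \<partial>lebesgue)
          \<le> ennreal (((1/2)^k)\<^sup>2)"
        using eventually_ge_at_top[of k]
      proof eventually_elim
        case (elim m)
        have "(\<integral>\<^sup>+x. ennreal ((cmod (f m x - rep_l2 (X n) x))\<^sup>2) \<partial>lebesgue)
            = (\<integral>\<^sup>+x. ennreal ((cmod (rep_l2 (X (s m) - X n) x))\<^sup>2) \<partial>lebesgue)"
          by (rule nn_integral_cong_AE, use rep_l2_diff[of "X (s m)" "X n"] in eventually_elim)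
            (simp add: f_def)
        also have "\<dots> = ennreal ((norm (X (s m) - X n))\<^sup>2)"
          by (rule nn_integral_rep_l2_square)
        also have "\<dots> \<le> ennreal (((1/2)^k)\<^sup>2)"
          by (intro ennreal_leI power_mono less_imp_le[OF N] sN) (use elim that in auto)
        finally show ?case .
      qed
    qed
    finally show ?thesis
      by (simp add: Liminf_const)
  qed
  have sq: "square_integrable (\<lambda>x. g x - rep_l2 (X n) x)" if "n \<ge> N k" for n k
  proof -
    have "(\<integral>\<^sup>+x. ennreal (norm ((cmod (g x - rep_l2 (X n) x))\<^sup>2)) \<partial>lebesgue) < \<infinity>"
      using dist_g[OF that] by (auto simp: less_top[symmetric] top_unique)
    then show ?thesis
      unfolding square_integrable_def by (auto simp: integrable_iff_bounded)
  qed
  have "square_integrable (\<lambda>x. (g x - rep_l2 (X (N 0)) x) + rep_l2 (X (N 0)) x)"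
    by (intro square_integrable_add sq square_integrable_rep_l2) auto
  then have sq_g: "square_integrable g"
    by simp
  have "norm (X n - abs_l2 g) \<le> (1/2)^k" if "n \<ge> N k" for n k
  proof -
    have "ennreal ((norm (abs_l2 g - X n))\<^sup>2)
        = (\<integral>\<^sup>+x. ennreal ((cmod (g x - rep_l2 (X n) x))\<^sup>2) \<partial>lebesgue)"
      unfolding nn_integral_rep_l2_square[symmetric]
      by (rule nn_integral_cong_AE,
          use rep_l2_diff[of "abs_l2 g" "X n"] rep_abs_l2[OF sq_g] in eventually_elim) simp
    also have "\<dots> \<le> ennreal (((1/2)^k)\<^sup>2)"
      by (rule dist_g[OF that])
    finally have "(norm (abs_l2 g - X n))\<^sup>2 \<le> ((1/2)^k)\<^sup>2"
      by (simp only: ennreal_le_iff zero_le_power2)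
    then have "norm (abs_l2 g - X n) \<le> (1/2)^k"
      by (rule power2_le_imp_le) simp
    then show ?thesis
      by (simp add: norm_minus_commute)
  qed
  then have "\<exists>M. \<forall>n\<ge>M. norm (X n - abs_l2 g) < e" if "e > 0" for e
  proof -
    obtain k where "(1/2)^k < e"
      using real_arch_pow_inv[OF \<open>e > 0\<close>, of "1/2"] by auto
    then show ?thesis
      using \<open>\<And>n k. n \<ge> N k \<Longrightarrow> norm (X n - abs_l2 g) \<le> (1/2)^k\<close>
      by (intro exI[of _ "N k"]) (auto intro: le_less_trans)
  qed
  then have "X \<longlonglongrightarrow> abs_l2 g"
    by (intro LIMSEQ_I) auto
  then show "convergent X"
    by (rule convergentI)
qed

text \<open>
  In a minimising sequence for the distance to the subspace the parallelogram law turns almost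
  minimal distances into a Cauchy estimate, and minimality at the limit is orthogonality.
\<close>

theorem orthogonal_projection:
  fixes M :: "'a :: {real_inner, complete_space} set"
  assumes "closed M" "subspace M"
  obtains m where "m \<in> M" "\<And>n. n \<in> M \<Longrightarrow> inner (f - m) n = 0"
proof -
  define D where "D = (INF m\<in>M. (norm (f - m))\<^sup>2)"
  have "0 \<in> M"
    using assms(2) by (rule subspace_0)
  have D_le: "D \<le> (norm (f - m))\<^sup>2" if "m \<in> M" for m
    unfolding D_def using that by (intro cINF_lower bdd_belowI2[of _ 0]) auto
  have "\<exists>m\<in>M. (norm (f - m))\<^sup>2 < D + (1/2)^k" for k
  proof (rule ccontr)
    assume "\<not> ?thesis"
    then have "D + (1/2)^k \<le> D"
      unfolding D_def by (intro cINF_greatest) (use \<open>0 \<in> M\<close> in \<open>auto simp: D_def not_less\<close>)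
    then show False
      using zero_less_power[of "1/2::real" k] by linarith
  qed
  then obtain a where a: "\<And>k. a k \<in> M" "\<And>k. (norm (f - a k))\<^sup>2 < D + (1/2)^k"
    by metis
  have close: "(norm (x - y))\<^sup>2 \<le> 2 * (norm (f - x))\<^sup>2 + 2 * (norm (f - y))\<^sup>2 - 4 * D"
    if "x \<in> M" "y \<in> M" for x y
  proof -
    have "(1/2) *\<^sub>R (x + y) \<in> M"
      using that assms(2) by (simp add: subspace_add subspace_scale)
    then have "D \<le> (norm (f - (1/2) *\<^sub>R (x + y)))\<^sup>2"
      by (rule D_le)
    moreover have "(norm (x - y))\<^sup>2 + 4 * (norm (f - (1/2) *\<^sub>R (x + y)))\<^sup>2
        = 2 * (norm (f - x))\<^sup>2 + 2 * (norm (f - y))\<^sup>2"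
      unfolding power2_norm_eq_inner by (simp add: algebra_simps inner_commute)
    ultimately show ?thesis by simp
  qed
  have "Cauchy a"
  proof (rule CauchyI)
    fix e :: real assume "e > 0"
    obtain k where k: "(1/2)^k < e\<^sup>2 / 4"
      using real_arch_pow_inv[of "e\<^sup>2 / 4" "1/2"] \<open>e > 0\<close> by auto
    have "norm (a m - a n) < e" if "m \<ge> k" "n \<ge> k" for m n
    proof -
      have "(1/2)^m \<le> (1/2::real)^k" "(1/2)^n \<le> (1/2::real)^k"
        using that by (auto intro: power_decreasing)
      then have "(norm (a m - a n))\<^sup>2 < e\<^sup>2"
        using close[OF a(1) a(1), of m n] a(2)[of m] a(2)[of n] k by linarith
      then show ?thesis
        using \<open>e > 0\<close> by (simp add: power2_less_imp_less)
    qed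
    then show "\<exists>k. \<forall>m\<ge>k. \<forall>n\<ge>k. norm (a m - a n) < e"
      by blast
  qed
  then obtain m where m: "a \<longlonglongrightarrow> m"
    using Cauchy_convergent_iff convergent_def by blast
  have "m \<in> M"
    using assms(1) a(1) m by (rule closed_sequentially)
  have "(norm (f - m))\<^sup>2 \<le> D"
  proof (rule LIMSEQ_le)
    show "(\<lambda>k. (norm (f - a k))\<^sup>2) \<longlonglongrightarrow> (norm (f - m))\<^sup>2"
      by (intro tendsto_intros m)
    have "(\<lambda>k. D + (1/2)^k) \<longlonglongrightarrow> D + 0"
      by (intro tendsto_intros LIMSEQ_power_zero) simp
    then show "(\<lambda>k. D + (1/2)^k) \<longlonglongrightarrow> D" by simp
    show "\<exists>N. \<forall>n\<ge>N. (norm (f - a n))\<^sup>2 \<le> D + (1/2)^n"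
      using a(2) less_imp_le by blast
  qed
  have "inner (f - m) n = 0" if "n \<in> M" for n
  proof (cases "n = 0")
    case False
    define t where "t = inner (f - m) n / inner n n"
    have "m + t *\<^sub>R n \<in> M"
      using \<open>m \<in> M\<close> that assms(2) by (simp add: subspace_add subspace_scale)
    then have "(norm (f - m))\<^sup>2 \<le> (norm (f - (m + t *\<^sub>R n)))\<^sup>2"
      using D_le \<open>(norm (f - m))\<^sup>2 \<le> D\<close> by (meson order_trans)
    also have "(norm (f - (m + t *\<^sub>R n)))\<^sup>2
        = (norm (f - m))\<^sup>2 - 2 * t * inner (f - m) n + t\<^sup>2 * inner n n"
      unfolding power2_norm_eq_inner by (simp add: algebra_simps inner_commute power2_eq_square)
    also have "\<dots> = (norm (f - m))\<^sup>2 - (inner (f - m) n)\<^sup>2 / inner n n"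
      using False by (simp add: t_def field_simps power2_eq_square)
    finally have "(inner (f - m) n)\<^sup>2 / inner n n \<le> 0"
      by simp
    moreover have "inner n n > 0"
      using False by simp
    ultimately have "(inner (f - m) n)\<^sup>2 \<le> 0"
      by (simp only: divide_le_0_iff) linarith
    then show ?thesis
      by simp
  qed simp
  with \<open>m \<in> M\<close> show ?thesis
    by (rule that)
qed

definition complex_subspace :: "l2 set \<Rightarrow> bool" where
  "complex_subspace M \<longleftrightarrow> 0 \<in> M \<and> (\<forall>f\<in>M. \<forall>g\<in>M. f + g \<in> M) \<and> (\<forall>c. \<forall>f\<in>M. c *\<^sub>C f \<in> M)"

lemma orthogonal_projection_complex:
  assumes "closed M" "complex_subspace M"
  obtains m where "m \<in> M" "\<And>n. n \<in> M \<Longrightarrow> cinner (f - m) n = 0"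
proof -
  have "subspace M"
    using assms(2) by (auto simp: complex_subspace_def subspace_def scaleR_l2_def)
  then obtain m where m: "m \<in> M" "\<And>n. n \<in> M \<Longrightarrow> inner (f - m) n = 0"
    using orthogonal_projection[OF assms(1)] by metis
  have "cinner (f - m) n = 0" if "n \<in> M" for n
    using m(2)[of n] m(2)[of "\<i> *\<^sub>C n"] that assms(2)
    by (simp add: cinner_eq_inner complex_subspace_def)
  then show ?thesis
    using m(1) that by blast
qed

lemma closed_complex_subspace_eq_UNIV:
  assumes "closed M" "complex_subspace M" "\<And>h. (\<And>m. m \<in> M \<Longrightarrow> cinner h m = 0) \<Longrightarrow> h = 0"
  shows "M = UNIV"
proof -
  have "f \<in> M" for f
    using orthogonal_projection_complex[OF assms(1,2), of f] assms(3) by (metis eq_iff_diff_eq_0)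
  then show ?thesis by blast
qed

text \<open>
  The representing vector is a multiple of any vector orthogonal to the kernel of the functional.
\<close>

lemma riesz_representation:
  assumes add: "\<And>f g. \<phi> (f + g) = \<phi> f + \<phi> g" and scale: "\<And>c f. \<phi> (c *\<^sub>C f) = c * \<phi> f"
    and bound: "\<And>f. cmod (\<phi> f) \<le> K * norm f"
  obtains h where "\<And>f. \<phi> f = cinner h f"
proof (cases "\<forall>f. \<phi> f = 0")
  case True
  then show ?thesis using that[of 0] by simp
next
  case False
  then obtain f where f: "\<phi> f \<noteq> 0" by blast
  define M where "M = {f. \<phi> f = 0}"
  have lin: "bounded_linear \<phi>"
  proof (rule bounded_linear_intro[of _ K])
    show "\<phi> (r *\<^sub>R x) = r *\<^sub>R \<phi> x" for r x
      using scale[of "complex_of_real r" x] by (simp add: scaleC_of_real scaleR_conv_of_real)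
  qed (use add bound in \<open>auto simp: mult.commute\<close>)
  then have diff: "\<phi> (f - g) = \<phi> f - \<phi> g" for f g
    by (simp add: bounded_linear.linear linear_diff)
  have "closed M"
    unfolding M_def by (intro closed_Collect_eq linear_continuous_on lin continuous_on_const)
  moreover have "complex_subspace M"
    using scale[of 0 0] by (auto simp: M_def complex_subspace_def add scale)
  ultimately obtain m where m: "m \<in> M" "\<And>n. n \<in> M \<Longrightarrow> cinner (f - m) n = 0"
    using orthogonal_projection_complex by metis
  define g where "g = f - m"
  have "\<phi> g \<noteq> 0"
    using f m(1) by (simp add: g_def diff M_def)
  then have "g \<noteq> 0"
    using scale[of 0 0] by auto
  have "\<phi> k = cinner (cnj (\<phi> g / cinner g g) *\<^sub>C g) k" for k
  proof -
    have "\<phi> (k - (\<phi> k / \<phi> g) *\<^sub>C g) = 0"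
      using \<open>\<phi> g \<noteq> 0\<close> by (simp add: diff scale)
    then have "cinner g (k - (\<phi> k / \<phi> g) *\<^sub>C g) = 0"
      unfolding g_def by (intro m(2)) (simp add: M_def)
    then show ?thesis
      using \<open>g \<noteq> 0\<close> \<open>\<phi> g \<noteq> 0\<close>
      by (simp add: cinner_diff_right cinner_scaleC_left cinner_scaleC_right cinner_self field_simps)
  qed
  then show ?thesis by (rule that)
qed

instance l2 :: banach ..

section \<open>Square roots of bounded positive operators\<close>

text \<open>
  With \<open>0 \<le> B \<le> 1\<close> and \<open>C = 1 - B\<close>, the root is \<open>1 - Y\<close> where \<open>Y\<close> solves \<open>Y = (C + Y\<^sup>2) / 2\<close>. The
  fixed point iteration started at \<open>0\<close> is dominated by the same iteration \<open>y \<mapsto> (1 + y\<^sup>2) / 2\<close> for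
  numbers, which increases to \<open>1\<close>; this gives convergence in operator norm. All iterates are
  polynomials in \<open>B\<close>, whence the root commutes with everything that commutes with \<open>B\<close>.
\<close>

lemma positive_sqrt_contraction:
  fixes B :: "'a :: {real_inner, banach} \<Rightarrow>\<^sub>L 'a"
  assumes sym: "\<And>f g. inner (B f) g = inner f (B g)" and pos: "\<And>f. 0 \<le> inner f (B f)"
    and norm: "norm B \<le> 1"
  obtains R :: "'a \<Rightarrow>\<^sub>L 'a" where "\<And>f g. inner (R f) g = inner f (R g)" "\<And>f. 0 \<le> inner f (R f)"
    "\<And>f. R (R f) = B f"
    "\<And>(G :: 'a \<Rightarrow>\<^sub>L 'a) f. (\<And>f. G (B f) = B (G f)) \<Longrightarrow> G (R f) = R (G f)"
proof -
  define C where "C = id_blinfun - B"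
  have C_apply: "C f = f - B f" for f
    by (simp add: C_def blinfun.diff_left)
  have norm_B: "norm (B f) \<le> norm f" for f
    using norm_blinfun[of B f] norm mult_right_mono[OF norm, of "norm f"] by auto
  have "norm (C f) \<le> 1 * norm f" for f
  proof -
    \<comment> \<open>Positivity of \<open>B\<close> at \<open>f - B f\<close> yields \<open>\<parallel>B f\<parallel>\<^sup>2 \<le> \<langle>f, B f\<rangle>\<close>.\<close>
    have "0 \<le> inner (f - B f) (B (f - B f))"
      by (rule pos)
    also have "\<dots> = inner f (B f) - 2 * (norm (B f))\<^sup>2 + inner (B f) (B (B f))"
      unfolding power2_norm_eq_inner
      by (simp add: blinfun.diff_right inner_diff_left inner_diff_right sym[symmetric])
    also have "inner (B f) (B (B f)) \<le> (norm (B f))\<^sup>2"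
      using norm_cauchy_schwarz[of "B f" "B (B f)"]
        mult_left_mono[OF norm_B[of "B f"], of "norm (B f)"]
      by (simp add: power2_eq_square)
    finally have "(norm (B f))\<^sup>2 \<le> inner f (B f)"
      by simp
    moreover have "(norm (C f))\<^sup>2 = (norm f)\<^sup>2 - 2 * inner f (B f) + (norm (B f))\<^sup>2"
      unfolding power2_norm_eq_inner C_apply
      by (simp add: inner_diff_left inner_diff_right inner_commute)
    ultimately have "(norm (C f))\<^sup>2 \<le> (norm f)\<^sup>2"
      using pos[of f] by linarith
    then show ?thesis
      using power2_le_imp_le by auto
  qed
  then have norm_C: "norm C \<le> 1"
    by (intro norm_blinfun_bound) auto
  define Y where "Y = rec_nat 0 (\<lambda>_ Y. (1/2) *\<^sub>R (C + (Y o\<^sub>L Y)))"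
  define y where "y = rec_nat 0 (\<lambda>_ y. (1 + y\<^sup>2) / 2 :: real)"
  have Y: "Y 0 = 0" "\<And>n. Y (Suc n) = (1/2) *\<^sub>R (C + (Y n o\<^sub>L Y n))"
    by (simp_all add: Y_def)
  have y: "y 0 = 0" "\<And>n. y (Suc n) = (1 + (y n)\<^sup>2) / 2"
    by (simp_all add: y_def)
  have y_bounds: "0 \<le> y n \<and> y n \<le> 1" for n
  proof (induction n)
    case (Suc n)
    then have "(y n)\<^sup>2 \<le> 1\<^sup>2"
      by (intro power_mono) auto
    then show ?case by (simp add: y)
  qed (simp add: y)
  have y_step: "y n \<le> y (Suc n)" for n
  proof -
    have "y (Suc n) - y n = (1 - y n)\<^sup>2 / 2"
      by (simp add: y power2_eq_square field_simps)
    then show ?thesis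
      by (metis diff_ge_0_iff_ge divide_nonneg_nonneg zero_le_numeral zero_le_power2)
  qed
  have norm_Y: "norm (Y n) \<le> y n" for n
  proof (induction n)
    case (Suc n)
    have "norm (C + (Y n o\<^sub>L Y n)) \<le> norm C + norm (Y n o\<^sub>L Y n)"
      by (rule norm_triangle_ineq)
    also have "\<dots> \<le> 1 + norm (Y n) * norm (Y n)"
      by (intro add_mono norm_C norm_blinfun_compose)
    also have "\<dots> \<le> 1 + y n * y n"
      using Suc y_bounds by (intro add_left_mono mult_mono) auto
    finally show ?case
      by (simp add: Y y power2_eq_square)
  qed (simp add: Y y)
  have Y_step: "norm (Y (Suc n) - Y n) \<le> y (Suc n) - y n" for n
  proof (induction n)
    case 0
    then show ?case using norm_C by (simp add: Y y)
  next
    case (Suc n)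
    define Z where "Z = Y (Suc n) - Y n"
    have "Y (Suc (Suc n)) - Y (Suc n)
        = (1/2) *\<^sub>R ((C + (Y (Suc n) o\<^sub>L Y (Suc n))) - (C + (Y n o\<^sub>L Y n)))"
      by (simp only: scaleR_diff_right flip: Y(2))
    also have "(C + (Y (Suc n) o\<^sub>L Y (Suc n))) - (C + (Y n o\<^sub>L Y n)) = (Y (Suc n) o\<^sub>L Z) + (Z o\<^sub>L Y n)"
      unfolding Z_def
      by (intro blinfun_eqI) (simp add: blinfun.diff_left blinfun.diff_right blinfun.add_left)
    finally have "norm (Y (Suc (Suc n)) - Y (Suc n)) \<le> (1/2) * (norm (Y (Suc n)) * norm Z + norm Z * norm (Y n))"
      using norm_triangle_ineq[of "Y (Suc n) o\<^sub>L Z" "Z o\<^sub>L Y n"]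
        norm_blinfun_compose[of "Y (Suc n)" Z] norm_blinfun_compose[of Z "Y n"]
      by simp
    also have "\<dots> \<le> (1/2) * (y (Suc n) * (y (Suc n) - y n) + (y (Suc n) - y n) * y n)"
      using Suc norm_Y y_bounds y_step[of n] unfolding Z_def[symmetric]
      by (intro mult_left_mono add_mono mult_mono) auto
    also have "\<dots> = y (Suc (Suc n)) - y (Suc n)"
    proof -
      have "(1/2) * (b * (b - a) + (b - a) * a) = c - b"
        if "2 * c = 1 + b * b" "2 * b = 1 + a * a" for a b c :: real
        using that by (simp add: algebra_simps)
      moreover have "2 * y (Suc k) = 1 + y k * y k" for k
        by (simp add: y power2_eq_square)
      ultimately show ?thesis
        by blast
    qed
    finally show ?case .
  qed
  have Y_diff: "norm (Y (m + k) - Y m) \<le> y (m + k) - y m" for m k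
  proof (induction k)
    case (Suc k)
    have "norm (Y (m + Suc k) - Y m) \<le> norm (Y (Suc (m + k)) - Y (m + k)) + norm (Y (m + k) - Y m)"
      using norm_triangle_ineq[of "Y (Suc (m + k)) - Y (m + k)" "Y (m + k) - Y m"] by simp
    then show ?case
      using Suc Y_step[of "m + k"] by simp
  qed simp
  have "Bseq y"
    using y_bounds by (intro BseqI'[of _ 1]) auto
  then have "convergent y"
    by (intro Bseq_monoseq_convergent mono_SucI1) (auto simp: y_step)
  then have "Cauchy y"
    by (rule convergent_Cauchy)
  have "Cauchy Y"
  proof (rule CauchyI)
    fix e :: real assume "e > 0"
    then obtain N where N: "\<And>m n. m \<ge> N \<Longrightarrow> n \<ge> N \<Longrightarrow> norm (y m - y n) < e / 2"
      using CauchyD[OF \<open>Cauchy y\<close>, of "e / 2"] by auto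
    have near: "norm (Y n - Y N) < e / 2" if "n \<ge> N" for n
    proof -
      have "norm (Y n - Y N) \<le> y n - y N"
        using Y_diff[of N "n - N"] that by simp
      then show ?thesis
        using N[OF that, of N] by (simp add: abs_real_def split: if_splits)
    qed
    have "norm (Y m - Y n) < e" if "m \<ge> N" "n \<ge> N" for m n
      using near[OF that(1)] near[OF that(2)]
        norm_triangle_ineq4[of "Y m - Y N" "Y n - Y N"] by simp
    then show "\<exists>N. \<forall>m\<ge>N. \<forall>n\<ge>N. norm (Y m - Y n) < e"
      by blast
  qed
  then obtain L where L: "Y \<longlonglongrightarrow> L"
    using Cauchy_convergent_iff convergent_def by blast
  have "(\<lambda>n. (1/2) *\<^sub>R (C + (Y n o\<^sub>L Y n))) \<longlonglongrightarrow> (1/2) *\<^sub>R (C + (L o\<^sub>L L))"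
    by (intro tendsto_intros bounded_bilinear.tendsto[OF bounded_bilinear_blinfun_compose] L)
  moreover have "(\<lambda>n. Y (Suc n)) \<longlonglongrightarrow> L"
    using L by (rule LIMSEQ_Suc)
  ultimately have L_eq: "L = (1/2) *\<^sub>R (C + (L o\<^sub>L L))"
    unfolding Y(2) by (rule LIMSEQ_unique[rotated])
  have L_apply: "(\<lambda>n. Y n f) \<longlonglongrightarrow> L f" for f
    by (intro tendsto_intros L)
  have sym_Y: "inner (Y n f) g = inner f (Y n g)" for n f g
    by (induction n arbitrary: f g)
      (simp_all add: Y C_apply blinfun.add_left blinfun.scaleR_left inner_add_left inner_add_right
        inner_diff_left inner_diff_right sym)
  have sym_L: "inner (L f) g = inner f (L g)" for f g
    using LIMSEQ_unique[OF tendsto_inner[OF L_apply tendsto_const]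
        tendsto_inner[OF tendsto_const L_apply, of f g, folded sym_Y]] .
  have "norm L \<le> 1"
  proof (rule LIMSEQ_le_const2)
    show "(\<lambda>n. norm (Y n)) \<longlonglongrightarrow> norm L"
      by (intro tendsto_norm L)
    show "\<exists>N. \<forall>n\<ge>N. norm (Y n) \<le> 1"
      using norm_Y y_bounds order_trans by blast
  qed
  then have norm_L: "norm (L f) \<le> norm f" for f
    using norm_blinfun[of L f] mult_right_mono[of "norm L" 1 "norm f"] by auto
  define R where "R = id_blinfun - L"
  have R_apply: "R f = f - L f" for f
    by (simp add: R_def blinfun.diff_left)
  show ?thesis
  proof (rule that)
    show "inner (R f) g = inner f (R g)" for f g
      by (simp add: R_apply inner_diff_left inner_diff_right sym_L)
    show "0 \<le> inner f (R f)" for f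
      using norm_cauchy_schwarz[of f "L f"] mult_left_mono[OF norm_L[of f], of "norm f"]
      by (simp add: R_apply inner_diff_right flip: power2_norm_eq_inner) (simp add: power2_eq_square)
    have "2 *\<^sub>R L f = C f + L (L f)" for f
      using arg_cong[OF L_eq, of "\<lambda>A. 2 *\<^sub>R A f"]
      by (simp add: blinfun.add_left blinfun.scaleR_left)
    then have "L f + L f = f - B f + L (L f)" for f
      by (simp add: C_apply scaleR_2)
    then show "R (R f) = B f" for f
      by (simp add: R_apply blinfun.diff_right algebra_simps)
    show "G (R f) = R (G f)" if G: "\<And>f. G (B f) = B (G f)" for G :: "'a \<Rightarrow>\<^sub>L 'a" and f
    proof -
      have "G (Y n f) = Y n (G f)" for n f
        by (induction n arbitrary: f)
          (simp_all add: Y C_apply blinfun.add_left blinfun.add_right blinfun.scaleR_left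
            blinfun.scaleR_right blinfun.diff_right G)
      then have "(\<lambda>n. Y n (G f)) \<longlonglongrightarrow> G (L f)"
        using bounded_linear.tendsto[OF blinfun.bounded_linear_right L_apply, of G f] by simp
      then have "G (L f) = L (G f)"
        using L_apply[of "G f"] by (rule LIMSEQ_unique)
      then show ?thesis
        by (simp add: R_apply blinfun.diff_right)
    qed
  qed
qed

text \<open>
  The bound \<open>B \<le> 1\<close> is removed by scaling.
\<close>

lemma positive_sqrt:
  fixes B :: "'a :: {real_inner, banach} \<Rightarrow> 'a"
  assumes "bounded_linear B" and sym: "\<And>f g. inner (B f) g = inner f (B g)"
    and pos: "\<And>f. 0 \<le> inner f (B f)"
  obtains R where "bounded_linear R" "\<And>f g. inner (R f) g = inner f (R g)"
    "\<And>f. 0 \<le> inner f (R f)" "\<And>f. R (R f) = B f"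
    "\<And>G f. bounded_linear G \<Longrightarrow> (\<And>f. G (B f) = B (G f)) \<Longrightarrow> G (R f) = R (G f)"
proof -
  define A where "A = Blinfun B"
  have A: "A f = B f" for f
    by (simp add: A_def bounded_linear_Blinfun_apply assms(1))
  define c where "c = norm A + 1"
  have "c > 0"
    by (simp add: c_def add_nonneg_pos)
  have "norm ((1/c) *\<^sub>R A) \<le> 1"
    using \<open>c > 0\<close> by (simp add: c_def)
  moreover have "inner (((1/c) *\<^sub>R A) f) g = inner f (((1/c) *\<^sub>R A) g)" "0 \<le> inner f (((1/c) *\<^sub>R A) f)" for f g
    using sym pos \<open>c > 0\<close> by (auto simp: A blinfun.scaleR_left)
  ultimately obtain Q :: "'a \<Rightarrow>\<^sub>L 'a" where Q: "\<And>f g. inner (Q f) g = inner f (Q g)"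
    "\<And>f. 0 \<le> inner f (Q f)" "\<And>f. Q (Q f) = ((1/c) *\<^sub>R A) f"
    and comm: "\<And>(G :: 'a \<Rightarrow>\<^sub>L 'a) f. (\<And>f. G (((1/c) *\<^sub>R A) f) = ((1/c) *\<^sub>R A) (G f)) \<Longrightarrow> G (Q f) = Q (G f)"
    using positive_sqrt_contraction[of "(1/c) *\<^sub>R A"] by blast
  show ?thesis
  proof (rule that[of "\<lambda>f. sqrt c *\<^sub>R Q f"])
    show "bounded_linear (\<lambda>f. sqrt c *\<^sub>R Q f)"
      by (intro bounded_linear_intros)
    show "inner (sqrt c *\<^sub>R Q f) g = inner f (sqrt c *\<^sub>R Q g)" for f g
      by (simp add: Q(1))
    show "0 \<le> inner f (sqrt c *\<^sub>R Q f)" for f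
      using Q(2) \<open>c > 0\<close> by simp
    show "sqrt c *\<^sub>R Q (sqrt c *\<^sub>R Q f) = B f" for f
      using \<open>c > 0\<close> by (simp add: blinfun.scaleR_right Q(3) blinfun.scaleR_left A)
    show "G (sqrt c *\<^sub>R Q f) = sqrt c *\<^sub>R Q (G f)"
      if "bounded_linear G" "\<And>f. G (B f) = B (G f)" for G f
      using comm[of "Blinfun G" f] that
      by (simp add: bounded_linear_Blinfun_apply blinfun.scaleR_left A linear_cmul
          bounded_linear.linear)
  qed
qed

text \<open>
  Otherwise the quadratic form would be negative at \<open>f - t R f\<close> for small \<open>t > 0\<close>, the linear term
  \<open>- 2 t \<parallel>R f\<parallel>\<^sup>2\<close> dominating the quadratic one.
\<close>

lemma positive_form_zero_imp_zero:
  fixes R :: "'a :: real_inner \<Rightarrow> 'a"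
  assumes "linear R" and sym: "\<And>f g. inner (R f) g = inner f (R g)"
    and pos: "\<And>f. 0 \<le> inner f (R f)" and zero: "inner f (R f) = 0"
  shows "R f = 0"
proof (rule ccontr)
  assume "R f \<noteq> 0"
  define a where "a = inner (R f) (R f)"
  define b where "b = inner (R f) (R (R f))"
  define t where "t = a / (b + 1)"
  have "a > 0" "b \<ge> 0"
    using \<open>R f \<noteq> 0\<close> pos by (simp_all add: a_def b_def)
  have neg: "t * b - 2 * a < 0"
  proof -
    have "t * b \<le> a"
      using \<open>a > 0\<close> \<open>b \<ge> 0\<close> by (simp add: t_def field_simps)
    then show ?thesis using \<open>a > 0\<close> by simp
  qed
  have "0 \<le> inner (f - t *\<^sub>R R f) (R (f - t *\<^sub>R R f))"
    by (rule pos)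
  also have "\<dots> = t\<^sup>2 * b - 2 * t * a"
    using zero by (simp add: linear_diff[OF assms(1)] linear_cmul[OF assms(1)] inner_diff_left
        inner_diff_right a_def b_def sym[symmetric] power2_eq_square algebra_simps)
  also have "\<dots> = t * (t * b - 2 * a)"
    by (simp add: power2_eq_square algebra_simps)
  finally have "0 \<le> t * (t * b - 2 * a)" .
  moreover have "t > 0"
    using \<open>a > 0\<close> \<open>b \<ge> 0\<close> by (simp add: t_def)
  ultimately show False
    using neg by (simp add: zero_le_mult_iff)
qed

text \<open>
  For commuting roots, \<open>D = R - R'\<close> satisfies \<open>(R + R') D = 0\<close>; hence both nonnegative terms of
  \<open>\<langle>D f, R D f\<rangle> + \<langle>D f, R' D f\<rangle> = 0\<close> vanish, so \<open>D\<^sup>2 = 0\<close>.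
\<close>

lemma positive_sqrt_unique_commuting:
  fixes R R' :: "'a :: real_inner \<Rightarrow> 'a"
  assumes lin: "linear R" "linear R'"
    and sym: "\<And>f g. inner (R f) g = inner f (R g)" "\<And>f g. inner (R' f) g = inner f (R' g)"
    and pos: "\<And>f. 0 \<le> inner f (R f)" "\<And>f. 0 \<le> inner f (R' f)"
    and sq: "\<And>f. R (R f) = R' (R' f)" and comm: "\<And>f. R (R' f) = R' (R f)"
  shows "R = R'"
proof
  fix f
  define D where "D g = R g - R' g" for g
  have "R (D f) + R' (D f) = 0"
    by (simp add: D_def linear_diff[OF lin(1)] linear_diff[OF lin(2)] sq comm)
  then have "inner (D f) (R (D f)) + inner (D f) (R' (D f)) = 0"
    by (simp flip: inner_add_right)
  then have "inner (D f) (R (D f)) = 0" "inner (D f) (R' (D f)) = 0"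
    using pos[of "D f"] by linarith+
  then have "R (D f) = 0" "R' (D f) = 0"
    using positive_form_zero_imp_zero lin sym pos by metis+
  then have "D (D f) = 0"
    by (simp add: D_def[of "D f"])
  moreover have "inner (D (D f)) f = inner (D f) (D f)"
    unfolding D_def[of "D f"] by (simp add: inner_diff_left sym) (simp add: D_def inner_diff_right)
  ultimately show "R f = R' f"
    by (simp add: D_def[of f])
qed

text \<open>
  The root produced by the iteration commutes with every root, so that each of them equals it.
\<close>

lemma positive_sqrt_unique:
  fixes R R' :: "'a :: {real_inner, banach} \<Rightarrow> 'a"
  assumes R: "bounded_linear R" "\<And>f g. inner (R f) g = inner f (R g)" "\<And>f. 0 \<le> inner f (R f)"
    and R': "bounded_linear R'" "\<And>f g. inner (R' f) g = inner f (R' g)" "\<And>f. 0 \<le> inner f (R' f)"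
    and sq: "\<And>f. R (R f) = R' (R' f)"
  shows "R = R'"
proof -
  have "bounded_linear (\<lambda>f. R (R f))"
    by (rule bounded_linear_compose[OF R(1) R(1)])
  moreover have "inner (R (R f)) g = inner f (R (R g))" "0 \<le> inner f (R (R f))" for f g
    using inner_ge_zero[of "R f"] by (simp_all only: R(2))
  ultimately obtain P where P: "bounded_linear P" "\<And>f g. inner (P f) g = inner f (P g)"
    "\<And>f. 0 \<le> inner f (P f)" "\<And>f. P (P f) = R (R f)"
    and comm: "\<And>G f. bounded_linear G \<Longrightarrow> (\<And>f. G (R (R f)) = R (R (G f))) \<Longrightarrow> G (P f) = P (G f)"
    using positive_sqrt[of "\<lambda>f. R (R f)"] by blast
  have "P = R"
    by (intro positive_sqrt_unique_commuting P R bounded_linear.linear comm[symmetric] refl)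
  moreover have "P = R'"
    by (intro positive_sqrt_unique_commuting P R' bounded_linear.linear comm[symmetric])
      (simp_all only: P sq)
  ultimately show ?thesis by simp
qed

section \<open>Operators as graphs and their square roots\<close>

definition bounded_clinear :: "(l2 \<Rightarrow> l2) \<Rightarrow> bool" where
  "bounded_clinear F \<longleftrightarrow> (\<forall>f g. F (f + g) = F f + F g) \<and> (\<forall>c f. F (c *\<^sub>C f) = c *\<^sub>C F f) \<and>
     (\<exists>K. \<forall>f. norm (F f) \<le> K * norm f)"

definition fun_graph :: "(l2 \<Rightarrow> l2) \<Rightarrow> l2_op" where
  "fun_graph F = {(f, g). g = F f}"

definition symmetric_map :: "('a \<Rightarrow> 'a :: real_inner) \<Rightarrow> bool" where
  "symmetric_map F \<longleftrightarrow> (\<forall>f g. inner (F f) g = inner f (F g))"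

definition positive_map :: "('a \<Rightarrow> 'a :: real_inner) \<Rightarrow> bool" where
  "positive_map F \<longleftrightarrow> (\<forall>f. 0 \<le> inner f (F f))"

lemma bounded_clinear_add: "bounded_clinear F \<Longrightarrow> F (f + g) = F f + F g"
  and bounded_clinear_scaleC: "bounded_clinear F \<Longrightarrow> F (c *\<^sub>C f) = c *\<^sub>C F f"
  by (simp_all add: bounded_clinear_def)

lemma bounded_clinear_bound:
  assumes "bounded_clinear F"
  obtains K where "K > 0" "\<And>f. norm (F f) \<le> K * norm f"
proof -
  obtain K where K: "\<And>f. norm (F f) \<le> K * norm f"
    using assms by (auto simp: bounded_clinear_def)
  have "norm (F f) \<le> max K 1 * norm f" for f
    using K[of f] mult_right_mono[of K "max K 1" "norm f"] by auto
  then show ?thesis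
    by (intro that[of "max K 1"]) auto
qed

lemma bounded_clinear_zero: "bounded_clinear F \<Longrightarrow> F 0 = 0"
  using bounded_clinear_scaleC[of F 0 0] by simp

lemma bounded_clinear_diff: "bounded_clinear F \<Longrightarrow> F (f - g) = F f - F g"
  using bounded_clinear_add[of F f "- g"] bounded_clinear_scaleC[of F "-1" g]
  by (simp add: scaleC_minus_one)

lemma bounded_clinear_sum: "bounded_clinear F \<Longrightarrow> F (\<Sum>i\<in>I. f i) = (\<Sum>i\<in>I. F (f i))"
  by (induction I rule: infinite_finite_induct)
    (simp_all add: bounded_clinear_add bounded_clinear_zero)

lemma bounded_clinear_imp_bounded_linear:
  assumes "bounded_clinear F"
  shows "bounded_linear F"
proof -
  obtain K where "\<And>f. norm (F f) \<le> K * norm f"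
    using bounded_clinear_bound[OF assms] by metis
  then show ?thesis
    by (intro bounded_linear_intro[of _ K])
      (simp_all add: assms bounded_clinear_add bounded_clinear_scaleC flip: scaleC_of_real
        mult.commute[of K])
qed

lemma bounded_clinear_compose:
  assumes "bounded_clinear F" "bounded_clinear G"
  shows "bounded_clinear (\<lambda>f. F (G f))"
proof -
  obtain K L where K: "K > 0" "\<And>f. norm (F f) \<le> K * norm f"
    and L: "\<And>f. norm (G f) \<le> L * norm f"
    using bounded_clinear_bound assms by metis
  have "norm (F (G f)) \<le> K * L * norm f" for f
    using order_trans[OF K(2)[of "G f"] mult_left_mono[OF L[of f], of K]] K(1) by (simp add: mult.assoc)
  then show ?thesis
    using assms unfolding bounded_clinear_def by metis
qed

lemma in_fun_graph [simp]: "(f, g) \<in> fun_graph F \<longleftrightarrow> g = F f"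
  by (simp add: fun_graph_def)

lemma fun_graph_comp: "fun_graph F \<circ>\<^sub>o fun_graph G = fun_graph (\<lambda>f. F (G f))"
  by (auto simp: fun_graph_def)

lemma op_apply_fun_graph [simp]: "op_apply (fun_graph F) f = F f"
  by (simp add: op_apply_def)

lemma fun_graph_Image: "fun_graph F `` S = F ` S"
  by (auto simp: fun_graph_def)

lemma linear_op_fun_graph:
  assumes "\<And>f g. F (f + g) = F f + F g" "\<And>c f. F (c *\<^sub>C f) = c *\<^sub>C F f"
  shows "linear_op (fun_graph F)"
  using assms assms(2)[of 0 0] by (auto simp: linear_op_def single_valued_def)

lemma fun_graph_in_bounded_ops:
  assumes "bounded_clinear F"
  shows "fun_graph F \<in> bounded_ops"
  using assms linear_op_fun_graph[of F] by (auto simp: bounded_ops_def bounded_clinear_def)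

lemma bounded_opsE:
  assumes "A \<in> bounded_ops"
  obtains F where "bounded_clinear F" "A = fun_graph F"
proof -
  obtain K where A: "linear_op A" "Domain A = UNIV" "\<And>f g. (f, g) \<in> A \<Longrightarrow> norm g \<le> K * norm f"
    using assms by (auto simp: bounded_ops_def)
  have "\<forall>f. \<exists>g. (f, g) \<in> A"
    using A(2) by blast
  then obtain F where F: "\<And>f. (f, F f) \<in> A"
    by metis
  have eq: "g = F f" if "(f, g) \<in> A" for f g
    using A(1) F[of f] that by (auto simp: linear_op_def single_valued_def)
  have "F (f + g) = F f + F g" "F (c *\<^sub>C f) = c *\<^sub>C F f" for f g c
    using A(1) F eq by (metis linear_op_def)+
  then have "bounded_clinear F"
    using A(3) F unfolding bounded_clinear_def by blast
  moreover have "A = fun_graph F"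
    using F eq by auto
  ultimately show ?thesis
    by (rule that)
qed

lemma bounded_adjoint:
  assumes "bounded_clinear F"
  obtains G where "bounded_clinear G" "\<And>f g. cinner (G g) f = cinner g (F f)"
    "adjoint_op (fun_graph F) = fun_graph G"
proof -
  obtain K where K: "K > 0" "\<And>f. norm (F f) \<le> K * norm f"
    using bounded_clinear_bound[OF assms] by metis
  have "\<exists>h. \<forall>f. cinner g (F f) = cinner h f" for g
  proof -
    have "cmod (cinner g (F f)) \<le> norm g * K * norm f" for f
      using cinner_cauchy_schwarz[of g "F f"] mult_left_mono[OF K(2)[of f], of "norm g"]
      by (simp add: mult.assoc)
    then show ?thesis
      using riesz_representation[of "\<lambda>f. cinner g (F f)" "norm g * K"] assms
      by (metis bounded_clinear_add bounded_clinear_scaleC cinner_add_right cinner_scaleC_right)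
  qed
  then obtain G where G: "\<And>g f. cinner (G g) f = cinner g (F f)"
    by metis
  have unique: "h = k" if "\<And>f. cinner h f = cinner k f" for h k
    using that by (intro l2_eq_if_cinner_eq) (metis cinner_commute)
  have "norm (G g) \<le> K * norm g" for g
  proof (cases "G g = 0")
    case False
    have "complex_of_real ((norm (G g))\<^sup>2) = cinner g (F (G g))"
      by (simp only: cinner_self[symmetric] G)
    then have "(norm (G g))\<^sup>2 = cmod (cinner g (F (G g)))"
      by (metis abs_of_nonneg norm_of_real zero_le_power2)
    also have "\<dots> \<le> norm g * norm (F (G g))"
      by (rule cinner_cauchy_schwarz)
    also have "\<dots> \<le> norm g * (K * norm (G g))"
      by (intro mult_left_mono K(2)) auto
    finally have "norm (G g) * norm (G g) \<le> (K * norm g) * norm (G g)"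
      by (simp add: power2_eq_square mult.commute mult.left_commute)
    then show ?thesis
      using False by (simp only: mult_le_cancel_right) auto
  qed (use K in auto)
  then have "bounded_clinear G"
    unfolding bounded_clinear_def
    by (intro conjI allI unique exI[of _ K])
      (simp_all add: cinner_add_left cinner_scaleC_left G)
  moreover have "adjoint_op (fun_graph F) = fun_graph G"
  proof (intro set_eqI iffI)
    fix z assume "z \<in> adjoint_op (fun_graph F)"
    then have "cinner (snd z) f = cinner (G (fst z)) f" for f
      by (auto simp: adjoint_op_def G)
    then show "z \<in> fun_graph G"
      using unique by (metis in_fun_graph prod.collapse)
  next
    fix z assume "z \<in> fun_graph G"
    then show "z \<in> adjoint_op (fun_graph F)"
      by (cases z) (simp add: adjoint_op_def G)
  qed
  ultimately show ?thesis
    using G that by blast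
qed

lemma symmetric_map_cinner:
  assumes "symmetric_map F" "\<And>c f. F (c *\<^sub>C f) = c *\<^sub>C F f"
  shows "cinner (F f) g = cinner f (F g)"
  using assms unfolding cinner_eq_inner symmetric_map_def by metis

lemma symmetric_mapI: "(\<And>f g. cinner (F f) g = cinner f (F g)) \<Longrightarrow> symmetric_map F"
  by (simp add: symmetric_map_def inner_l2_def)

lemma self_adjoint_fun_graph:
  assumes "bounded_clinear F" "symmetric_map F"
  shows "self_adjoint_op (fun_graph F)"
proof -
  have sym: "cinner (F f) g = cinner f (F g)" for f g
    using assms by (intro symmetric_map_cinner) (auto simp: bounded_clinear_def)
  have "adjoint_op (fun_graph F) = fun_graph F"
  proof (intro set_eqI iffI)
    fix z assume "z \<in> adjoint_op (fun_graph F)"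
    then have "cinner f (snd z) = cinner f (F (fst z))" for f
      using cinner_commute[of f] by (auto simp: adjoint_op_def sym)
    then show "z \<in> fun_graph F"
      by (metis in_fun_graph prod.collapse l2_eq_if_cinner_eq)
  next
    fix z assume "z \<in> fun_graph F"
    then show "z \<in> adjoint_op (fun_graph F)"
      by (cases z) (simp add: adjoint_op_def sym)
  qed
  moreover have "Domain (fun_graph F) = UNIV"
    by (auto simp: fun_graph_def)
  ultimately show ?thesis
    using assms(1) by (simp add: self_adjoint_op_def linear_op_fun_graph bounded_clinear_def)
qed

lemma op_ge_zero_fun_graph:
  assumes "bounded_clinear F" "symmetric_map F" "positive_map F"
  shows "op_ge (fun_graph F) 0"
proof -
  have "cinner f (F f) = cnj (cinner f (F f))" for f
    using symmetric_map_cinner[OF assms(2), of f f] assms(1) cinner_commute[of f "F f"]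
    by (simp add: bounded_clinear_scaleC)
  then have "cinner f (F f) \<in> \<real>" for f
    by (metis Reals_cnj_iff)
  then show ?thesis
    using assms(3) by (simp add: op_ge_def positive_map_def inner_l2_def)
qed

lemma self_adjoint_symmetric:
  assumes "self_adjoint_op S" "(f, f') \<in> S" "(g, g') \<in> S"
  shows "cinner f' g = cinner f g'"
proof -
  have "(f, f') \<in> adjoint_op S"
    using assms(1,2) by (simp add: self_adjoint_op_def)
  then show ?thesis
    using assms(3) by (auto simp: adjoint_op_def)
qed

text \<open>
  Applied to a square root \<open>S\<close> of a bounded operator, and to the inverse of a square root of an
  operator with bounded inverse. Boundedness is automatic from \<open>\<parallel>R f\<parallel>\<^sup>2 = \<langle>f, R\<^sup>2 f\<rangle>\<close>.
\<close>

lemma symmetric_root_is_bounded: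
  assumes add: "\<And>f f' g g'. (f, f') \<in> P \<Longrightarrow> (g, g') \<in> P \<Longrightarrow> (f + g, f' + g') \<in> P"
    and scale: "\<And>c f f'. (f, f') \<in> P \<Longrightarrow> (c *\<^sub>C f, c *\<^sub>C f') \<in> P"
    and sym: "\<And>f f' g g'. (f, f') \<in> P \<Longrightarrow> (g, g') \<in> P \<Longrightarrow> cinner f' g = cinner f g'"
    and pos: "\<And>f f'. (f, f') \<in> P \<Longrightarrow> 0 \<le> Re (cinner f f')"
    and sq: "P O P = fun_graph B" and B: "bounded_clinear B"
  obtains R where "bounded_clinear R" "symmetric_map R" "positive_map R"
    "\<And>f. R (R f) = B f" "P = fun_graph R"
proof -
  have "\<exists>g. (f, g) \<in> P" for f
  proof -
    have "(f, B f) \<in> P O P"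
      by (simp add: sq)
    then show ?thesis by blast
  qed
  then obtain R where R: "\<And>f. (f, R f) \<in> P"
    by metis
  have eq: "a = b" if "(f, a) \<in> P" "(f, b) \<in> P" for f a b
  proof -
    have "cinner a g = cinner b g" for g
      using sym[OF that(1) R[of g]] sym[OF that(2) R[of g]] by simp
    then show ?thesis
      by (intro l2_eq_if_cinner_eq) (metis cinner_commute)
  qed
  have RR: "R (R f) = B f" for f
  proof -
    have "(f, R (R f)) \<in> P O P"
      using R by blast
    then show ?thesis
      unfolding sq by simp
  qed
  have symR: "cinner (R f) g = cinner f (R g)" for f g
    by (rule sym[OF R R])
  obtain K where K: "K > 0" "\<And>f. norm (B f) \<le> K * norm f"
    using bounded_clinear_bound[OF B] by metis
  have "norm (R f) \<le> sqrt K * norm f" for f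
  proof -
    have "(norm (R f))\<^sup>2 = inner f (B f)"
      by (simp add: power2_norm_eq_inner inner_l2_def symR RR)
    also have "\<dots> \<le> norm f * norm (B f)"
      by (rule norm_cauchy_schwarz)
    also have "\<dots> \<le> norm f * (K * norm f)"
      by (intro mult_left_mono K) auto
    also have "\<dots> = (sqrt K * norm f)\<^sup>2"
      using K(1) by (simp add: power_mult_distrib power2_eq_square)
    finally show ?thesis
      by (rule power2_le_imp_le) (use K(1) in auto)
  qed
  moreover have "R (f + g) = R f + R g" "R (c *\<^sub>C f) = c *\<^sub>C R f" for f g c
    by (rule eq[OF R], rule add[OF R R], rule eq[OF R], rule scale[OF R])
  ultimately have "bounded_clinear R"
    unfolding bounded_clinear_def by blast
  moreover have "symmetric_map R"
    by (intro symmetric_mapI symR)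
  moreover have "positive_map R"
    using pos[OF R] by (simp add: positive_map_def inner_l2_def)
  moreover have "P = fun_graph R"
    using R eq by auto
  ultimately show ?thesis
    using RR that by blast
qed

lemma bounded_positive_sqrt:
  assumes B: "bounded_clinear B" "symmetric_map B" "positive_map B"
  obtains R where "bounded_clinear R" "symmetric_map R" "positive_map R" "\<And>f. R (R f) = B f"
proof -
  obtain R where R: "bounded_linear R" "\<And>f g. inner (R f) g = inner f (R g)"
    "\<And>f. 0 \<le> inner f (R f)" "\<And>f. R (R f) = B f"
    and comm: "\<And>G f. bounded_linear G \<Longrightarrow> (\<And>f. G (B f) = B (G f)) \<Longrightarrow> G (R f) = R (G f)"
    using positive_sqrt[OF bounded_clinear_imp_bounded_linear[OF B(1)]] B(2,3)
    unfolding symmetric_map_def positive_map_def by blast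
  have "R (c *\<^sub>C f) = c *\<^sub>C R f" for c f
    using comm[OF bounded_linear_scaleC, of c f] B(1) by (simp add: bounded_clinear_scaleC)
  moreover obtain K where "\<And>f. norm (R f) \<le> K * norm f"
    using bounded_linear.bounded[OF R(1)] by (metis mult.commute)
  ultimately have "bounded_clinear R"
    using R(1) unfolding bounded_clinear_def by (auto simp: linear_add bounded_linear.linear)
  then show ?thesis
    using R that by (simp add: symmetric_map_def positive_map_def)
qed

lemma bounded_positive_sqrt_unique:
  assumes "bounded_clinear R" "symmetric_map R" "positive_map R"
    and "bounded_clinear R'" "symmetric_map R'" "positive_map R'"
    and "\<And>f. R (R f) = R' (R' f)"
  shows "R = R'"
  using assms unfolding symmetric_map_def positive_map_def
  by (intro positive_sqrt_unique) (auto intro: bounded_clinear_imp_bounded_linear)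

text \<open>
  The uniqueness in the definition of the square root ranges over unbounded operators as well; a
  root of a bounded operator is everywhere defined and bounded, which brings it into the scope of
  the uniqueness among bounded roots.
\<close>

theorem op_sqrt_bounded:
  assumes B: "bounded_clinear B" "symmetric_map B" "positive_map B"
  obtains R where "bounded_clinear R" "symmetric_map R" "positive_map R" "\<And>f. R (R f) = B f"
    "op_sqrt (fun_graph B) = fun_graph R"
proof -
  obtain R where R: "bounded_clinear R" "symmetric_map R" "positive_map R" "\<And>f. R (R f) = B f"
    using bounded_positive_sqrt[OF B] by metis
  have "op_sqrt (fun_graph B) = fun_graph R"
    unfolding op_sqrt_def
  proof (rule the_equality)
    show "self_adjoint_op (fun_graph R) \<and> op_ge (fun_graph R) 0 \<and>
        fun_graph R \<circ>\<^sub>o fun_graph R = fun_graph B"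
      using R by (simp add: self_adjoint_fun_graph op_ge_zero_fun_graph fun_graph_comp)
  next
    fix S assume S: "self_adjoint_op S \<and> op_ge S 0 \<and> S \<circ>\<^sub>o S = fun_graph B"
    obtain R' where R': "bounded_clinear R'" "symmetric_map R'" "positive_map R'"
      "\<And>f. R' (R' f) = B f" "S = fun_graph R'"
    proof (rule symmetric_root_is_bounded[of S B])
      show "cinner f' g = cinner f g'" if "(f, f') \<in> S" "(g, g') \<in> S" for f f' g g'
        using S that self_adjoint_symmetric by blast
    qed (use S B in \<open>auto simp: self_adjoint_op_def linear_op_def op_ge_def\<close>)
    then show "S = fun_graph R"
      using bounded_positive_sqrt_unique[of R R'] R by simp
  qed
  then show ?thesis
    using R that by blast
qed

lemma complex_subspace_closure:
  assumes "complex_subspace M"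
  shows "complex_subspace (closure M)"
  unfolding complex_subspace_def
proof (intro conjI ballI allI)
  show "0 \<in> closure M"
    using assms closure_subset by (auto simp: complex_subspace_def)
  fix f assume "f \<in> closure M"
  then obtain x where x: "\<And>n. x n \<in> M" "x \<longlonglongrightarrow> f"
    by (auto simp: closure_sequential)
  show "c *\<^sub>C f \<in> closure M" for c
    unfolding closure_sequential using x assms
    by (intro exI[of _ "\<lambda>n. c *\<^sub>C x n"]) (auto simp: complex_subspace_def intro: tendsto_scaleC)
  fix g assume "g \<in> closure M"
  then obtain y where y: "\<And>n. y n \<in> M" "y \<longlonglongrightarrow> g"
    by (auto simp: closure_sequential)
  show "f + g \<in> closure M"
    unfolding closure_sequential using x y assms
    by (intro exI[of _ "\<lambda>n. x n + y n"]) (auto simp: complex_subspace_def intro: tendsto_add)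
qed

text \<open>
  The form bound makes the range closed; self-adjointness makes its orthogonal complement the
  kernel, which is trivial.
\<close>

lemma self_adjoint_coercive_inverse:
  assumes sa: "self_adjoint_op T" and ge: "op_ge T \<epsilon>" and "\<epsilon> > 0"
  obtains B where "bounded_clinear B" "symmetric_map B" "positive_map B" "T = (fun_graph B)\<inverse>"
proof -
  have lin: "linear_op T" and adj: "adjoint_op T = T"
    using sa by (auto simp: self_adjoint_op_def)
  have lower: "\<epsilon> * norm f \<le> norm g" if "(f, g) \<in> T" for f g
  proof (cases "f = 0")
    case False
    have "\<epsilon> * (norm f)\<^sup>2 \<le> inner f g"
      using ge that by (auto simp: op_ge_def inner_l2_def)
    also have "\<dots> \<le> norm f * norm g"
      by (rule norm_cauchy_schwarz)
    finally have "norm f * (\<epsilon> * norm f) \<le> norm f * norm g"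
      by (simp add: power2_eq_square mult.commute mult.left_commute)
    then show ?thesis
      using False by (simp only: mult_le_cancel_left) auto
  qed simp
  have diff: "(f - f', g - g') \<in> T" if "(f, g) \<in> T" "(f', g') \<in> T" for f f' g g'
  proof -
    have "((-1) *\<^sub>C f', (-1) *\<^sub>C g') \<in> T"
      using lin that(2) unfolding linear_op_def by blast
    then have "(f + - f', g + - g') \<in> T"
      using lin that(1) unfolding linear_op_def scaleC_minus_one by blast
    then show ?thesis by simp
  qed
  define M where "M = Range T"
  have "closed M"
    unfolding closed_sequential_limits
  proof (intro allI impI)
    fix g l assume *: "(\<forall>n. g n \<in> M) \<and> g \<longlonglongrightarrow> l"
    then have "\<forall>n. \<exists>f. (f, g n) \<in> T"
      by (auto simp: M_def)
    then obtain f where f: "\<And>n. (f n, g n) \<in> T"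
      by metis
    have "Cauchy f"
    proof (rule CauchyI)
      fix e :: real assume "e > 0"
      then obtain N where N: "\<And>m n. m \<ge> N \<Longrightarrow> n \<ge> N \<Longrightarrow> norm (g m - g n) < \<epsilon> * e"
        using CauchyD[OF LIMSEQ_imp_Cauchy, of g l "\<epsilon> * e"] * \<open>\<epsilon> > 0\<close> by auto
      have "norm (f m - f n) < e" if "m \<ge> N" "n \<ge> N" for m n
        using lower[OF diff[OF f f], of m n] N[OF that] \<open>\<epsilon> > 0\<close>
        by (metis le_less_trans mult_less_cancel_left_pos)
      then show "\<exists>N. \<forall>m\<ge>N. \<forall>n\<ge>N. norm (f m - f n) < e"
        by blast
    qed
    then obtain k where k: "f \<longlonglongrightarrow> k"
      using Cauchy_convergent_iff convergent_def by blast
    have "cinner k h' = cinner l h" if "(h, h') \<in> T" for h h'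
    proof (rule LIMSEQ_unique)
      show "(\<lambda>n. cinner (f n) h') \<longlonglongrightarrow> cinner k h'"
        by (intro tendsto_cinner k tendsto_const)
      have "(\<lambda>n. cinner (g n) h) \<longlonglongrightarrow> cinner l h"
        using * by (intro tendsto_cinner tendsto_const) auto
      moreover have "cinner (f n) h' = cinner (g n) h" for n
        using self_adjoint_symmetric[OF sa f that] by simp
      ultimately show "(\<lambda>n. cinner (f n) h') \<longlonglongrightarrow> cinner l h"
        by simp
    qed
    then have "(k, l) \<in> adjoint_op T"
      by (auto simp: adjoint_op_def)
    then show "l \<in> M"
      by (auto simp: adj M_def)
  qed
  moreover have "complex_subspace M"
    using lin unfolding complex_subspace_def M_def linear_op_def by blast
  moreover have "h = 0" if "\<And>m. m \<in> M \<Longrightarrow> cinner h m = 0" for h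
  proof -
    have "(h, 0) \<in> adjoint_op T"
      using that by (auto simp: adjoint_op_def M_def)
    then have "\<epsilon> * norm h \<le> norm (0::l2)"
      unfolding adj by (rule lower)
    then show ?thesis
      using \<open>\<epsilon> > 0\<close> by (simp add: mult_le_0_iff)
  qed
  ultimately have "M = UNIV"
    by (rule closed_complex_subspace_eq_UNIV)
  then have "\<forall>g. \<exists>f. (f, g) \<in> T"
    unfolding M_def by blast
  then obtain B where B: "\<And>g. (B g, g) \<in> T"
    by metis
  have eq: "f = B g" if "(f, g) \<in> T" for f g
  proof -
    have "\<epsilon> * norm (f - B g) \<le> norm (g - g)"
      by (rule lower[OF diff[OF that B]])
    then show ?thesis
      using \<open>\<epsilon> > 0\<close> by (simp add: mult_le_0_iff)
  qed
  have "norm (B g) \<le> (1 / \<epsilon>) * norm g" for g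
    using lower[OF B] \<open>\<epsilon> > 0\<close> by (simp add: field_simps)
  moreover have "B (f + g) = B f + B g" "B (c *\<^sub>C f) = c *\<^sub>C B f" for f g c
    using lin B eq by (metis linear_op_def)+
  ultimately have "bounded_clinear B"
    unfolding bounded_clinear_def by blast
  moreover have "symmetric_map B"
  proof (rule symmetric_mapI)
    show "cinner (B f) g = cinner f (B g)" for f g
      using self_adjoint_symmetric[OF sa B[of f] B[of g]] by simp
  qed
  moreover have "positive_map B"
    unfolding positive_map_def
  proof
    fix f
    have "0 \<le> \<epsilon> * (norm (B f))\<^sup>2"
      using \<open>\<epsilon> > 0\<close> by simp
    also have "\<dots> \<le> inner (B f) f"
      using ge B[of f] by (auto simp: op_ge_def inner_l2_def)
    finally show "0 \<le> inner f (B f)"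
      by (simp add: inner_commute)
  qed
  moreover have "T = (fun_graph B)\<inverse>"
    using B eq by auto
  ultimately show ?thesis
    by (rule that)
qed

text \<open>
  A vector orthogonal to the range is in the kernel by symmetry, hence the range is dense.
\<close>

lemma self_adjoint_inverse:
  assumes R: "bounded_clinear R" "symmetric_map R" and inj: "\<And>f. R f = 0 \<Longrightarrow> f = 0"
  shows "self_adjoint_op ((fun_graph R)\<inverse>)"
proof -
  have sym: "cinner (R f) g = cinner f (R g)" for f g
    using R by (intro symmetric_map_cinner) (auto simp: bounded_clinear_def)
  have "single_valued ((fun_graph R)\<inverse>)"
    using inj R(1) by (auto simp: single_valued_def) (metis bounded_clinear_diff eq_iff_diff_eq_0)
  then have "linear_op ((fun_graph R)\<inverse>)"
    using R(1) by (simp add: linear_op_def bounded_clinear_def bounded_clinear_zero)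
  moreover have "closure (range R) = UNIV"
  proof (rule closed_complex_subspace_eq_UNIV)
    have "complex_subspace (range R)"
      unfolding complex_subspace_def
      using R(1) bounded_clinear_zero[OF R(1)]
      by (auto simp flip: bounded_clinear_add bounded_clinear_scaleC)
    then show "complex_subspace (closure (range R))"
      by (rule complex_subspace_closure)
    fix h assume h: "\<And>m. m \<in> closure (range R) \<Longrightarrow> cinner h m = 0"
    have "cinner h (R f) = 0" for f
      by (intro h subsetD[OF closure_subset] rangeI)
    then have "cinner (R h) (R h) = 0"
      by (simp add: sym)
    then show "h = 0"
      using inj by (simp add: cinner_self)
  qed simp
  moreover have "Domain ((fun_graph R)\<inverse>) = range R"
    by (auto simp: fun_graph_def)
  moreover have "adjoint_op ((fun_graph R)\<inverse>) = (fun_graph R)\<inverse>"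
  proof (intro set_eqI iffI)
    fix z assume "z \<in> adjoint_op ((fun_graph R)\<inverse>)"
    then have "cinner (fst z) f = cinner (R (snd z)) f" for f
      by (auto simp: adjoint_op_def sym)
    then have "fst z = R (snd z)"
      by (intro l2_eq_if_cinner_eq) (metis cinner_commute)
    then show "z \<in> (fun_graph R)\<inverse>"
      by (cases z) simp
  next
    fix z assume "z \<in> (fun_graph R)\<inverse>"
    then show "z \<in> adjoint_op ((fun_graph R)\<inverse>)"
      by (cases z) (simp add: adjoint_op_def sym)
  qed
  ultimately show ?thesis
    by (simp add: self_adjoint_op_def)
qed

text \<open>The square root of \<open>T\<close> is the inverse of the square root of \<open>T\<^sup>-\<^sup>1\<close>.\<close>

theorem op_sqrt_coercive:
  assumes sa: "self_adjoint_op T" and ge: "op_ge T \<epsilon>" and "\<epsilon> > 0"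
  obtains R where "bounded_clinear R" "symmetric_map R" "\<And>f. R f = 0 \<Longrightarrow> f = 0"
    "op_sqrt T = (fun_graph R)\<inverse>"
proof -
  obtain B where B: "bounded_clinear B" "symmetric_map B" "positive_map B" "T = (fun_graph B)\<inverse>"
    using self_adjoint_coercive_inverse[OF assms] by metis
  obtain R where R: "bounded_clinear R" "symmetric_map R" "positive_map R" "\<And>f. R (R f) = B f"
    using bounded_positive_sqrt[OF B(1-3)] by metis
  have inj: "f = 0" if "R f = 0" for f
  proof -
    have "(0, f) \<in> T"
      using that R(4)[of f] bounded_clinear_zero[OF R(1)] by (simp add: B(4))
    then show ?thesis
      using sa by (auto simp: self_adjoint_op_def linear_op_def single_valued_def)
  qed
  have "op_sqrt T = (fun_graph R)\<inverse>"
    unfolding op_sqrt_def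
  proof (rule the_equality)
    have "op_ge ((fun_graph R)\<inverse>) 0"
      using op_ge_zero_fun_graph[OF R(1-3)] symmetric_map_cinner[OF R(2)] R(1)
      by (auto simp: op_ge_def bounded_clinear_scaleC)
    moreover have "(fun_graph R)\<inverse> O (fun_graph R)\<inverse> = T"
      unfolding B(4) converse_relcomp[symmetric] by (simp add: fun_graph_comp R(4))
    ultimately show "self_adjoint_op ((fun_graph R)\<inverse>) \<and> op_ge ((fun_graph R)\<inverse>) 0 \<and>
        (fun_graph R)\<inverse> \<circ>\<^sub>o (fun_graph R)\<inverse> = T"
      using self_adjoint_inverse[OF R(1,2) inj] by blast
  next
    fix S assume S: "self_adjoint_op S \<and> op_ge S 0 \<and> S \<circ>\<^sub>o S = T"
    obtain R' where R': "bounded_clinear R'" "symmetric_map R'" "positive_map R'"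
      "\<And>f. R' (R' f) = B f" "S\<inverse> = fun_graph R'"
    proof (rule symmetric_root_is_bounded[of "S\<inverse>" B])
      show "cinner f' g = cinner f g'" if "(f, f') \<in> S\<inverse>" "(g, g') \<in> S\<inverse>" for f f' g g'
        using S that self_adjoint_symmetric by fastforce
      show "0 \<le> Re (cinner f f')" if "(f, f') \<in> S\<inverse>" for f f'
        using S that cinner_commute[of f f'] by (auto simp: op_ge_def)
      show "S\<inverse> O S\<inverse> = fun_graph B"
        using S B(4) by (simp flip: converse_relcomp)
    qed (use S B in \<open>auto simp: self_adjoint_op_def linear_op_def op_ge_def\<close>)
    then have "S\<inverse> = fun_graph R"
      using bounded_positive_sqrt_unique[of R R'] R by simp
    then show "S = (fun_graph R)\<inverse>"
      by (metis converse_converse)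
  qed
  then show ?thesis
    using that[OF R(1,2) inj] by blast
qed

section \<open>Comparison of closed operators with the same domain\<close>

text \<open>
  A form of the closed graph theorem for two closed linear relations, of which the first has the
  smaller domain. By Baire's theorem some set \<open>{u \<in> G. \<exists>z. (fst u, z) \<in> H \<and> \<parallel>z\<parallel> \<le> n}\<close> is dense in a
  ball of \<open>G\<close>, so that every \<open>u \<in> G\<close> can be approximated by elements \<open>v\<close> with a companion \<open>z\<close> of
  norm at most \<open>L \<parallel>u\<parallel>\<close>. Summing the approximations of the successive remainders gives a companion
  of \<open>u\<close> itself.
\<close>

lemma closed_subspace_relative_bound:
  fixes G :: "('a::banach \<times> 'b::banach) set" and H :: "('a \<times> 'c::banach) set"
  assumes G: "closed G" "subspace G" and H: "closed H" "subspace H"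
    and dom: "\<And>x y. (x, y) \<in> G \<Longrightarrow> \<exists>z. (x, z) \<in> H"
  obtains C where "C > 0" "\<And>x y. (x, y) \<in> G \<Longrightarrow> \<exists>z. (x, z) \<in> H \<and> norm z \<le> C * norm (x, y)"
proof -
  define X where "X n = {u \<in> G. \<exists>z. (fst u, z) \<in> H \<and> norm z \<le> real n}" for n :: nat
  have X_sub: "X n \<subseteq> G" for n
    by (auto simp: X_def)
  have "0 \<in> G" "0 \<in> H"
    using G(2) H(2) by (auto simp: subspace_0)
  have "\<exists>n. (top_of_set G) interior_of (closure (X n)) \<noteq> {}"
  proof (rule ccontr)
    assume "\<not> ?thesis"
    then have *: "(top_of_set G) interior_of (closure (X n)) = {}" for n
      by blast
    have "completely_metrizable_space (top_of_set G)"
      by (intro completely_metrizable_space_closedin[OF completely_metrizable_space_euclidean])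
        (simp add: G(1))
    then have "(top_of_set G) interior_of (\<Union>(range (\<lambda>n. closure (X n)))) = {}"
    proof (intro Baire_category_alt disjI1)
      fix S assume "S \<in> range (\<lambda>n. closure (X n))"
      then obtain n where n: "S = closure (X n)" by blast
      have "closure (X n) \<subseteq> G"
        using X_sub G(1) by (intro closure_minimal) auto
      then show "closedin (top_of_set G) S \<and> (top_of_set G) interior_of S = {}"
        using * by (auto simp: n closedin_closed_eq G(1) intro: closed_subset)
    qed auto
    moreover have "G \<subseteq> \<Union>(range (\<lambda>n. closure (X n)))"
    proof
      fix u assume "u \<in> G"
      then obtain z where "(fst u, z) \<in> H"
        using dom by (metis prod.collapse)
      moreover obtain n where "norm z \<le> real n"
        using real_arch_simple by blast
      ultimately have "u \<in> X n"
        using \<open>u \<in> G\<close> by (auto simp: X_def)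
      then show "u \<in> \<Union>(range (\<lambda>n. closure (X n)))"
        using closure_subset by blast
    qed
    then have "G \<subseteq> (top_of_set G) interior_of (\<Union>(range (\<lambda>n. closure (X n))))"
      by (intro interior_of_maximal) auto
    ultimately show False
      using \<open>0 \<in> G\<close> by auto
  qed
  then obtain n w where w: "w \<in> (top_of_set G) interior_of (closure (X n))"
    by blast
  then obtain T where T: "open T" "w \<in> T" "w \<in> G" "G \<inter> T \<subseteq> closure (X n)"
    unfolding interior_of_def by (auto simp: openin_open)
  then obtain \<delta> where \<delta>: "\<delta> > 0" "ball w \<delta> \<subseteq> T"
    using open_contains_ball by metis
  \<comment> \<open>Scaling \<open>u\<close> to length \<open>\<delta>/2\<close> and subtracting the centre \<open>w\<close> costs the factor \<open>2 n\<close> over \<open>\<delta>/2\<close>.\<close>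
  define L where "L = 4 * real n / \<delta>"
  have "L \<ge> 0"
    using \<delta> by (simp add: L_def)
  have approx: "\<exists>v\<in>G. \<exists>z. (fst v, z) \<in> H \<and> norm z \<le> L * norm u \<and> norm (u - v) < \<eta>"
    if "u \<in> G" "u \<noteq> 0" "\<eta> > 0" for u \<eta>
  proof -
    define s where "s = \<delta> / (2 * norm u)"
    have s: "s > 0"
      using that \<delta> by (simp add: s_def)
    have "norm (s *\<^sub>R u) < \<delta>"
      using that \<delta> by (simp add: s_def)
    then have "w + s *\<^sub>R u \<in> T"
      using \<delta>(2) by (auto simp: dist_norm)
    moreover have "w + s *\<^sub>R u \<in> G"
      using T(3) that(1) G(2) by (intro subspace_add subspace_scale)
    ultimately have "w + s *\<^sub>R u \<in> closure (X n)" "w \<in> closure (X n)"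
      using T by blast+
    moreover have "s * \<eta> / 2 > 0"
      using s that by simp
    ultimately obtain a b where ab: "a \<in> X n" "b \<in> X n" "norm (a - (w + s *\<^sub>R u)) < s * \<eta> / 2"
        "norm (b - w) < s * \<eta> / 2"
      unfolding closure_approachable dist_norm by metis
    obtain y z where yz: "(fst a, y) \<in> H" "(fst b, z) \<in> H" "norm y \<le> real n" "norm z \<le> real n"
      using ab by (auto simp: X_def)
    define v where "v = (1/s) *\<^sub>R (a - b)"
    have "v \<in> G"
      using ab X_sub G(2) unfolding v_def by (intro subspace_scale subspace_diff) auto
    moreover have "(fst v, (1/s) *\<^sub>R (y - z)) \<in> H"
      using subspace_scale[OF H(2) subspace_diff[OF H(2) yz(1,2)], of "1/s"] by (simp add: v_def)
    moreover have "norm ((1/s) *\<^sub>R (y - z)) \<le> L * norm u"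
    proof -
      have "norm (y - z) \<le> 2 * real n"
        using norm_triangle_ineq4[of y z] yz by simp
      then have "norm ((1/s) *\<^sub>R (y - z)) \<le> (1/s) * (2 * real n)"
        using s by (simp add: divide_right_mono)
      also have "\<dots> = L * norm u"
        using that by (simp add: L_def s_def)
      finally show ?thesis .
    qed
    moreover have "norm (u - v) < \<eta>"
    proof -
      have "u - v = (1/s) *\<^sub>R ((b - w) - (a - (w + s *\<^sub>R u)))"
        using s by (simp add: v_def scaleR_diff_right scaleR_add_right)
      also have "norm \<dots> = (1/s) * norm ((b - w) - (a - (w + s *\<^sub>R u)))"
        using s by simp
      also have "norm ((b - w) - (a - (w + s *\<^sub>R u))) < s * \<eta>"
        using norm_triangle_ineq4[of "b - w" "a - (w + s *\<^sub>R u)"] ab by simp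
      then have "(1/s) * norm ((b - w) - (a - (w + s *\<^sub>R u))) < (1/s) * (s * \<eta>)"
        using s by (intro mult_strict_left_mono) auto
      finally show ?thesis
        using s by simp
    qed
    ultimately show ?thesis by blast
  qed
  have companion: "\<exists>z. (fst u, z) \<in> H \<and> norm z \<le> 2 * L * norm u" if "u \<in> G" for u
  proof (cases "u = 0")
    case True
    then show ?thesis
      using \<open>0 \<in> H\<close> by (intro exI[of _ 0]) (auto simp: zero_prod_def)
  next
    case False
    have "\<exists>p. x \<in> G \<longrightarrow> fst p \<in> G \<and> (fst (fst p), snd p) \<in> H \<and> norm (snd p) \<le> L * norm x \<and>
        norm (x - fst p) \<le> norm u * (1/2) ^ Suc k" for x k
    proof (cases "x \<in> G \<and> x \<noteq> 0")
      case True
      then obtain v z where "v \<in> G" "(fst v, z) \<in> H" "norm z \<le> L * norm x"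
          "norm (x - v) < norm u * (1/2) ^ Suc k"
        using approx[of x "norm u * (1/2) ^ Suc k"] False by auto
      then show ?thesis
        by (intro exI[of _ "(v, z)"]) auto
    next
      case False
      then show ?thesis
        using \<open>0 \<in> G\<close> \<open>0 \<in> H\<close> by (intro exI[of _ "(0, 0)"]) (auto simp: zero_prod_def)
    qed
    then obtain p where p: "\<And>x k. x \<in> G \<Longrightarrow> fst (p x k) \<in> G \<and> (fst (fst (p x k)), snd (p x k)) \<in> H \<and>
        norm (snd (p x k)) \<le> L * norm x \<and> norm (x - fst (p x k)) \<le> norm u * (1/2) ^ Suc k"
      by metis
    define U where "U = rec_nat u (\<lambda>k x. x - fst (p x k))"
    have U: "U 0 = u" "\<And>k. U (Suc k) = U k - fst (p (U k) k)"
      by (simp_all add: U_def)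
    have UG: "U k \<in> G" for k
      by (induction k) (use p G(2) that in \<open>auto simp: U subspace_diff\<close>)
    have U_norm: "norm (U k) \<le> norm u * (1/2) ^ k" for k
      by (cases k) (use p[OF UG] in \<open>auto simp: U\<close>)
    define z where "z k = snd (p (U k) k)" for k
    have z_norm: "norm (z k) \<le> L * norm u * (1/2) ^ k" for k
    proof -
      have "norm (z k) \<le> L * norm (U k)"
        using p[OF UG] by (simp add: z_def)
      also have "\<dots> \<le> L * (norm u * (1/2) ^ k)"
        by (intro mult_left_mono U_norm \<open>L \<ge> 0\<close>)
      finally show ?thesis by (simp add: mult.assoc)
    qed
    have geom: "(\<lambda>k. L * norm u * (1/2) ^ k) sums (L * norm u * 2)"
      using geometric_sums[of "1/2::real"] by (intro sums_mult) auto
    have summ: "summable (\<lambda>k. norm (z k))"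
      by (rule summable_comparison_test'[OF sums_summable[OF geom], of 0]) (use z_norm in auto)
    have partial: "(fst (u - U m), \<Sum>k<m. z k) \<in> H" for m
    proof (induction m)
      case (Suc m)
      have "(fst (fst (p (U m) m)), z m) \<in> H"
        using p[OF UG] by (simp add: z_def)
      from subspace_add[OF H(2) Suc this] show ?case
        by (simp add: U algebra_simps)
    qed (use \<open>0 \<in> H\<close> in \<open>simp add: U zero_prod_def\<close>)
    have "(\<lambda>m. norm u * (1/2) ^ m) \<longlonglongrightarrow> norm u * 0"
      by (intro tendsto_intros LIMSEQ_power_zero) auto
    then have "U \<longlonglongrightarrow> 0"
      by (intro Lim_null_comparison[of U]) (use U_norm in auto)
    then have "(\<lambda>m. (fst (u - U m), \<Sum>k<m. z k)) \<longlonglongrightarrow> (fst (u - 0), suminf z)"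
      by (rule tendsto_Pair[OF tendsto_fst[OF tendsto_diff[OF tendsto_const]]
            summable_LIMSEQ[OF summable_norm_cancel[OF summ]]])
    then have "(fst (u - 0), suminf z) \<in> H"
      by (rule closed_sequentially[OF H(1) partial])
    moreover have "norm (suminf z) \<le> 2 * L * norm u"
    proof -
      have "norm (suminf z) \<le> (\<Sum>k. norm (z k))"
        by (rule summable_norm[OF summ])
      also have "\<dots> \<le> (\<Sum>k. L * norm u * (1/2) ^ k)"
        by (intro suminf_le z_norm summ sums_summable[OF geom])
      also have "\<dots> = L * norm u * 2"
        using geom by (rule sums_unique[symmetric])
      finally show ?thesis by simp
    qed
    ultimately show ?thesis by auto
  qed
  show ?thesis
  proof (rule that[of "2 * L + 1"])
    show "2 * L + 1 > 0"
      using \<open>L \<ge> 0\<close> by simp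
    show "\<exists>z. (x, z) \<in> H \<and> norm z \<le> (2 * L + 1) * norm (x, y)" if "(x, y) \<in> G" for x y
    proof -
      have "2 * L * norm (x, y) \<le> (2 * L + 1) * norm (x, y)"
        by (intro mult_right_mono) auto
      then show ?thesis
        using companion[OF that] order_trans by fastforce
    qed
  qed
qed


section \<open>Smooth cut-off functions\<close>

text \<open>
  Differentiability in terms of a given derivative is stable under sums, products and affine
  substitutions by a plain induction; iterated \<^const>\<open>deriv\<close> is reached only at the end.
\<close>

fun smooth_upto :: "nat \<Rightarrow> (real \<Rightarrow> real) \<Rightarrow> bool" where
  "smooth_upto 0 f \<longleftrightarrow> True"
| "smooth_upto (Suc n) f \<longleftrightarrow> (\<exists>f'. (\<forall>x. (f has_real_derivative f' x) (at x)) \<and> smooth_upto n f')"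

lemma smooth_upto_SucI:
  "(\<And>x. (f has_real_derivative f' x) (at x)) \<Longrightarrow> smooth_upto n f' \<Longrightarrow> smooth_upto (Suc n) f"
  by auto

lemma smooth_upto_add: "smooth_upto n f \<Longrightarrow> smooth_upto n g \<Longrightarrow> smooth_upto n (\<lambda>x. f x + g x)"
proof (induction n arbitrary: f g)
  case (Suc n)
  then obtain f' g' where "\<And>x. (f has_real_derivative f' x) (at x)" "smooth_upto n f'"
      "\<And>x. (g has_real_derivative g' x) (at x)" "smooth_upto n g'"
    by auto
  then show ?case
    by (intro smooth_upto_SucI[of _ "\<lambda>x. f' x + g' x"] Suc.IH) (auto intro: DERIV_add)
qed simp

lemma smooth_upto_Suc_imp: "smooth_upto (Suc n) f \<Longrightarrow> smooth_upto n f"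
  by (induction n arbitrary: f) (simp, metis smooth_upto.simps(2))

lemma smooth_upto_mult: "smooth_upto n f \<Longrightarrow> smooth_upto n g \<Longrightarrow> smooth_upto n (\<lambda>x. f x * g x)"
proof (induction n arbitrary: f g)
  case (Suc n)
  then obtain f' g' where D: "\<And>x. (f has_real_derivative f' x) (at x)" "smooth_upto n f'"
      "\<And>x. (g has_real_derivative g' x) (at x)" "smooth_upto n g'"
    by auto
  have "smooth_upto n f" "smooth_upto n g"
    using Suc.prems by (blast intro: smooth_upto_Suc_imp)+
  with D show ?case
    by (intro smooth_upto_SucI[of _ "\<lambda>x. f' x * g x + g' x * f x"] smooth_upto_add Suc.IH)
      (auto intro: DERIV_mult)
qed simp

lemma smooth_upto_const: "smooth_upto n (\<lambda>_. c)"
  by (induction n arbitrary: c) (auto intro!: exI[of _ "\<lambda>_. 0"])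

lemma smooth_upto_affine: "smooth_upto n f \<Longrightarrow> smooth_upto n (\<lambda>x. f (a * x + b))"
proof (induction n arbitrary: f)
  case (Suc n)
  then obtain f' where f': "\<And>x. (f has_real_derivative f' x) (at x)" "smooth_upto n f'"
    by auto
  have "((\<lambda>x. f (a * x + b)) has_real_derivative a * f' (a * x + b)) (at x)" for x
    by (rule DERIV_cong[OF DERIV_chain2[OF f'(1)]]) (auto intro!: derivative_eq_intros)
  then show ?case
    by (intro smooth_upto_SucI[of _ "\<lambda>x. a * f' (a * x + b)"] smooth_upto_mult smooth_upto_const
        Suc.IH f'(2))
qed simp

lemma smooth_upto_imp_differentiable:
  "smooth_upto (Suc k) f \<Longrightarrow> ((deriv ^^ k) f) field_differentiable (at x)"
proof (induction k arbitrary: f)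
  case 0
  then show ?case by (auto simp: field_differentiable_def)
next
  case (Suc k)
  then obtain f' where f': "\<And>x. (f has_real_derivative f' x) (at x)" "smooth_upto (Suc k) f'"
    by (metis smooth_upto.simps(2))
  then have "deriv f = f'"
    by (auto simp: DERIV_imp_deriv)
  then show ?case
    using Suc.IH[OF f'(2)] by (simp add: funpow_swap1)
qed

text \<open>
  The flat function \<open>exp (- 1/t)\<close> together with its multiples by powers of \<open>1/t\<close>; derivatives of
  members of this family are linear combinations of members.
\<close>

definition flat_power :: "nat \<Rightarrow> real \<Rightarrow> real" where
  "flat_power n t = (if t > 0 then (1/t) ^ n * exp (- (1/t)) else 0)"

lemma flat_power_tendsto_0: "(flat_power n \<longlongrightarrow> 0) (at_right 0)"
proof -
  have "((\<lambda>t::real. (inverse t) ^ n / exp (inverse t)) \<longlongrightarrow> 0) (at_right 0)"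
    by (rule filterlim_compose[OF tendsto_power_div_exp_0 filterlim_inverse_at_top_right])
  then show ?thesis
    by (rule Lim_transform_eventually)
      (auto simp: eventually_at_filter flat_power_def exp_minus field_simps inverse_eq_divide
        intro!: always_eventually)
qed

lemma flat_power_derivative:
  "(flat_power n has_real_derivative flat_power (n + 2) t - real n * flat_power (n + 1) t) (at t)"
proof -
  consider "t > 0" | "t < 0" | "t = 0" by linarith
  then show ?thesis
  proof cases
    case 1
    have inv: "((\<lambda>t. 1/t) has_real_derivative - (1/t)\<^sup>2) (at t)"
      using 1 by (auto intro!: derivative_eq_intros simp: power2_eq_square)
    have "((\<lambda>t. (1/t) ^ n * exp (- (1/t))) has_real_derivative
        (real n * (1/t) ^ (n - 1) * - (1/t)\<^sup>2) * exp (- (1/t))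
          + (exp (- (1/t)) * (1/t)\<^sup>2) * (1/t) ^ n) (at t)"
      by (rule DERIV_cong[OF DERIV_mult[OF DERIV_power[OF inv] DERIV_chain2[OF DERIV_exp DERIV_minus[OF inv]]]])
        simp
    also have "(real n * (1/t) ^ (n - 1) * - (1/t)\<^sup>2) * exp (- (1/t))
          + (exp (- (1/t)) * (1/t)\<^sup>2) * (1/t) ^ n
        = flat_power (n + 2) t - real n * flat_power (n + 1) t"
      using 1 by (cases n) (simp_all add: flat_power_def power2_eq_square algebra_simps add_divide_distrib)
    finally have "((\<lambda>t. (1/t) ^ n * exp (- (1/t))) has_real_derivative
        flat_power (n + 2) t - real n * flat_power (n + 1) t) (at t)" .
    then show ?thesis
      by (rule has_field_derivative_transform_within_open[of _ _ _ "{0<..}"])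
        (use 1 in \<open>auto simp: flat_power_def\<close>)
  next
    case 2
    have "((\<lambda>t. 0) has_real_derivative flat_power (n + 2) t - real n * flat_power (n + 1) t) (at t)"
      using 2 by (simp add: flat_power_def)
    then show ?thesis
      by (rule has_field_derivative_transform_within_open[of _ _ _ "{..<0}"])
        (use 2 in \<open>auto simp: flat_power_def\<close>)
  next
    case 3
    have "((\<lambda>h. flat_power n h / h) \<longlongrightarrow> 0) (at 0)"
      unfolding filterlim_at_split
    proof
      show "((\<lambda>h. flat_power n h / h) \<longlongrightarrow> 0) (at_left 0)"
        by (rule Lim_transform_eventually[OF tendsto_const])
          (auto simp: eventually_at_filter flat_power_def intro!: always_eventually)
      show "((\<lambda>h. flat_power n h / h) \<longlongrightarrow> 0) (at_right 0)"
        by (rule Lim_transform_eventually[OF flat_power_tendsto_0[of "Suc n"]])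
          (auto simp: eventually_at_filter flat_power_def intro!: always_eventually)
    qed
    then show ?thesis
      using 3 by (simp add: DERIV_def flat_power_def)
  qed
qed

lemma smooth_upto_flat_power: "smooth_upto m (flat_power n)"
proof (induction m arbitrary: n)
  case (Suc m)
  have "smooth_upto m (\<lambda>t. flat_power (n + 2) t + (- real n) * flat_power (n + 1) t)"
    by (intro smooth_upto_add smooth_upto_mult smooth_upto_const Suc.IH)
  then show ?case
    by (intro smooth_upto_SucI[OF flat_power_derivative]) simp
qed simp

lemma bounded_of_continuous_support:
  fixes \<psi> :: "real \<Rightarrow> real"
  assumes "continuous_on UNIV \<psi>" "\<And>x. x \<notin> {A..B} \<Longrightarrow> \<psi> x = 0"
  obtains C where "C \<ge> 0" "\<And>x. \<bar>\<psi> x\<bar> \<le> C * indicator {A..B} x"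
proof -
  have "bounded (\<psi> ` {A..B})"
    using assms(1) by (intro compact_imp_bounded compact_continuous_image)
      (auto intro: continuous_on_subset)
  then obtain C where "\<forall>y\<in>\<psi> ` {A..B}. norm y \<le> C"
    unfolding bounded_iff by blast
  then have C: "\<bar>\<psi> x\<bar> \<le> C" if "x \<in> {A..B}" for x
    using that by auto
  have "\<bar>\<psi> x\<bar> \<le> \<bar>C\<bar> * indicator {A..B} x" for x
    using C[of x] assms(2)[of x] by (cases "x \<in> {A..B}") auto
  then show ?thesis
    by (intro that[of "\<bar>C\<bar>"]) auto
qed

text \<open>
  The step is the normalised antiderivative of the bump \<open>exp (- 1/t) exp (- 1/(1 - t))\<close> on the
  unit interval.
\<close>

lemma smooth_step:
  obtains P \<rho> :: "real \<Rightarrow> real" and C where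
    "\<And>t. (P has_real_derivative \<rho> t) (at t)" "\<And>n. smooth_upto n \<rho>"
    "continuous_on UNIV \<rho>" "C \<ge> 0" "\<And>t. \<bar>\<rho> t\<bar> \<le> C * indicator {0..1} t"
    "\<And>t. t \<le> 0 \<or> t \<ge> 1 \<Longrightarrow> \<rho> t = 0"
    "\<And>t. t \<le> 0 \<Longrightarrow> P t = 0" "\<And>t. t \<ge> 1 \<Longrightarrow> P t = 1" "\<And>t. 0 \<le> P t \<and> P t \<le> 1"
proof -
  define \<beta> where "\<beta> t = flat_power 0 t * flat_power 0 ((-1) * t + 1)" for t
  have smooth: "smooth_upto n \<beta>" for n
    unfolding \<beta>_def by (intro smooth_upto_mult smooth_upto_affine smooth_upto_flat_power)
  have nonneg: "\<beta> t \<ge> 0" and pos: "0 < t \<Longrightarrow> t < 1 \<Longrightarrow> \<beta> t > 0"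
    and zero: "t \<le> 0 \<or> t \<ge> 1 \<Longrightarrow> \<beta> t = 0" for t
    by (auto simp: \<beta>_def flat_power_def)
  have isCont: "isCont \<beta> t" for t
    using smooth[of 1] by (auto intro: DERIV_isCont)
  then obtain Q where Q: "\<And>t. (Q has_vector_derivative \<beta> t) (at t)"
    using einterval_antiderivative[of "-\<infinity>" \<infinity> \<beta>] by auto
  then have DQ: "(Q has_real_derivative \<beta> t) (at t)" for t
    by (simp add: has_real_derivative_iff_has_vector_derivative)
  have mono: "Q s \<le> Q t" if "s \<le> t" for s t
    by (rule DERIV_nonneg_imp_nondecreasing[OF that]) (use DQ nonneg in blast)
  have left: "Q t = Q 0" if "t \<le> 0" for t
  proof -
    have "Q 0 \<le> Q t"
      by (rule DERIV_nonpos_imp_nonincreasing[OF that]) (use DQ zero in fastforce)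
    then show ?thesis using mono[OF that] by simp
  qed
  have right: "Q t = Q 1" if "t \<ge> 1" for t
  proof -
    have "Q t \<le> Q 1"
      by (rule DERIV_nonpos_imp_nonincreasing[OF that]) (use DQ zero in fastforce)
    then show ?thesis using mono[OF that] by simp
  qed
  have "Q 0 < Q 1"
    by (rule DERIV_pos_imp_increasing_open)
      (use DQ pos in \<open>auto intro!: DERIV_continuous_on continuous_at_imp_continuous_on DERIV_isCont\<close>)
  define Z where "Z = Q 1 - Q 0"
  have "Z > 0"
    using \<open>Q 0 < Q 1\<close> by (simp add: Z_def)
  have cont: "continuous_on UNIV (\<lambda>t. \<beta> t / Z)"
    using isCont \<open>Z > 0\<close> by (intro continuous_on_divide continuous_at_imp_continuous_on) auto
  have "\<beta> t / Z = 0" if "t \<notin> {0..1}" for t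
    using that zero[of t] by auto
  then obtain C where C: "C \<ge> 0" "\<And>t. \<bar>\<beta> t / Z\<bar> \<le> C * indicator {0..1} t"
    using bounded_of_continuous_support[OF cont] by blast
  show ?thesis
  proof (rule that[of "\<lambda>t. (Q t - Q 0) / Z" "\<lambda>t. \<beta> t / Z" C])
    show "((\<lambda>t. (Q t - Q 0) / Z) has_real_derivative \<beta> t / Z) (at t)" for t
      using \<open>Z > 0\<close> by (auto intro!: derivative_eq_intros DQ)
    show "smooth_upto n (\<lambda>t. \<beta> t / Z)" for n
      using smooth_upto_mult[OF smooth smooth_upto_const[of _ "1/Z"]] by simp
    show "0 \<le> (Q t - Q 0) / Z \<and> (Q t - Q 0) / Z \<le> 1" for t
      using \<open>Z > 0\<close> mono[of 0 t] mono[of t 1] left[of t] right[of t]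
      by (cases "t \<le> 0"; cases "t \<ge> 1") (auto simp: Z_def)
    show "\<beta> t / Z = 0" if "t \<le> 0 \<or> t \<ge> 1" for t
      using zero[OF that] by simp
    show "(Q t - Q 0) / Z = 0" if "t \<le> 0" for t
      using left[OF that] by simp
    show "(Q t - Q 0) / Z = 1" if "t \<ge> 1" for t
      unfolding right[OF that] Z_def[symmetric] using \<open>Z > 0\<close> by simp
  qed (use cont C in auto)
qed

text \<open>
  Differences of rescaled and translated steps are smoothed indicators of intervals. As \<open>m\<close> grows
  they converge to the indicator of \<open>{x<..y}\<close>, the step being \<open>0\<close> at the origin.
\<close>

lemma step_difference_test_function:
  assumes P: "\<And>t. (P has_real_derivative \<rho> t) (at t)" "\<And>n. smooth_upto n \<rho>"
    "\<And>t. t \<le> 0 \<Longrightarrow> P t = 0" "\<And>t. t \<ge> 1 \<Longrightarrow> P t = 1" and "m \<ge> 1"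
  shows "test_function (\<lambda>t. P (m * (t - x)) - P (m * (t - y)))"
    and "deriv (\<lambda>t. P (m * (t - x)) - P (m * (t - y))) =
      (\<lambda>t. m * \<rho> (m * (t - x)) - m * \<rho> (m * (t - y)))"
    and "t \<notin> {min x y .. max x y + 1} \<Longrightarrow> P (m * (t - x)) - P (m * (t - y)) = 0"
proof -
  have smooth_P: "smooth_upto n P" for n
    by (cases n) (auto intro!: smooth_upto_SucI[OF P(1)] P(2) simp del: smooth_upto.simps(2))
  have shift: "smooth_upto n (\<lambda>t. P (m * (t - x)))" for n x
    using smooth_upto_affine[OF smooth_P, of n m "- m * x"] by (simp add: algebra_simps)
  have "smooth_upto n (\<lambda>t. P (m * (t - x)) + (-1) * P (m * (t - y)))" for n
    by (intro smooth_upto_add smooth_upto_mult smooth_upto_const shift)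
  then have smooth: "smooth_upto n (\<lambda>t. P (m * (t - x)) - P (m * (t - y)))" for n
    by simp
  have big: "1 \<le> m * (t - z)" if "t \<ge> z + 1" for t z
    using mult_mono[of 1 m 1 "t - z"] that \<open>m \<ge> 1\<close> by simp
  have small: "m * (t - z) \<le> 0" if "t \<le> z" for t z
    using that \<open>m \<ge> 1\<close> by (simp add: mult_nonneg_nonpos)
  show supp: "P (m * (t - x)) - P (m * (t - y)) = 0" if "t \<notin> {min x y .. max x y + 1}" for t
    using that P(3)[OF small, of t x] P(3)[OF small, of t y] P(4)[OF big, of x t] P(4)[OF big, of y t]
    by auto
  have "closure {t. P (m * (t - x)) - P (m * (t - y)) \<noteq> 0} \<subseteq> {min x y .. max x y + 1}"
    by (rule closure_minimal) (use supp in blast, simp)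
  then have "compact (closure {t. P (m * (t - x)) - P (m * (t - y)) \<noteq> 0})"
    by (meson bounded_subset bounded_closed_interval closed_closure compact_eq_bounded_closed)
  then show "test_function (\<lambda>t. P (m * (t - x)) - P (m * (t - y)))"
    unfolding test_function_def using smooth smooth_upto_imp_differentiable by blast
  have D: "((\<lambda>t. P (m * (t - x))) has_real_derivative m * \<rho> (m * (t - x))) (at t)" for t x
    by (rule DERIV_cong[OF DERIV_chain2[OF P(1)]]) (auto intro!: derivative_eq_intros)
  show "deriv (\<lambda>t. P (m * (t - x)) - P (m * (t - y))) =
      (\<lambda>t. m * \<rho> (m * (t - x)) - m * \<rho> (m * (t - y)))"
    by (rule ext, rule DERIV_imp_deriv, rule DERIV_diff; rule D)
qed

section \<open>Weak derivatives and continuous representatives\<close>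

definition weak_derivative :: "l2 \<Rightarrow> l2 \<Rightarrow> bool" where
  "weak_derivative f g \<longleftrightarrow> (\<forall>\<phi>. test_function \<phi> \<longrightarrow>
     (LINT x|lebesgue. rep_l2 f x * complex_of_real (deriv \<phi> x)) =
     - (LINT x|lebesgue. rep_l2 g x * complex_of_real (\<phi> x)))"

lemma H1_iff: "f \<in> H1 \<longleftrightarrow> (\<exists>g. weak_derivative f g)"
  by (simp add: H1_def weak_derivative_def)

lemma borel_measurable_lebesgue_of_continuous:
  fixes \<psi> :: "real \<Rightarrow> 'a :: real_normed_vector"
  assumes "continuous_on UNIV \<psi>"
  shows "\<psi> \<in> borel_measurable lebesgue"
  using borel_measurable_continuous_onI[OF assms] by (intro measurable_completion) simp

lemma borel_measurable_ident_lebesgue [measurable]: "(\<lambda>x::real. x) \<in> borel_measurable lebesgue"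
  by (rule measurable_completion) simp

lemma borel_measurable_cnj [measurable]:
  "f \<in> borel_measurable M \<Longrightarrow> (\<lambda>x. cnj (f x)) \<in> borel_measurable M"
  by (rule borel_measurable_continuous_on[OF continuous_on_cnj[OF continuous_on_id]])

lemma test_function_continuous:
  assumes "test_function \<phi>"
  shows "continuous_on UNIV \<phi>" "continuous_on UNIV (deriv \<phi>)"
    "(\<phi> has_real_derivative deriv \<phi> x) (at x)"
proof -
  have "((deriv ^^ 0) \<phi>) field_differentiable (at x)" "((deriv ^^ 1) \<phi>) field_differentiable (at x)" for x
    using assms unfolding test_function_def by blast+
  then have D: "\<phi> field_differentiable (at x)" "deriv \<phi> field_differentiable (at x)" for x
    by simp_all
  then show "continuous_on UNIV \<phi>" "continuous_on UNIV (deriv \<phi>)"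
    by (auto intro!: continuous_at_imp_continuous_on field_differentiable_imp_continuous_at)
  show "(\<phi> has_real_derivative deriv \<phi> x) (at x)"
    using D(1) by (simp add: DERIV_deriv_iff_field_differentiable)
qed

lemma test_function_support:
  assumes "test_function \<phi>"
  obtains A B where "A \<le> B" "\<And>x. x \<notin> {A..B} \<Longrightarrow> \<phi> x = 0" "\<And>x. x \<notin> {A..B} \<Longrightarrow> deriv \<phi> x = 0"
proof -
  have "bounded (closure {x. \<phi> x \<noteq> 0})"
    using assms by (auto simp: test_function_def compact_imp_bounded)
  then obtain K where "\<And>x. x \<in> closure {x. \<phi> x \<noteq> 0} \<Longrightarrow> \<bar>x\<bar> \<le> K"
    unfolding bounded_iff real_norm_def by blast
  then have K: "\<bar>x\<bar> \<le> K" if "\<phi> x \<noteq> 0" for x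
    using that subsetD[OF closure_subset, of x "{x. \<phi> x \<noteq> 0}"] by simp
  have zero: "\<phi> x = 0" if "x \<notin> {-\<bar>K\<bar>..\<bar>K\<bar>}" for x
    using K[of x] that by (cases "\<phi> x = 0") auto
  have "deriv \<phi> x = 0" if "x \<notin> {-\<bar>K\<bar>..\<bar>K\<bar>}" for x
  proof -
    have "(\<phi> has_real_derivative 0) (at x)"
    proof (rule has_field_derivative_transform_within_open[of "\<lambda>_. 0" _ _ "- {-\<bar>K\<bar>..\<bar>K\<bar>}"])
      show "open (- {-\<bar>K\<bar>..\<bar>K\<bar>})"
        by (intro open_Compl) simp
    qed (use that zero in auto)
    then show ?thesis by (rule DERIV_imp_deriv)
  qed
  then show ?thesis
    using zero that[of "-\<bar>K\<bar>" "\<bar>K\<bar>"] by auto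
qed

lemma integrable_indicator_Icc [simp]: "integrable lebesgue (indicator {a..b::real} :: real \<Rightarrow> real)"
  by (intro integrable_real_indicator) (auto simp: emeasure_lborel_Icc_eq)

lemma square_integrable_bounded_support:
  fixes k :: "real \<Rightarrow> complex"
  assumes [measurable]: "k \<in> borel_measurable lebesgue"
    and "\<And>x. cmod (k x) \<le> C * indicator {A..B} x"
  shows "square_integrable k"
proof -
  have "integrable lebesgue (\<lambda>x. (cmod (k x))\<^sup>2)"
  proof (rule Bochner_Integration.integrable_bound)
    show "integrable lebesgue (\<lambda>x. C\<^sup>2 * indicator {A..B} x :: real)"
      by (intro integrable_mult_right) auto
    show "AE x in lebesgue. norm ((cmod (k x))\<^sup>2) \<le> norm (C\<^sup>2 * indicator {A..B} x :: real)"
    proof (rule AE_I2)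
      fix x
      have "(cmod (k x))\<^sup>2 \<le> (C * indicator {A..B} x)\<^sup>2"
        by (intro power_mono assms) auto
      also have "\<dots> = C\<^sup>2 * indicator {A..B} x"
        by (cases "x \<in> {A..B}") auto
      finally show "norm ((cmod (k x))\<^sup>2) \<le> norm (C\<^sup>2 * indicator {A..B} x :: real)"
        by auto
    qed
  qed measurable
  then show ?thesis by (simp add: square_integrable_def)
qed

lemma integrable_rep_l2_mult:
  fixes k :: "real \<Rightarrow> complex"
  assumes "k \<in> borel_measurable lebesgue" "\<And>x. cmod (k x) \<le> C * indicator {A..B} x"
  shows "integrable lebesgue (\<lambda>x. rep_l2 f x * k x)"
proof -
  have "(\<lambda>x. cnj (k x)) \<in> borel_measurable lebesgue"
    using assms(1) by measurable
  then have "square_integrable (\<lambda>x. cnj (k x))"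
    using assms(2) by (intro square_integrable_bounded_support[of _ C A B]) auto
  from square_integrable_cnj_mult[OF this square_integrable_rep_l2[of f]] show ?thesis
    by (simp add: mult.commute)
qed

lemma integrable_rep_l2_on_Icc: "integrable lebesgue (\<lambda>x. rep_l2 f x * indicator {a..b} x)"
  by (rule integrable_rep_l2_mult[where C = 1 and A = a and B = b], measurable)
    (auto simp: indicator_def)

lemma cinner_real_function:
  assumes "square_integrable (\<lambda>x. complex_of_real (\<psi> x))"
  shows "cinner (abs_l2 (\<lambda>x. complex_of_real (\<psi> x))) f
    = (LINT x|lebesgue. rep_l2 f x * complex_of_real (\<psi> x))"
proof -
  have [measurable]: "(\<lambda>x. complex_of_real (\<psi> x)) \<in> borel_measurable lebesgue"
    using assms by (simp add: square_integrable_def)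
  show ?thesis
    unfolding cinner_rep_l2
  proof (rule integral_cong_AE)
    show "AE x in lebesgue. cnj (rep_l2 (abs_l2 (\<lambda>x. complex_of_real (\<psi> x))) x) * rep_l2 f x
        = rep_l2 f x * complex_of_real (\<psi> x)"
      using rep_abs_l2[OF assms] by eventually_elim (simp add: mult.commute)
  qed (intro borel_measurable_times borel_measurable_cnj rep_l2_measurable; measurable)+
qed

lemma test_function_square_integrable:
  assumes "test_function \<phi>"
  shows "square_integrable (\<lambda>x. complex_of_real (\<phi> x))"
    and "square_integrable (\<lambda>x. complex_of_real (deriv \<phi> x))"
proof -
  obtain A B where AB: "\<And>x. x \<notin> {A..B} \<Longrightarrow> \<phi> x = 0" "\<And>x. x \<notin> {A..B} \<Longrightarrow> deriv \<phi> x = 0"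
    using test_function_support[OF assms] by metis
  have [measurable]: "\<phi> \<in> borel_measurable lebesgue" "deriv \<phi> \<in> borel_measurable lebesgue"
    using test_function_continuous(1,2)[OF assms] by (auto intro: borel_measurable_lebesgue_of_continuous)
  obtain C where C: "\<And>x. \<bar>\<phi> x\<bar> \<le> C * indicator {A..B} x"
    using bounded_of_continuous_support[OF test_function_continuous(1)[OF assms] AB(1)] by metis
  show "square_integrable (\<lambda>x. complex_of_real (\<phi> x))"
    by (rule square_integrable_bounded_support[of _ C A B]) (use C in auto)
  obtain D where D: "\<And>x. \<bar>deriv \<phi> x\<bar> \<le> D * indicator {A..B} x"
    using bounded_of_continuous_support[OF test_function_continuous(2)[OF assms] AB(2)] by metis
  show "square_integrable (\<lambda>x. complex_of_real (deriv \<phi> x))"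
    by (rule square_integrable_bounded_support[of _ D A B]) (use D in auto)
qed

text \<open>
  In this form weak differentiability is a family of closed linear conditions on \<open>(f, g)\<close>.
\<close>

lemma weak_derivative_iff_cinner:
  "weak_derivative f g \<longleftrightarrow> (\<forall>\<phi>. test_function \<phi> \<longrightarrow>
     cinner (abs_l2 (\<lambda>x. complex_of_real (deriv \<phi> x))) f
     + cinner (abs_l2 (\<lambda>x. complex_of_real (\<phi> x))) g = 0)"
  unfolding weak_derivative_def
  by (auto simp: cinner_real_function test_function_square_integrable add_eq_0_iff2)

lemma weak_derivative_closed_subspace:
  shows "closed {(f, g). weak_derivative f g}" and "subspace {(f, g). weak_derivative f g}"
proof -
  have "{(f, g). weak_derivative f g} = (\<Inter>\<phi>\<in>Collect test_function.
      {p. cinner (abs_l2 (\<lambda>x. complex_of_real (deriv \<phi> x))) (fst p)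
        + cinner (abs_l2 (\<lambda>x. complex_of_real (\<phi> x))) (snd p) = 0})"
    by (auto simp: weak_derivative_iff_cinner)
  also have "closed \<dots>"
    by (intro closed_INT ballI closed_Collect_eq continuous_intros
        bounded_linear.continuous_on[OF bounded_bilinear.bounded_linear_right[OF bounded_bilinear_cinner]])
  finally show "closed {(f, g). weak_derivative f g}" .
  show "subspace {(f, g). weak_derivative f g}"
  proof (rule subspaceI)
    fix x y :: "l2 \<times> l2" and c :: real
    assume x: "x \<in> {(f, g). weak_derivative f g}"
    then show "c *\<^sub>R x \<in> {(f, g). weak_derivative f g}"
      by (auto simp: weak_derivative_iff_cinner scaleR_l2_def cinner_scaleC_right
          simp flip: distrib_left)
    assume "y \<in> {(f, g). weak_derivative f g}"
    with x show "x + y \<in> {(f, g). weak_derivative f g}"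
      by (auto simp: weak_derivative_iff_cinner cinner_add_right add_eq_0_iff2)
  qed (simp add: weak_derivative_iff_cinner zero_prod_def)
qed

text \<open>Integration by parts: the derivative of \<open>\<phi> \<psi>\<close> integrates to zero.\<close>

lemma weak_derivative_test_function:
  assumes \<phi>: "test_function \<phi>"
  shows "weak_derivative (abs_l2 (\<lambda>x. complex_of_real (\<phi> x))) (abs_l2 (\<lambda>x. complex_of_real (deriv \<phi> x)))"
  unfolding weak_derivative_def
proof (intro allI impI)
  fix \<psi> assume \<psi>: "test_function \<psi>"
  obtain A B where AB: "A \<le> B" "\<And>x. x \<notin> {A..B} \<Longrightarrow> \<psi> x = 0" "\<And>x. x \<notin> {A..B} \<Longrightarrow> deriv \<psi> x = 0"
    using test_function_support[OF \<psi>] by metis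
  note sq = test_function_square_integrable
  note cont = test_function_continuous
  have swap: "(LINT x|lebesgue. rep_l2 (abs_l2 (\<lambda>x. complex_of_real (a x))) x * complex_of_real (b x))
      = complex_of_real (LINT x|lborel. a x * b x)"
    if "square_integrable (\<lambda>x. complex_of_real (a x))" "continuous_on UNIV a" "continuous_on UNIV b" for a b
  proof -
    have [measurable]: "a \<in> borel_measurable borel" "b \<in> borel_measurable borel"
      using that by (auto intro: borel_measurable_continuous_onI)
    have [measurable]: "(\<lambda>x. complex_of_real (a x)) \<in> borel_measurable lebesgue"
      "(\<lambda>x. complex_of_real (b x)) \<in> borel_measurable lebesgue"
      by (rule measurable_completion; simp)+
    have "(LINT x|lebesgue. rep_l2 (abs_l2 (\<lambda>x. complex_of_real (a x))) x * complex_of_real (b x))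
        = (LINT x|lebesgue. complex_of_real (a x) * complex_of_real (b x))"
      by (intro integral_cong_AE borel_measurable_times rep_l2_measurable)
        (use rep_abs_l2[OF that(1)] in \<open>auto elim!: eventually_mono\<close>)
    also have "\<dots> = (LINT x|lborel. complex_of_real (a x * b x))"
      by (subst integral_completion) auto
    finally show ?thesis
      by (simp only: integral_complex_of_real)
  qed
  have "(LINT x|lborel. deriv \<phi> x * \<psi> x + \<phi> x * deriv \<psi> x) = 0"
  proof -
    \<comment> \<open>The interval is enlarged by one on both sides so that \<open>\<psi>\<close> vanishes at its end points.\<close>
    have D: "((\<lambda>x. \<phi> x * \<psi> x) has_real_derivative deriv \<phi> x * \<psi> x + \<phi> x * deriv \<psi> x) (at x)" for x
      by (rule DERIV_cong[OF DERIV_mult[OF cont(3)[OF \<phi>] cont(3)[OF \<psi>]]]) (simp add: mult.commute)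
    have "continuous_on UNIV (\<lambda>x. deriv \<phi> x * \<psi> x + \<phi> x * deriv \<psi> x)"
      by (intro continuous_intros cont \<phi> \<psi>)
    then have "(LINT x|lborel. (deriv \<phi> x * \<psi> x + \<phi> x * deriv \<psi> x) * indicator {A - 1..B + 1} x)
        = \<phi> (B + 1) * \<psi> (B + 1) - \<phi> (A - 1) * \<psi> (A - 1)"
      using AB(1) D by (intro integral_FTC_Icc_real) (auto simp: continuous_on_eq_continuous_at)
    also have "\<dots> = 0"
      using AB by simp
    also have "(\<lambda>x. (deriv \<phi> x * \<psi> x + \<phi> x * deriv \<psi> x) * indicator {A - 1..B + 1} x)
        = (\<lambda>x. deriv \<phi> x * \<psi> x + \<phi> x * deriv \<psi> x)"
    proof
      fix x
      show "(deriv \<phi> x * \<psi> x + \<phi> x * deriv \<psi> x) * indicator {A - 1..B + 1} x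
          = deriv \<phi> x * \<psi> x + \<phi> x * deriv \<psi> x"
        using AB(2,3)[of x] by (cases "x \<in> {A - 1..B + 1}") auto
    qed
    finally show ?thesis .
  qed
  moreover have "integrable lborel (\<lambda>x. a x * b x)"
    if "continuous_on UNIV a" "continuous_on UNIV b" "\<And>x. x \<notin> {A..B} \<Longrightarrow> b x = 0" for a b :: "real \<Rightarrow> real"
  proof -
    have "integrable lborel (\<lambda>x. indicator {A..B} x *\<^sub>R (a x * b x))"
      unfolding set_integrable_def[symmetric]
      by (intro borel_integrable_atLeastAtMost' continuous_intros continuous_on_subset[OF that(1)]
          continuous_on_subset[OF that(2)]) auto
    also have "(\<lambda>x. indicator {A..B} x *\<^sub>R (a x * b x)) = (\<lambda>x. a x * b x)"
    proof
      show "indicator {A..B} x *\<^sub>R (a x * b x) = a x * b x" for x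
        using that(3)[of x] by (cases "x \<in> {A..B}") auto
    qed
    finally show ?thesis .
  qed
  ultimately have "(LINT x|lborel. deriv \<phi> x * \<psi> x) + (LINT x|lborel. \<phi> x * deriv \<psi> x) = 0"
    using AB \<phi> \<psi> by (simp add: cont)
  then have "(LINT x|lborel. \<phi> x * deriv \<psi> x) = - (LINT x|lborel. deriv \<phi> x * \<psi> x)"
    by linarith
  then show "(LINT x|lebesgue. rep_l2 (abs_l2 (\<lambda>x. complex_of_real (\<phi> x))) x * complex_of_real (deriv \<psi> x)) =
      - (LINT x|lebesgue. rep_l2 (abs_l2 (\<lambda>x. complex_of_real (deriv \<phi> x))) x * complex_of_real (\<psi> x))"
    by (subst (1 2) swap) (simp_all add: sq cont \<phi> \<psi>)
qed

text \<open>
  The positive and the negative part of \<open>h\<close> are densities of two measures that agree on all half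
  lines, hence everywhere.
\<close>

lemma AE_zero_of_Ioi_integrals:
  fixes h :: "real \<Rightarrow> real"
  assumes int: "integrable lborel h" and zero: "\<And>x. (LINT t|lborel. h t * indicator {x<..} t) = 0"
  shows "AE t in lborel. h t = 0"
proof -
  have [measurable]: "h \<in> borel_measurable borel"
    using borel_measurable_integrable[OF int] by simp
  define M where "M = density lborel (\<lambda>t. ennreal (h t))"
  define N where "N = density lborel (\<lambda>t. ennreal (- h t))"
  have M: "emeasure M {x<..} = (\<integral>\<^sup>+t. ennreal (h t * indicator {x<..} t) \<partial>lborel)" for x
    unfolding M_def
    by (subst emeasure_density) (auto intro!: nn_integral_cong simp: indicator_def)
  have N: "emeasure N {x<..} = (\<integral>\<^sup>+t. ennreal (- (h t * indicator {x<..} t)) \<partial>lborel)" for x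
    unfolding N_def
    by (subst emeasure_density) (auto intro!: nn_integral_cong simp: indicator_def)
  have int_x: "integrable lborel (\<lambda>t. h t * indicator {x<..} t)" for x
    using integrable_mult_indicator[OF _ int, of "{x<..}"] by (simp add: mult.commute)
  have fin: "emeasure M {x<..} < \<infinity>" "emeasure N {x<..} < \<infinity>" for x
    unfolding M N using int_x[of x] by (auto simp: real_integrable_def less_top)
  have "M = N"
  proof (rule measure_eqI_lessThan)
    fix x
    have "enn2real (emeasure M {x<..}) = enn2real (emeasure N {x<..})"
      using real_lebesgue_integral_def[OF int_x[of x]] zero[of x] by (simp add: M N)
    then show "emeasure M {x<..} = emeasure N {x<..}"
      using fin[of x] by (metis ennreal_enn2real infinity_ennreal_def)
  qed (use fin in \<open>auto simp: M_def N_def\<close>)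
  then have "AE t in lborel. ennreal (h t) = ennreal (- h t)"
    unfolding M_def N_def by (intro sigma_finite_measure.density_unique[OF sigma_finite_lborel]) auto
  then show ?thesis
  proof eventually_elim
    case (elim t)
    then show ?case
      by (cases "h t \<ge> 0") (auto simp: ennreal_neg ennreal_eq_0_iff)
  qed
qed

lemma AE_zero_of_Icc_integrals:
  fixes h :: "real \<Rightarrow> real"
  assumes int: "\<And>a b. integrable lebesgue (\<lambda>t. h t * indicator {a..b} t)"
    and zero: "\<And>a b. a \<le> b \<Longrightarrow> (LINT t|lebesgue. h t * indicator {a..b} t) = 0"
  shows "AE t in lebesgue. h t = 0"
proof -
  have "AE t in lebesgue. h t * indicator {- real n..real n} t = 0" for n
  proof -
    obtain k where [measurable]: "k \<in> borel_measurable lborel"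
      and k: "AE t in lborel. h t * indicator {- real n..real n} t = k t"
      using completion_ex_borel_measurable_real[OF borel_measurable_integrable[OF int[of "- real n" "real n"]]]
      by auto
    have [measurable]: "k \<in> borel_measurable lebesgue"
      by (intro measurable_completion) auto
    have k': "AE t in lebesgue. h t * indicator {- real n..real n} t = k t"
      using k by (rule AE_completion)
    have "integrable lebesgue k"
      by (rule integrable_cong_AE_imp[OF int[of "- real n" "real n"]]) (use k' in auto)
    then have "integrable lborel k"
      by (simp add: integrable_completion)
    moreover have "(LINT t|lborel. k t * indicator {x<..} t) = 0" for x
    proof -
      \<comment> \<open>Up to one point the half line meets \<open>[- n, n]\<close> in a compact interval.\<close>
      define a where "a = max x (- real n)"
      have "(LINT t|lborel. k t * indicator {x<..} t) = (LINT t|lebesgue. k t * indicator {x<..} t)"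
        by (rule integral_completion[symmetric]) auto
      also have "\<dots> = (LINT t|lebesgue. h t * indicator {a..real n} t)"
      proof (rule integral_cong_AE)
        have "AE t in lborel. t \<noteq> x"
          by (rule AE_lborel_singleton)
        then have "AE t in lebesgue. t \<noteq> x"
          by (rule AE_completion)
        then show "AE t in lebesgue. k t * indicator {x<..} t = h t * indicator {a..real n} t"
          using k' by eventually_elim (auto simp: a_def indicator_def split: if_splits)
      next
        have [measurable]: "indicat_real {x<..} \<in> borel_measurable lebesgue"
          by (rule measurable_completion) simp
        show "(\<lambda>t. k t * indicator {x<..} t) \<in> borel_measurable lebesgue"
          by measurable
      qed (rule borel_measurable_integrable[OF int])
      also have "\<dots> = 0"
      proof (cases "a \<le> real n")
        case True
        then show ?thesis by (rule zero)
      qed simp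
      finally show ?thesis .
    qed
    ultimately have "AE t in lborel. k t = 0"
      by (rule AE_zero_of_Ioi_integrals)
    then have "AE t in lebesgue. k t = 0"
      by (rule AE_completion)
    then show ?thesis
      using k' by eventually_elim simp
  qed
  then have "AE t in lebesgue. \<forall>n. h t * indicator {- real n..real n} t = 0"
    unfolding AE_all_countable by blast
  then show ?thesis
  proof eventually_elim
    case (elim t)
    obtain n where "\<bar>t\<bar> \<le> real n"
      using real_arch_simple by blast
    then show ?case
      using elim[rule_format, of n] by (auto simp: indicator_def)
  qed
qed

lemma AE_eq_of_Icc_integrals:
  fixes f u :: "real \<Rightarrow> complex"
  assumes int: "\<And>a b. integrable lebesgue (\<lambda>t. f t * indicator {a..b} t)"
      "\<And>a b. integrable lebesgue (\<lambda>t. u t * indicator {a..b} t)"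
    and eq: "\<And>a b. a \<le> b \<Longrightarrow>
      (LINT t|lebesgue. f t * indicator {a..b} t) = (LINT t|lebesgue. u t * indicator {a..b} t)"
  shows "AE t in lebesgue. f t = u t"
proof -
  have int': "integrable lebesgue (\<lambda>t. (f t - u t) * indicator {a..b} t)" for a b
    using Bochner_Integration.integrable_diff[OF int, of a b] by (simp add: algebra_simps)
  have eq': "(LINT t|lebesgue. (f t - u t) * indicator {a..b} t) = 0" if "a \<le> b" for a b
    using eq[OF that] int[of a b] by (simp add: left_diff_distrib)
  have Re: "Re ((f t - u t) * indicator {a..b} t) = Re (f t - u t) * indicator {a..b} t"
    and Im: "Im ((f t - u t) * indicator {a..b} t) = Im (f t - u t) * indicator {a..b} t" for t a b
    by (auto simp: indicator_def)
  have "AE t in lebesgue. Re (f t - u t) = 0"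
  proof (rule AE_zero_of_Icc_integrals)
    show "integrable lebesgue (\<lambda>t. Re (f t - u t) * indicator {a..b} t)" for a b
      using integrable_bounded_linear[OF bounded_linear_Re int', of a b] unfolding Re .
    show "(LINT t|lebesgue. Re (f t - u t) * indicator {a..b} t) = 0" if "a \<le> b" for a b
      using integral_bounded_linear[OF bounded_linear_Re int', of a b] eq'[OF that] unfolding Re by simp
  qed
  moreover have "AE t in lebesgue. Im (f t - u t) = 0"
  proof (rule AE_zero_of_Icc_integrals)
    show "integrable lebesgue (\<lambda>t. Im (f t - u t) * indicator {a..b} t)" for a b
      using integrable_bounded_linear[OF bounded_linear_Im int', of a b] unfolding Im .
    show "(LINT t|lebesgue. Im (f t - u t) * indicator {a..b} t) = 0" if "a \<le> b" for a b
      using integral_bounded_linear[OF bounded_linear_Im int', of a b] eq'[OF that] unfolding Im by simp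
  qed
  ultimately show ?thesis
    by eventually_elim (simp add: complex_eq_iff)
qed

lemma sigma_finite_lebesgue: "sigma_finite_measure (lebesgue :: real measure)"
proof
  show "\<exists>A. countable A \<and> A \<subseteq> sets (lebesgue :: real measure) \<and> \<Union>A = space lebesgue \<and>
      (\<forall>a\<in>A. emeasure lebesgue a \<noteq> \<infinity>)"
  proof (intro exI conjI)
    show "\<Union>(range (\<lambda>n. {- real n..real n})) = space lebesgue"
      by (auto simp: abs_le_iff[symmetric] minus_le_iff intro: real_arch_simple) 
        (metis abs_le_iff minus_le_iff real_arch_simple)
  qed (auto simp: emeasure_lborel_Icc_eq)
qed

text \<open>
  Testing the weak derivative on the smoothed indicator \<open>\<phi>\<^sub>n\<close> of \<open>{x<..y}\<close> expresses the
  difference of two mollifications \<open>F\<^sub>n x = \<integral> f(t) n \<rho>(n (t - x)) dt\<close> through \<open>\<integral> g \<phi>\<^sub>n\<close>, which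
  converges to the integral of \<open>g\<close> over \<open>{x<..y}\<close>. The averages \<open>\<integral> F\<^sub>n\<close> over an interval converge
  to those of \<open>f\<close> by Fubini's theorem. Hence \<open>F\<^sub>n\<close> converges at every point, and its limit has the
  same averages as \<open>f\<close>.
\<close>

theorem weak_derivative_representative:
  assumes fg: "weak_derivative f g"
  obtains u where "AE x in lebesgue. rep_l2 f x = u x" "u \<in> borel_measurable lebesgue"
    "\<And>x y. x \<le> y \<Longrightarrow> u y - u x = (LINT t|lebesgue. rep_l2 g t * indicator {x<..y} t)"
proof -
  interpret L: sigma_finite_measure "lebesgue :: real measure"
    by (rule sigma_finite_lebesgue)
  interpret LL: pair_sigma_finite "lebesgue :: real measure" "lebesgue :: real measure" ..
  obtain P \<rho> :: "real \<Rightarrow> real" and C where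
    P: "\<And>t. (P has_real_derivative \<rho> t) (at t)" "\<And>n. smooth_upto n \<rho>"
    and cont_\<rho>: "continuous_on UNIV \<rho>" and C: "C \<ge> 0" "\<And>t. \<bar>\<rho> t\<bar> \<le> C * indicator {0..1} t"
    and step: "\<And>t. t \<le> 0 \<or> t \<ge> 1 \<Longrightarrow> \<rho> t = 0"
    "\<And>t. t \<le> 0 \<Longrightarrow> P t = 0" "\<And>t. t \<ge> 1 \<Longrightarrow> P t = 1" "\<And>t. 0 \<le> P t \<and> P t \<le> 1"
    by (fact smooth_step)
  have cont_P: "continuous_on UNIV P"
    using P(1) by (meson DERIV_isCont continuous_at_imp_continuous_on)
  have [measurable]: "\<rho> \<in> borel_measurable borel" "P \<in> borel_measurable borel"
    using cont_\<rho> cont_P by (auto intro: borel_measurable_continuous_onI)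
  have [simp]: "cmod (indicator A t) = indicator A t" for A :: "real set" and t
    by (auto simp: indicator_def)
  define m where "m n = real (Suc n)" for n
  have m: "m n \<ge> 1" for n
    by (simp add: m_def)
  \<comment> \<open>\<open>\<phi> n x y\<close> is the smoothed indicator of \<open>{x<..y}\<close>, with \<open>\<psi> n x - \<psi> n y\<close> its derivative and \<open>ind x y\<close> its limit.\<close>
  define \<psi> where "\<psi> n x t = m n * \<rho> (m n * (t - x))" for n x t
  define \<phi> where "\<phi> n x y t = P (m n * (t - x)) - P (m n * (t - y))" for n x y t
  define ind where "ind x y t = indicator {x<..} t - (indicator {y<..} t :: real)" for x y t :: real
  have [measurable]: "\<psi> n x \<in> borel_measurable lebesgue" "\<phi> n x y \<in> borel_measurable lebesgue"
    "(\<lambda>p. \<psi> n (fst p) (snd p)) \<in> borel_measurable (lebesgue \<Otimes>\<^sub>M lebesgue)" for n x y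
    unfolding \<psi>_def \<phi>_def
    using measurable_compose[OF measurable_fst borel_measurable_ident_lebesgue]
      measurable_compose[OF measurable_snd borel_measurable_ident_lebesgue]
    by measurable
  have [measurable]: "indicat_real {x<..} \<in> borel_measurable lebesgue"
      "indicat_real {x<..y} \<in> borel_measurable lebesgue" for x y :: real
    by (rule measurable_completion; simp)+
  have [measurable]: "ind x y \<in> borel_measurable lebesgue" for x y
    unfolding ind_def by measurable
  have \<psi>_bound: "\<bar>\<psi> n x t\<bar> \<le> m n * C * indicator {x..x + 1} t" for n x t
  proof (cases "0 < m n * (t - x) \<and> m n * (t - x) < 1")
    case True
    then have "t > x"
      using m[of n] by (simp add: zero_less_mult_iff)
    moreover have le: "t - x \<le> m n * (t - x)"
      using m[of n] \<open>t > x\<close> mult_right_mono[of 1 "m n" "t - x"] by simp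
    ultimately have "t \<in> {x..x + 1}"
      using True le \<open>t > x\<close> by (intro atLeastAtMost_iff[THEN iffD2] conjI) linarith+
    moreover have "\<bar>\<rho> (m n * (t - x))\<bar> \<le> C"
      using C(2)[of "m n * (t - x)"] True by auto
    ultimately show ?thesis
      using m[of n] by (simp add: \<psi>_def abs_mult mult_left_mono)
  next
    case False
    then have "\<rho> (m n * (t - x)) = 0"
      by (intro step(1)) auto
    then show ?thesis
      using m[of n] C(1) by (simp add: \<psi>_def)
  qed
  have \<phi>_bound: "\<bar>\<phi> n x y t\<bar> \<le> indicator {min x y..max x y + 1} t" for n x y t
  proof (cases "t \<in> {min x y..max x y + 1}")
    case True
    then show ?thesis
      using step(4)[of "m n * (t - x)"] step(4)[of "m n * (t - y)"] unfolding \<phi>_def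
      by (auto simp: abs_le_iff simp del: atLeastAtMost_iff)
  next
    case False
    then show ?thesis
      using step_difference_test_function(3)[OF P step(2,3) m False] unfolding \<phi>_def by simp
  qed
  have \<phi>_lim: "(\<lambda>n. \<phi> n x y t) \<longlonglongrightarrow> ind x y t" for x y t
  proof -
    have lim: "(\<lambda>n. P (m n * (t - x))) \<longlonglongrightarrow> indicator {x<..} t" for x
    proof (cases "t > x")
      case True
      obtain N where N: "1 / (t - x) \<le> real N"
        using real_arch_simple by blast
      have "P (m n * (t - x)) = 1" if "n \<ge> N" for n
      proof (rule step(3))
        have "1 / (t - x) \<le> m n"
          using N that by (simp add: m_def)
        then show "m n * (t - x) \<ge> 1"
          using True by (simp add: pos_divide_le_eq)
      qed
      then show ?thesis
        using True by (intro tendsto_eventually) (auto simp: eventually_sequentially)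
    next
      case False
      then have "P (m n * (t - x)) = 0" for n
        using m[of n] by (intro step(2)) (simp add: mult_nonneg_nonpos)
      then show ?thesis
        using False by simp
    qed
    then show ?thesis
      unfolding \<phi>_def ind_def by (intro tendsto_diff lim)
  qed
  have test_lim: "(\<lambda>n. LINT t|lebesgue. rep_l2 h t * complex_of_real (\<phi> n x y t))
      \<longlonglongrightarrow> (LINT t|lebesgue. rep_l2 h t * complex_of_real (ind x y t))" for h x y
  proof (rule integral_dominated_convergence)
    show "integrable lebesgue (\<lambda>t. cmod (rep_l2 h t * indicator {min x y..max x y + 1} t))"
      by (intro integrable_norm integrable_rep_l2_on_Icc)
    show "AE t in lebesgue. (\<lambda>n. rep_l2 h t * complex_of_real (\<phi> n x y t))
        \<longlonglongrightarrow> rep_l2 h t * complex_of_real (ind x y t)"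
      by (intro AE_I2 tendsto_mult tendsto_const tendsto_of_real \<phi>_lim)
    show "AE t in lebesgue. norm (rep_l2 h t * complex_of_real (\<phi> n x y t))
        \<le> cmod (rep_l2 h t * indicator {min x y..max x y + 1} t)" for n
      using \<phi>_bound[of n x y] by (intro AE_I2) (auto simp: norm_mult intro!: mult_left_mono)
  qed measurable
  define F where "F n x = (LINT t|lebesgue. rep_l2 f t * complex_of_real (\<psi> n x t))" for n x
  have [measurable]: "F n \<in> borel_measurable lebesgue" for n
    unfolding F_def by measurable
  have int_\<psi>: "integrable lebesgue (\<lambda>t. rep_l2 f t * complex_of_real (\<psi> n x t))" for n x
    by (rule integrable_rep_l2_mult[where C = "m n * C" and A = x and B = "x + 1"], measurable)
      (use \<psi>_bound in auto)
  \<comment> \<open>The increments \<open>D n x\<close> of \<open>F n\<close> from \<open>0\<close> converge; it remains to control \<open>F n 0\<close>, which follows from the averages over \<open>{0..1}\<close>.\<close>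
  define D where "D n x = - (LINT t|lebesgue. rep_l2 g t * complex_of_real (\<phi> n x 0 t))" for n x
  have F_diff: "F n x - F n y = - (LINT t|lebesgue. rep_l2 g t * complex_of_real (\<phi> n x y t))" for n x y
  proof -
    note diff = step_difference_test_function[OF P step(2,3) m[of n], of x y]
    have "F n x - F n y = (LINT t|lebesgue.
        rep_l2 f t * complex_of_real (\<psi> n x t) - rep_l2 f t * complex_of_real (\<psi> n y t))"
      unfolding F_def
      by (rule sym, rule Bochner_Integration.integral_diff; rule int_\<psi>)
    also have "\<dots> = (LINT t|lebesgue. rep_l2 f t * complex_of_real (\<psi> n x t - \<psi> n y t))"
      by (intro Bochner_Integration.integral_cong refl) (simp add: right_diff_distrib)
    also have "\<dots> = (LINT t|lebesgue. rep_l2 f t * complex_of_real (deriv (\<lambda>t. P (m n * (t - x)) - P (m n * (t - y))) t))"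
      by (simp only: diff(2) \<psi>_def)
    also have "\<dots> = - (LINT t|lebesgue. rep_l2 g t * complex_of_real (\<phi> n x y t))"
      using fg diff(1) unfolding weak_derivative_def \<phi>_def by blast
    finally show ?thesis .
  qed
  have F_eq: "F n x = F n 0 + D n x" for n x
    using F_diff[of n x 0] by (simp add: D_def algebra_simps)
  have [measurable]: "D n \<in> borel_measurable lebesgue" for n
  proof -
    have "D n = (\<lambda>x. F n x - F n 0)"
    proof
      show "D n x = F n x - F n 0" for x
        using F_eq[of n x] by simp
    qed
    then show ?thesis
      by simp
  qed
  define \<gamma> where "\<gamma> R = (LINT t|lebesgue. cmod (rep_l2 g t * indicator {-R..R + 1} t))" for R
  have D_bound: "cmod (D n x) \<le> \<gamma> R" if "\<bar>x\<bar> \<le> R" for n x R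
  proof -
    have "cmod (D n x) \<le> (LINT t|lebesgue. cmod (rep_l2 g t * complex_of_real (\<phi> n x 0 t)))"
      unfolding D_def norm_minus_cancel by (rule integral_norm_bound)
    also have "\<dots> \<le> \<gamma> R"
      unfolding \<gamma>_def
    proof (rule integral_mono)
      show "integrable lebesgue (\<lambda>t. cmod (rep_l2 g t * complex_of_real (\<phi> n x 0 t)))"
        by (intro integrable_norm integrable_rep_l2_mult[where C = 1 and A = "min x 0" and B = "max x 0 + 1"])
          (use \<phi>_bound[of n x 0] in \<open>auto simp del: atLeastAtMost_iff\<close>)
      fix t
      have "\<bar>\<phi> n x 0 t\<bar> \<le> indicator {min x 0..max x 0 + 1} t"
        by (rule \<phi>_bound)
      also have "\<dots> \<le> indicator {-R..R + 1} t"
        using that by (auto simp: indicator_def)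
      finally show "cmod (rep_l2 g t * complex_of_real (\<phi> n x 0 t)) \<le> cmod (rep_l2 g t * indicator {-R..R + 1} t)"
        by (auto simp: norm_mult intro!: mult_left_mono)
    qed (intro integrable_norm integrable_rep_l2_on_Icc)
    finally show ?thesis .
  qed
  define D' where "D' x = - (LINT t|lebesgue. rep_l2 g t * complex_of_real (ind x 0 t))" for x
  have D_lim: "(\<lambda>n. D n x) \<longlonglongrightarrow> D' x" for x
    unfolding D_def D'_def by (intro tendsto_minus test_lim)
  have [measurable]: "D' \<in> borel_measurable lebesgue"
    by (rule borel_measurable_LIMSEQ_metric[where f = D, OF _ D_lim]) measurable
  have average: "(LINT x|lebesgue. F n x * indicator {a..b} x)
      = (LINT t|lebesgue. rep_l2 f t * complex_of_real (\<phi> n a b t))" if "a \<le> b" for n a b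
  proof -
    define k where "k x t = rep_l2 f t * complex_of_real (\<psi> n x t) * indicator {a..b} x" for x t
    have [measurable]: "(\<lambda>p. indicator {a..b} (fst p) :: complex) \<in> borel_measurable (lebesgue \<Otimes>\<^sub>M lebesgue)"
      by (rule measurable_compose[OF measurable_fst]) measurable
    have [measurable]: "(\<lambda>p. rep_l2 f (snd p)) \<in> borel_measurable (lebesgue \<Otimes>\<^sub>M lebesgue)"
      by (rule measurable_compose[OF measurable_snd]) measurable
    have [measurable]: "case_prod k \<in> borel_measurable (lebesgue \<Otimes>\<^sub>M lebesgue)"
      unfolding k_def case_prod_beta by measurable
    define K where "K = (LINT t|lebesgue. m n * C * cmod (rep_l2 f t * indicator {a..b + 1} t))"
    have k_bound: "norm (k x t) \<le> m n * C * cmod (rep_l2 f t * indicator {a..b + 1} t) * indicator {a..b} x" for x t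
    proof (cases "x \<in> {a..b}")
      case True
      then have "\<bar>\<psi> n x t\<bar> \<le> m n * C * indicator {a..b + 1} t"
        using \<psi>_bound[of n x t] m[of n] C(1)
        by (cases "t \<in> {x..x + 1}") (auto intro: order_trans)
      then have "cmod (rep_l2 f t) * \<bar>\<psi> n x t\<bar> \<le> cmod (rep_l2 f t) * (m n * C * indicator {a..b + 1} t)"
        by (intro mult_left_mono) auto
      then show ?thesis
        using True by (simp add: k_def norm_mult mult_ac)
    qed (simp add: k_def)
    have int_bound: "integrable lebesgue (\<lambda>t. m n * C * cmod (rep_l2 f t * indicator {a..b + 1} t))"
      by (intro integrable_mult_right integrable_norm integrable_rep_l2_on_Icc)
    have int_k: "integrable lebesgue (k x)" for x
      unfolding k_def by (intro integrable_mult_left int_\<psi>)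
    have "integrable (lebesgue \<Otimes>\<^sub>M lebesgue) (case_prod k)"
    proof (rule LL.Fubini_integrable)
      show "AE x in lebesgue. integrable lebesgue (\<lambda>t. case_prod k (x, t))"
        using int_k by simp
      show "integrable lebesgue (\<lambda>x. LINT t|lebesgue. norm (case_prod k (x, t)))"
      proof (rule Bochner_Integration.integrable_bound)
        show "integrable lebesgue (\<lambda>x. K * indicator {a..b} x :: real)"
          by (intro integrable_mult_right) auto
        show "AE x in lebesgue. norm (LINT t|lebesgue. norm (case_prod k (x, t))) \<le> norm (K * indicator {a..b} x :: real)"
        proof (rule AE_I2)
          fix x
          have "(LINT t|lebesgue. norm (k x t)) \<le> (LINT t|lebesgue. m n * C * cmod (rep_l2 f t * indicator {a..b + 1} t) * indicator {a..b} x)"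
            by (intro integral_mono integrable_norm int_k integrable_mult_left int_bound k_bound)
          also have "\<dots> = K * indicator {a..b} x"
            unfolding K_def by simp
          finally have "(LINT t|lebesgue. norm (k x t)) \<le> K * indicator {a..b} x" .
          moreover have "0 \<le> (LINT t|lebesgue. norm (k x t))"
            by simp
          ultimately show "norm (LINT t|lebesgue. norm (case_prod k (x, t))) \<le> norm (K * indicator {a..b} x :: real)"
            by simp
        qed
      qed measurable
    qed measurable
    then have "(LINT x|lebesgue. LINT t|lebesgue. k x t) = (LINT t|lebesgue. LINT x|lebesgue. k x t)"
      by (rule LL.Fubini_integral[symmetric])
    moreover have "(LINT t|lebesgue. k x t) = F n x * indicator {a..b} x" for x
      unfolding k_def F_def by simp
    moreover have "(LINT x|lebesgue. k x t) = rep_l2 f t * complex_of_real (\<phi> n a b t)" for t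
    proof -
      have cont: "continuous_on UNIV (\<lambda>x. \<psi> n x t)"
        unfolding \<psi>_def by (intro continuous_intros continuous_on_compose2[OF cont_\<rho>]) auto
      have "(LINT x|lebesgue. \<psi> n x t * indicator {a..b} x) = (LINT x|lborel. \<psi> n x t * indicator {a..b} x)"
        by (rule integral_completion, intro borel_measurable_times borel_measurable_indicator)
          (use borel_measurable_continuous_onI[OF cont] in auto)
      also have "\<dots> = - P (m n * (t - b)) - - P (m n * (t - a))"
      proof (rule integral_FTC_Icc_real[OF that])
        show "((\<lambda>x. - P (m n * (t - x))) has_real_derivative \<psi> n x t) (at x)" for x
          unfolding \<psi>_def
          by (rule DERIV_cong[OF DERIV_minus[OF DERIV_chain2[OF P(1)]]])
            (auto intro!: derivative_eq_intros)
        show "isCont (\<lambda>x. \<psi> n x t) x" for x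
          using cont by (simp add: continuous_on_eq_continuous_at)
      qed
      finally have eq: "(LINT x|lebesgue. \<psi> n x t * indicator {a..b} x) = \<phi> n a b t"
        by (simp add: \<phi>_def)
      have "k x t = rep_l2 f t * complex_of_real (\<psi> n x t * indicator {a..b} x)" for x
        by (simp add: k_def indicator_def)
      then show ?thesis
        by (simp only: integral_mult_right_zero integral_complex_of_real eq)
    qed
    ultimately show ?thesis by simp
  qed
  have dominated: "(\<lambda>n. LINT x|lebesgue. H n x * indicator {a..b} x)
      \<longlonglongrightarrow> (LINT x|lebesgue. H' x * indicator {a..b} x)"
    if "\<And>x. (\<lambda>n. H n x) \<longlonglongrightarrow> H' x" "\<And>n. H n \<in> borel_measurable lebesgue" "H' \<in> borel_measurable lebesgue"
      "\<And>n x. x \<in> {a..b} \<Longrightarrow> cmod (H n x) \<le> B" for H :: "nat \<Rightarrow> real \<Rightarrow> complex" and H' a b B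
  proof (rule integral_dominated_convergence[where w = "\<lambda>x. B * indicator {a..b} x"])
    note that(2,3)[measurable]
    show "integrable lebesgue (\<lambda>x. B * indicator {a..b} x :: real)"
      by (intro integrable_mult_right) auto
    show "AE x in lebesgue. (\<lambda>n. H n x * indicator {a..b} x) \<longlonglongrightarrow> H' x * indicator {a..b} x"
      by (intro AE_I2 tendsto_mult tendsto_const that(1))
    show "AE x in lebesgue. norm (H n x * indicator {a..b} x) \<le> B * indicator {a..b} x" for n
      using that(4) by (intro AE_I2) (auto simp: norm_mult indicator_def)
    show "(\<lambda>x. H' x * indicator {a..b} x) \<in> borel_measurable lebesgue"
      "(\<lambda>x. H n x * indicator {a..b} x) \<in> borel_measurable lebesgue" for n
      by measurable
  qed
  have int_D: "integrable lebesgue (\<lambda>x. D n x * indicator {a..b} x)" for n a b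
  proof (rule Bochner_Integration.integrable_bound)
    show "integrable lebesgue (\<lambda>x. \<gamma> (max \<bar>a\<bar> \<bar>b\<bar>) * indicator {a..b} x :: real)"
      by (intro integrable_mult_right) auto
    show "AE x in lebesgue. norm (D n x * indicator {a..b} x) \<le> norm (\<gamma> (max \<bar>a\<bar> \<bar>b\<bar>) * indicator {a..b} x :: real)"
    proof (rule AE_I2)
      fix x
      show "norm (D n x * indicator {a..b} x) \<le> norm (\<gamma> (max \<bar>a\<bar> \<bar>b\<bar>) * indicator {a..b} x :: real)"
        using D_bound[of x "max \<bar>a\<bar> \<bar>b\<bar>" n]
        by (cases "x \<in> {a..b}") (auto simp: norm_mult intro: order_trans[OF _ abs_ge_self])
    qed
  qed measurable
  have "convergent (\<lambda>n. F n 0)"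
  proof -
    have eq: "F n 0 = (LINT t|lebesgue. rep_l2 f t * complex_of_real (\<phi> n 0 1 t))
        - (LINT x|lebesgue. D n x * indicator {0..1} x)" for n
    proof -
      have "(LINT x|lebesgue. F n x * indicator {0..1} x)
          = (LINT x|lebesgue. F n 0 * complex_of_real (indicator {0..1} x) + D n x * indicator {0..1} x)"
        by (intro Bochner_Integration.integral_cong refl, subst F_eq)
          (simp add: indicator_def)
      also have "\<dots> = (LINT x::real|lebesgue. F n 0 * complex_of_real (indicator {0..1} x)) + (LINT x|lebesgue. D n x * indicator {0..1} x)"
        by (rule Bochner_Integration.integral_add[OF integrable_mult_right[OF integrable_of_real[OF integrable_indicator_Icc]] int_D])
      also have "(LINT x::real|lebesgue. F n 0 * complex_of_real (indicator {0..1} x)) = F n 0"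
        by (simp only: integral_mult_right_zero integral_complex_of_real) (simp add: measure_completion)
      finally show ?thesis
        using average[of 0 1 n] by simp
    qed
    have "(\<lambda>n. LINT x|lebesgue. D n x * indicator {0..1} x)
        \<longlonglongrightarrow> (LINT x|lebesgue. D' x * indicator {0..1} x)"
      using D_bound[of _ 1] by (intro dominated[of D D' 0 1 "\<gamma> 1"] D_lim) auto
    from tendsto_diff[OF test_lim[of f 0 1] this] show ?thesis
      unfolding eq by (rule convergentI)
  qed
  then obtain c where c: "(\<lambda>n. F n 0) \<longlonglongrightarrow> c"
    by (auto simp: convergent_def)
  define u where "u x = c + D' x" for x
  have [measurable]: "u \<in> borel_measurable lebesgue"
    unfolding u_def by measurable
  have F_lim: "(\<lambda>n. F n x) \<longlonglongrightarrow> u x" for x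
    unfolding u_def by (subst F_eq) (intro tendsto_add c D_lim)
  obtain B where B: "\<And>n. cmod (F n 0) \<le> B"
    using convergent_imp_Bseq[OF convergentI[OF c]] unfolding Bseq_def by blast
  have F_bound: "cmod (F n x) \<le> B + \<gamma> (max \<bar>a\<bar> \<bar>b\<bar>)" if "x \<in> {a..b}" for n x a b
    unfolding F_eq[of n x]
    by (rule norm_triangle_mono[OF B D_bound]) (use that in auto)
  have u_bound: "cmod (u x) \<le> B + \<gamma> (max \<bar>a\<bar> \<bar>b\<bar>)" if "x \<in> {a..b}" for x a b
    by (rule LIMSEQ_le_const2[OF tendsto_norm[OF F_lim]]) (use F_bound[OF that] in auto)
  have "AE x in lebesgue. rep_l2 f x = u x"
  proof (rule AE_eq_of_Icc_integrals)
    show "integrable lebesgue (\<lambda>t. u t * indicator {a..b} t)" for a b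
    proof (rule Bochner_Integration.integrable_bound)
      show "integrable lebesgue (\<lambda>x. (B + \<gamma> (max \<bar>a\<bar> \<bar>b\<bar>)) * indicator {a..b} x :: real)"
        by (intro integrable_mult_right) auto
      show "AE x in lebesgue. norm (u x * indicator {a..b} x)
          \<le> norm ((B + \<gamma> (max \<bar>a\<bar> \<bar>b\<bar>)) * indicator {a..b} x :: real)"
      proof (rule AE_I2)
        fix x
        show "norm (u x * indicator {a..b} x) \<le> norm ((B + \<gamma> (max \<bar>a\<bar> \<bar>b\<bar>)) * indicator {a..b} x :: real)"
          using u_bound[of x a b] by (cases "x \<in> {a..b}") (auto simp: norm_mult)
      qed
    qed measurable
    fix a b :: real assume "a \<le> b"
    have "(\<lambda>n. LINT x|lebesgue. F n x * indicator {a..b} x)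
        \<longlonglongrightarrow> (LINT x|lebesgue. u x * indicator {a..b} x)"
      by (rule dominated[OF F_lim]) (use F_bound in auto)
    moreover have "(\<lambda>n. LINT x|lebesgue. F n x * indicator {a..b} x)
        \<longlonglongrightarrow> (LINT t|lebesgue. rep_l2 f t * complex_of_real (ind a b t))"
      unfolding average[OF \<open>a \<le> b\<close>] by (rule test_lim)
    ultimately have "(LINT x|lebesgue. u x * indicator {a..b} x)
        = (LINT t|lebesgue. rep_l2 f t * complex_of_real (ind a b t))"
      by (rule LIMSEQ_unique)
    also have "\<dots> = (LINT t|lebesgue. rep_l2 f t * indicator {a..b} t)"
    proof (rule integral_cong_AE)
      have "AE t in lborel. t \<noteq> a"
        by (rule AE_lborel_singleton)
      then have "AE t in lebesgue. t \<noteq> a"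
        by (rule AE_completion)
      then show "AE t in lebesgue. rep_l2 f t * complex_of_real (ind a b t) = rep_l2 f t * indicator {a..b} t"
        by eventually_elim (use \<open>a \<le> b\<close> in \<open>auto simp: ind_def indicator_def\<close>)
    qed measurable
    finally show "(LINT t|lebesgue. rep_l2 f t * indicator {a..b} t) = (LINT t|lebesgue. u t * indicator {a..b} t)"
      by simp
  qed (rule integrable_rep_l2_on_Icc)
  moreover have "u y - u x = (LINT t|lebesgue. rep_l2 g t * indicator {x<..y} t)" if "x \<le> y" for x y
  proof -
    have "(\<lambda>n. F n y - F n x) \<longlonglongrightarrow> - (LINT t|lebesgue. rep_l2 g t * complex_of_real (ind y x t))"
      unfolding F_diff by (intro tendsto_minus test_lim)
    moreover have "(\<lambda>n. F n y - F n x) \<longlonglongrightarrow> u y - u x"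
      by (intro tendsto_diff F_lim)
    ultimately have "u y - u x = - (LINT t|lebesgue. rep_l2 g t * complex_of_real (ind y x t))"
      using LIMSEQ_unique by blast
    also have "\<dots> = (LINT t|lebesgue. - (rep_l2 g t * complex_of_real (ind y x t)))"
      by simp
    also have "\<dots> = (LINT t|lebesgue. rep_l2 g t * indicator {x<..y} t)"
      using that by (intro Bochner_Integration.integral_cong) (auto simp: ind_def indicator_def)
    finally show ?thesis .
  qed
  ultimately show ?thesis
    using that \<open>u \<in> borel_measurable lebesgue\<close> by blast
qed

section \<open>Pointwise and weighted bounds on the Sobolev space\<close>

lemma nn_integral_rep_l2_indicator_le:
  "(\<integral>\<^sup>+x. ennreal ((cmod (rep_l2 f x))\<^sup>2) * indicator A x \<partial>lebesgue) \<le> ennreal ((norm f)\<^sup>2)"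
  unfolding nn_integral_rep_l2_square[symmetric]
  by (intro nn_integral_mono) (auto simp: indicator_def)

text \<open>
  The integral is the inner product of an indicator with the restriction of \<open>g\<close> to \<open>{a..<b}\<close>.
\<close>

lemma cauchy_schwarz_interval:
  assumes "x \<le> y" "{x<..y} \<subseteq> {a..<b}"
  shows "ennreal ((cmod (LINT t|lebesgue. rep_l2 g t * indicator {x<..y} t))\<^sup>2)
    \<le> ennreal (y - x) * (\<integral>\<^sup>+t. ennreal ((cmod (rep_l2 g t))\<^sup>2) * indicator {a..<b} t \<partial>lebesgue)"
proof -
  have [measurable]: "indicat_real {x<..y} \<in> borel_measurable lebesgue" "indicat_real {a..<b} \<in> borel_measurable lebesgue"
    by (rule measurable_completion; simp)+
  define v where "v t = complex_of_real (indicator {x<..y} t)" for t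
  define k where "k t = rep_l2 g t * complex_of_real (indicator {a..<b} t)" for t
  have sq_v: "square_integrable v"
    unfolding v_def
    by (rule square_integrable_bounded_support[where C = 1 and A = x and B = y]; measurable?)
      (auto simp: indicator_def)
  have [measurable]: "k \<in> borel_measurable lebesgue"
    unfolding k_def by measurable
  have sq_k: "square_integrable k"
    unfolding square_integrable_def
  proof
    show "integrable lebesgue (\<lambda>t. (cmod (k t))\<^sup>2)"
      by (rule Bochner_Integration.integrable_bound[OF integrable_rep_l2_square[of g]])
        (auto simp: k_def indicator_def norm_mult)
  qed measurable
  have "(LINT t|lebesgue. rep_l2 g t * indicator {x<..y} t) = cinner (abs_l2 v) (abs_l2 k)"
    unfolding cinner_rep_l2
  proof (rule integral_cong_AE)
    show "AE t in lebesgue. rep_l2 g t * indicator {x<..y} t = cnj (rep_l2 (abs_l2 v) t) * rep_l2 (abs_l2 k) t"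
      using rep_abs_l2[OF sq_v] rep_abs_l2[OF sq_k]
      by eventually_elim (use assms(2) in \<open>auto simp: v_def k_def indicator_def\<close>)
  next
    have "(\<lambda>t. rep_l2 g t * complex_of_real (indicator {x<..y} t)) \<in> borel_measurable lebesgue"
      by measurable
    moreover have "complex_of_real (indicator {x<..y} t) = indicator {x<..y} t" for t
      by (simp add: indicator_def)
    ultimately show "(\<lambda>t. rep_l2 g t * indicator {x<..y} t) \<in> borel_measurable lebesgue"
      by simp
  qed (intro borel_measurable_times borel_measurable_cnj rep_l2_measurable)
  then have "(cmod (LINT t|lebesgue. rep_l2 g t * indicator {x<..y} t))\<^sup>2 \<le> (norm (abs_l2 v))\<^sup>2 * (norm (abs_l2 k))\<^sup>2"
    unfolding power_mult_distrib[symmetric] by (intro power_mono) (simp_all add: cinner_cauchy_schwarz)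
  then have "ennreal ((cmod (LINT t|lebesgue. rep_l2 g t * indicator {x<..y} t))\<^sup>2)
      \<le> ennreal ((norm (abs_l2 v))\<^sup>2) * ennreal ((norm (abs_l2 k))\<^sup>2)"
    by (simp only: ennreal_mult[symmetric] zero_le_power2 ennreal_leI)
  also have "ennreal ((norm (abs_l2 v))\<^sup>2) = ennreal (y - x)"
  proof -
    have "ennreal ((norm (abs_l2 v))\<^sup>2) = (\<integral>\<^sup>+t. indicator {x<..y} t \<partial>lebesgue)"
      unfolding nn_integral_rep_l2_square[symmetric]
      by (rule nn_integral_cong_AE, use rep_abs_l2[OF sq_v] in eventually_elim)
        (auto simp: v_def indicator_def)
    also have "\<dots> = emeasure lebesgue {x<..y}"
      by (rule nn_integral_indicator) simp
    finally show ?thesis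
      using assms(1) by (simp add: emeasure_lborel_Ioc)
  qed
  also have "ennreal ((norm (abs_l2 k))\<^sup>2) = (\<integral>\<^sup>+t. ennreal ((cmod (rep_l2 g t))\<^sup>2) * indicator {a..<b} t \<partial>lebesgue)"
    unfolding nn_integral_rep_l2_square[symmetric]
    by (rule nn_integral_cong_AE, use rep_abs_l2[OF sq_k] in eventually_elim)
      (auto simp: k_def indicator_def)
  finally show ?thesis .
qed

text \<open>
  On a unit interval the value at one point is controlled by the value at any other point and the
  integral of the derivative; averaging over the other point gives the local Sobolev inequality.
\<close>

lemma local_sobolev_inequality:
  assumes u: "AE x in lebesgue. rep_l2 f x = u x"
    and inc: "\<And>x y. x \<le> y \<Longrightarrow> u y - u x = (LINT t|lebesgue. rep_l2 g t * indicator {x<..y} t)"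
    and x: "x \<in> {a..<a + 1}"
  shows "ennreal ((cmod (u x))\<^sup>2) \<le> (\<integral>\<^sup>+t. (2 * ennreal ((cmod (rep_l2 f t))\<^sup>2)
    + 2 * ennreal ((cmod (rep_l2 g t))\<^sup>2)) * indicator {a..<a + 1} t \<partial>lebesgue)"
proof -
  define I where "I = {a..<a + 1}"
  have [measurable]: "I \<in> sets lebesgue"
    by (simp add: I_def)
  define \<Gamma> where "\<Gamma> = (\<integral>\<^sup>+t. ennreal ((cmod (rep_l2 g t))\<^sup>2) * indicator I t \<partial>lebesgue)"
  have point: "ennreal ((cmod (u x))\<^sup>2) \<le> 2 * ennreal ((cmod (u y))\<^sup>2) + 2 * \<Gamma>" if "y \<in> I" for y
  proof -
    have "ennreal ((cmod (u x - u y))\<^sup>2) \<le> ennreal \<bar>x - y\<bar> * \<Gamma>"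
    proof (cases "x \<le> y")
      case True
      then have "{x<..y} \<subseteq> {a..<a + 1}"
        using x that by (auto simp: I_def)
      from cauchy_schwarz_interval[OF True this, of g] show ?thesis
        using True by (simp add: inc[OF True, symmetric] \<Gamma>_def I_def norm_minus_commute)
    next
      case False
      then have le: "y \<le> x" by simp
      have "{y<..x} \<subseteq> {a..<a + 1}"
        using x that by (auto simp: I_def)
      from cauchy_schwarz_interval[OF le this, of g] show ?thesis
        using le by (simp add: inc[OF le, symmetric] \<Gamma>_def I_def)
    qed
    also have "\<dots> \<le> 1 * \<Gamma>"
      using x that by (intro mult_right_mono) (auto simp: I_def abs_le_iff)
    finally have diff: "ennreal ((cmod (u x - u y))\<^sup>2) \<le> \<Gamma>" by simp
    have "(cmod (u x))\<^sup>2 \<le> (cmod (u y) + cmod (u x - u y))\<^sup>2"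
      using norm_triangle_ineq[of "u y" "u x - u y"] by (intro power_mono) auto
    also have "\<dots> \<le> 2 * (cmod (u y))\<^sup>2 + 2 * (cmod (u x - u y))\<^sup>2"
      using sum_squares_bound[of "cmod (u y)" "cmod (u x - u y)"] by (simp add: power2_sum)
    finally have "ennreal ((cmod (u x))\<^sup>2) \<le> ennreal (2 * (cmod (u y))\<^sup>2 + 2 * (cmod (u x - u y))\<^sup>2)"
      by (rule ennreal_leI)
    also have "\<dots> = 2 * ennreal ((cmod (u y))\<^sup>2) + 2 * ennreal ((cmod (u x - u y))\<^sup>2)"
      by (simp add: ennreal_plus ennreal_mult)
    also have "\<dots> \<le> 2 * ennreal ((cmod (u y))\<^sup>2) + 2 * \<Gamma>"
      by (intro add_left_mono mult_left_mono diff) auto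
    finally show ?thesis .
  qed
  have one: "(\<integral>\<^sup>+y. indicator I y \<partial>lebesgue) = 1"
    unfolding I_def by (subst nn_integral_indicator) (auto simp: emeasure_lborel_Ico)
  have "ennreal ((cmod (u x))\<^sup>2) = (\<integral>\<^sup>+y. ennreal ((cmod (u x))\<^sup>2) * indicator I y \<partial>lebesgue)"
    by (simp add: nn_integral_cmult one)
  also have "\<dots> \<le> (\<integral>\<^sup>+y. (2 * ennreal ((cmod (rep_l2 f y))\<^sup>2)) * indicator I y + 2 * \<Gamma> * indicator I y \<partial>lebesgue)"
  proof (rule nn_integral_mono_AE, use u in eventually_elim)
    case (elim y)
    then show ?case
      using point[of y] by (auto simp: indicator_def)
  qed
  also have "\<dots> = (\<integral>\<^sup>+y. (2 * ennreal ((cmod (rep_l2 f y))\<^sup>2)) * indicator I y \<partial>lebesgue) + 2 * \<Gamma>"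
    by (subst nn_integral_add) (auto simp: nn_integral_cmult one)
  also have "2 * \<Gamma> = (\<integral>\<^sup>+y. (2 * ennreal ((cmod (rep_l2 g y))\<^sup>2)) * indicator I y \<partial>lebesgue)"
    unfolding \<Gamma>_def by (subst nn_integral_cmult[symmetric]) (auto simp: mult.assoc)
  also have "(\<integral>\<^sup>+y. (2 * ennreal ((cmod (rep_l2 f y))\<^sup>2)) * indicator I y \<partial>lebesgue)
      + (\<integral>\<^sup>+y. (2 * ennreal ((cmod (rep_l2 g y))\<^sup>2)) * indicator I y \<partial>lebesgue)
      = (\<integral>\<^sup>+t. (2 * ennreal ((cmod (rep_l2 f t))\<^sup>2) + 2 * ennreal ((cmod (rep_l2 g t))\<^sup>2)) * indicator I t \<partial>lebesgue)"
    by (subst nn_integral_add[symmetric]) (auto simp: distrib_right)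
  finally show ?thesis
    by (simp add: I_def)
qed

definition unit_cell :: "int \<Rightarrow> real set" where
  "unit_cell n = {real_of_int n..<real_of_int n + 1}"

abbreviation cell_mass :: "(real \<Rightarrow> real) \<Rightarrow> int \<Rightarrow> ennreal" where
  "cell_mass V n \<equiv> \<integral>\<^sup>+x. ennreal \<bar>V x\<bar> * indicator (unit_cell n) x \<partial>lebesgue"

lemma unit_cell_sets [measurable]: "unit_cell n \<in> sets lebesgue"
  by (simp add: unit_cell_def)

lemma in_unit_cell: "x \<in> unit_cell n \<longleftrightarrow> \<lfloor>x\<rfloor> = n"
  by (auto simp: unit_cell_def floor_eq_iff)

lemma nn_integral_unit_cells:
  assumes [measurable]: "f \<in> borel_measurable lebesgue"
  shows "(\<integral>\<^sup>+x. f x \<partial>lebesgue) = (\<Sum>k. \<integral>\<^sup>+x. f x * indicator (unit_cell (int_decode k)) x \<partial>lebesgue)"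
proof -
  have "disjoint_family (\<lambda>k. unit_cell (int_decode k))"
    by (auto simp: disjoint_family_on_def in_unit_cell)
      (metis int_decode_inverse)
  moreover have "(\<Union>k. unit_cell (int_decode k)) = UNIV"
    by (auto simp: in_unit_cell) (metis int_encode_inverse)
  ultimately show ?thesis
    using nn_integral_disjoint_family[of f lebesgue "\<lambda>k. unit_cell (int_decode k)"] by simp
qed

text \<open>
  On each cell \<open>|f|\<^sup>2\<close> is replaced by the local Sobolev bound, a constant there, so that \<open>w\<close> contributes
  its mass on the cell, which is at most \<open>M\<close>; the local bounds add up to the global norms.
\<close>

lemma H1_weighted_bound:
  fixes w :: "real \<Rightarrow> ennreal"
  assumes fg: "weak_derivative f g" and [measurable]: "w \<in> borel_measurable lebesgue"
    and w: "\<And>n. (\<integral>\<^sup>+x. w x * indicator (unit_cell n) x \<partial>lebesgue) \<le> M"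
  shows "(\<integral>\<^sup>+x. w x * ennreal ((cmod (rep_l2 f x))\<^sup>2) \<partial>lebesgue) \<le> M * ennreal (2 * (norm f)\<^sup>2 + 2 * (norm g)\<^sup>2)"
proof -
  obtain u where u: "AE x in lebesgue. rep_l2 f x = u x" "u \<in> borel_measurable lebesgue"
    "\<And>x y. x \<le> y \<Longrightarrow> u y - u x = (LINT t|lebesgue. rep_l2 g t * indicator {x<..y} t)"
    using weak_derivative_representative[OF fg] by blast
  define H where "H t = 2 * ennreal ((cmod (rep_l2 f t))\<^sup>2) + 2 * ennreal ((cmod (rep_l2 g t))\<^sup>2)" for t
  have [measurable]: "H \<in> borel_measurable lebesgue"
    unfolding H_def by measurable
  have cell: "(\<integral>\<^sup>+x. w x * ennreal ((cmod (rep_l2 f x))\<^sup>2) * indicator (unit_cell n) x \<partial>lebesgue)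
      \<le> M * (\<integral>\<^sup>+x. H x * indicator (unit_cell n) x \<partial>lebesgue)" for n
  proof -
    define h where "h = (\<integral>\<^sup>+x. H x * indicator (unit_cell n) x \<partial>lebesgue)"
    have "(\<integral>\<^sup>+x. w x * ennreal ((cmod (rep_l2 f x))\<^sup>2) * indicator (unit_cell n) x \<partial>lebesgue)
        \<le> (\<integral>\<^sup>+x. h * (w x * indicator (unit_cell n) x) \<partial>lebesgue)"
    proof (rule nn_integral_mono_AE, use u(1) in eventually_elim)
      case (elim x)
      show ?case
      proof (cases "x \<in> unit_cell n")
        case True
        then have "ennreal ((cmod (u x))\<^sup>2) \<le> h"
          using local_sobolev_inequality[OF u(1,3), of x "real_of_int n"]
          by (simp add: unit_cell_def h_def H_def)
        then show ?thesis
          using True elim mult_left_mono[of "ennreal ((cmod (u x))\<^sup>2)" h "w x"] by (simp add: mult.commute)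
      qed simp
    qed
    also have "\<dots> = h * (\<integral>\<^sup>+x. w x * indicator (unit_cell n) x \<partial>lebesgue)"
      by (rule nn_integral_cmult) measurable
    also have "\<dots> \<le> h * M"
      by (intro mult_left_mono w) auto
    finally show ?thesis
      by (simp add: h_def mult.commute)
  qed
  have "(\<integral>\<^sup>+x. w x * ennreal ((cmod (rep_l2 f x))\<^sup>2) \<partial>lebesgue)
      \<le> (\<Sum>k. M * (\<integral>\<^sup>+x. H x * indicator (unit_cell (int_decode k)) x \<partial>lebesgue))"
    by (subst nn_integral_unit_cells, measurable) (intro suminf_le cell summableI)
  also have "\<dots> = M * (\<integral>\<^sup>+x. H x \<partial>lebesgue)"
    by (subst nn_integral_unit_cells[of H]) (simp_all add: ennreal_suminf_cmult)
  also have "(\<integral>\<^sup>+x. H x \<partial>lebesgue) = ennreal (2 * (norm f)\<^sup>2 + 2 * (norm g)\<^sup>2)"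
    unfolding H_def
    by (subst nn_integral_add)
      (auto simp: nn_integral_cmult nn_integral_rep_l2_square ennreal_plus ennreal_mult)
  finally show ?thesis .
qed

lemma continuous_AE_eq_imp_eq:
  fixes u v :: "real \<Rightarrow> complex"
  assumes "continuous_on UNIV u" "continuous_on UNIV v" "AE x in lebesgue. u x = v x"
  shows "u = v"
proof -
  have "open {x. u x \<noteq> v x}"
    using open_Collect_neq[OF assms(1,2)] .
  moreover have "negligible {x. u x \<noteq> v x}"
    using assms(3) unfolding negligible_iff_null_sets by (simp add: AE_iff_null_sets eventually_ae_filter)
      (metis (mono_tags, lifting) assms(3) AE_E2 completion.complete2)
  ultimately have "{x. u x \<noteq> v x} = {}"
    using open_not_negligible by blast
  then show ?thesis by auto
qed

text \<open>
  The supremum bound comes from the unit interval to the right of \<open>x\<close>, the Hoelder bound from the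
  Cauchy--Schwarz inequality between \<open>x\<close> and \<open>y\<close>.
\<close>

lemma H1_continuous_representative:
  assumes fg: "weak_derivative f g"
  obtains u where "AE x in lebesgue. rep_l2 f x = u x" "continuous_on UNIV u"
    "\<And>x. (cmod (u x))\<^sup>2 \<le> 2 * (norm f)\<^sup>2 + 2 * (norm g)\<^sup>2"
    "\<And>x y. (cmod (u x - u y))\<^sup>2 \<le> \<bar>x - y\<bar> * (norm g)\<^sup>2"
proof -
  obtain u where u: "AE x in lebesgue. rep_l2 f x = u x" "u \<in> borel_measurable lebesgue"
    "\<And>x y. x \<le> y \<Longrightarrow> u y - u x = (LINT t|lebesgue. rep_l2 g t * indicator {x<..y} t)"
    using weak_derivative_representative[OF fg] by blast
  have bound: "(cmod (u x))\<^sup>2 \<le> 2 * (norm f)\<^sup>2 + 2 * (norm g)\<^sup>2" for x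
  proof -
    have "ennreal ((cmod (u x))\<^sup>2) \<le> (\<integral>\<^sup>+t. (2 * ennreal ((cmod (rep_l2 f t))\<^sup>2)
        + 2 * ennreal ((cmod (rep_l2 g t))\<^sup>2)) * indicator {x..<x + 1} t \<partial>lebesgue)"
      by (rule local_sobolev_inequality[OF u(1,3)]) auto
    also have "\<dots> \<le> (\<integral>\<^sup>+t. 2 * ennreal ((cmod (rep_l2 f t))\<^sup>2) + 2 * ennreal ((cmod (rep_l2 g t))\<^sup>2) \<partial>lebesgue)"
      by (intro nn_integral_mono) (auto simp: indicator_def)
    also have "\<dots> = ennreal (2 * (norm f)\<^sup>2 + 2 * (norm g)\<^sup>2)"
      by (subst nn_integral_add)
        (auto simp: nn_integral_cmult nn_integral_rep_l2_square ennreal_plus ennreal_mult)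
    finally show ?thesis
      by (subst (asm) ennreal_le_iff) auto
  qed
  have inc: "(cmod (u y - u x))\<^sup>2 \<le> (y - x) * (norm g)\<^sup>2" if "x \<le> y" for x y
  proof -
    have "ennreal ((cmod (u y - u x))\<^sup>2)
        \<le> ennreal (y - x) * (\<integral>\<^sup>+t. ennreal ((cmod (rep_l2 g t))\<^sup>2) * indicator {x..<y + 1} t \<partial>lebesgue)"
      unfolding u(3)[OF that] by (rule cauchy_schwarz_interval[OF that]) auto
    also have "\<dots> \<le> ennreal (y - x) * ennreal ((norm g)\<^sup>2)"
      by (intro mult_left_mono nn_integral_rep_l2_indicator_le) auto
    also have "\<dots> = ennreal ((y - x) * (norm g)\<^sup>2)"
      using that by (simp add: ennreal_mult)
    finally show ?thesis
      using that by (subst (asm) ennreal_le_iff) auto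
  qed
  have inc': "(cmod (u x - u y))\<^sup>2 \<le> \<bar>x - y\<bar> * (norm g)\<^sup>2" for x y
    using inc[of x y] inc[of y x] by (cases "x \<le> y") (auto simp: norm_minus_commute)
  have "isCont u x" for x
  proof -
    have "((\<lambda>y. sqrt (\<bar>y - x\<bar> * (norm g)\<^sup>2)) \<longlongrightarrow> sqrt (\<bar>x - x\<bar> * (norm g)\<^sup>2)) (at x)"
      by (intro tendsto_intros)
    then have "((\<lambda>y. sqrt (\<bar>y - x\<bar> * (norm g)\<^sup>2)) \<longlongrightarrow> 0) (at x)"
      by simp
    then have "((\<lambda>y. u y - u x) \<longlongrightarrow> 0) (at x)"
      by (rule Lim_null_comparison[rotated])
        (intro always_eventually allI real_le_rsqrt inc')
    then show ?thesis
      by (simp add: isCont_def LIM_zero_iff)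
  qed
  then have "continuous_on UNIV u"
    by (simp add: continuous_at_imp_continuous_on)
  then show ?thesis
    using u(1) bound inc' that by blast
qed

section \<open>Orthonormal families\<close>

definition orthonormal_family :: "'i set \<Rightarrow> ('i \<Rightarrow> l2) \<Rightarrow> bool" where
  "orthonormal_family I e \<longleftrightarrow> (\<forall>i\<in>I. \<forall>j\<in>I. cinner (e i) (e j) = (if i = j then 1 else 0))"

lemma orthonormal_expansion:
  assumes "finite I" "orthonormal_family I e"
  shows "(norm (f - (\<Sum>i\<in>I. c i *\<^sub>C e i)))\<^sup>2
    = (norm f)\<^sup>2 - (\<Sum>i\<in>I. (cmod (cinner (e i) f))\<^sup>2) + (\<Sum>i\<in>I. (cmod (c i - cinner (e i) f))\<^sup>2)"
proof -
  define s where "s = (\<Sum>i\<in>I. c i *\<^sub>C e i)"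
  have fs: "cinner f s = (\<Sum>i\<in>I. c i * cnj (cinner (e i) f))"
    unfolding s_def cinner_sum_right cinner_scaleC_right
    by (intro sum.cong refl arg_cong2[of _ _ _ _ "(*)"] cinner_commute)
  have sf: "cinner s f = (\<Sum>i\<in>I. cnj (c i) * cinner (e i) f)"
    unfolding s_def by (simp add: cinner_sum_left cinner_scaleC_left)
  have ss: "cinner s s = (\<Sum>i\<in>I. cnj (c i) * c i)"
  proof -
    have "cinner s s = (\<Sum>i\<in>I. cnj (c i) * (\<Sum>j\<in>I. c j * cinner (e i) (e j)))"
      by (simp only: s_def cinner_sum_left cinner_scaleC_left)
        (simp only: cinner_sum_right cinner_scaleC_right)
    also have "\<dots> = (\<Sum>i\<in>I. cnj (c i) * (\<Sum>j\<in>I. if i = j then c j else 0))"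
      using assms(2) by (intro sum.cong refl arg_cong2[of _ _ _ _ "(*)"]) (auto simp: orthonormal_family_def)
    finally show ?thesis
      using assms(1) by simp
  qed
  have sq: "complex_of_real ((cmod z)\<^sup>2) = z * cnj z" for z
    by (rule complex_norm_square)
  have "complex_of_real ((norm (f - s))\<^sup>2) = cinner f f - cinner f s - cinner s f + cinner s s"
    unfolding cinner_self[symmetric] by (simp add: cinner_diff_left cinner_diff_right)
  also have "\<dots> = complex_of_real ((norm f)\<^sup>2 - (\<Sum>i\<in>I. (cmod (cinner (e i) f))\<^sup>2)
      + (\<Sum>i\<in>I. (cmod (c i - cinner (e i) f))\<^sup>2))"
    unfolding fs sf ss unfolding of_real_add of_real_diff of_real_sum sq cinner_self
    by (simp add: sum_subtractf[symmetric] sum.distrib[symmetric] algebra_simps)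
  finally show ?thesis
    unfolding s_def of_real_eq_iff .
qed

lemma norm_orthonormal_sum:
  assumes "finite I" "orthonormal_family I e"
  shows "(norm (\<Sum>i\<in>I. c i *\<^sub>C e i))\<^sup>2 = (\<Sum>i\<in>I. (cmod (c i))\<^sup>2)"
  using orthonormal_expansion[OF assms, of 0 c] by simp

lemma bessel_inequality:
  assumes "finite I" "orthonormal_family I e"
  shows "(\<Sum>i\<in>I. (cmod (cinner (e i) f))\<^sup>2) \<le> (norm f)\<^sup>2"
  using orthonormal_expansion[OF assms, of f "\<lambda>i. cinner (e i) f"]
    zero_le_power2[of "norm (f - (\<Sum>i\<in>I. cinner (e i) f *\<^sub>C e i))"] by simp

lemma orthonormal_basis_family:
  assumes "orthonormal_basis E" "D \<subseteq> E"
  shows "orthonormal_family D (\<lambda>e. e)"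
proof -
  have "\<forall>e\<in>E. \<forall>e'\<in>E. cinner e e' = (if e = e' then 1 else 0)"
    using assms(1) unfolding orthonormal_basis_def by (rule conjunct1)
  then show ?thesis
    unfolding orthonormal_family_def using assms(2) by (meson subsetD)
qed

text \<open>
  Finite linear combinations of \<open>E\<close> are dense, as only zero is orthogonal to \<open>E\<close>; among the
  combinations over a given \<open>D\<close>, the Fourier coefficients give the smallest error.
\<close>

lemma parseval_approximation:
  assumes E: "orthonormal_basis E" and "\<delta> > 0"
  obtains D where "finite D" "D \<subseteq> E" "(norm f)\<^sup>2 \<le> (\<Sum>e\<in>D. (cmod (cinner e f))\<^sup>2) + \<delta>"
proof -
  define M where "M = {s. \<exists>D c. finite D \<and> D \<subseteq> E \<and> s = (\<Sum>e\<in>D. c e *\<^sub>C e)}"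
  have "complex_subspace M"
    unfolding complex_subspace_def
  proof (intro conjI ballI allI)
    show "0 \<in> M"
      by (auto simp: M_def intro!: exI[of _ "{}"])
    fix s assume "s \<in> M"
    then obtain D c where D: "finite D" "D \<subseteq> E" "s = (\<Sum>e\<in>D. c e *\<^sub>C e)"
      by (auto simp: M_def)
    show "a *\<^sub>C s \<in> M" for a
    proof -
      have "a *\<^sub>C s = (\<Sum>e\<in>D. (a * c e) *\<^sub>C e)"
        using linear_sum[OF bounded_linear.linear[OF bounded_linear_scaleC[of a]], of "\<lambda>e. c e *\<^sub>C e" D]
        by (simp add: D(3) scaleC_scaleC)
      then show ?thesis
        using D by (auto simp: M_def)
    qed
    fix t assume "t \<in> M"
    then obtain D' c' where D': "finite D'" "D' \<subseteq> E" "t = (\<Sum>e\<in>D'. c' e *\<^sub>C e)"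
      by (auto simp: M_def)
    have ext: "(\<Sum>e\<in>D. c e *\<^sub>C e) = (\<Sum>e\<in>D \<union> D'. (if e \<in> D then c e else 0) *\<^sub>C e)"
      "(\<Sum>e\<in>D'. c' e *\<^sub>C e) = (\<Sum>e\<in>D \<union> D'. (if e \<in> D' then c' e else 0) *\<^sub>C e)"
      using D D' by (auto intro!: sum.mono_neutral_cong_left)
    have "s + t = (\<Sum>e\<in>D \<union> D'. ((if e \<in> D then c e else 0) + (if e \<in> D' then c' e else 0)) *\<^sub>C e)"
      unfolding D(3) D'(3) ext sum.distrib[symmetric] by (simp add: scaleC_add_left)
    then show "s + t \<in> M"
      using D D' unfolding M_def by (intro CollectI exI conjI) auto
  qed
  have "closure M = UNIV"
  proof (rule closed_complex_subspace_eq_UNIV)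
    show "complex_subspace (closure M)"
      by (rule complex_subspace_closure) fact
    fix h assume h: "\<And>m. m \<in> closure M \<Longrightarrow> cinner h m = 0"
    have "cinner e h = 0" if "e \<in> E" for e
    proof -
      have "e \<in> M"
        using that by (auto simp: M_def intro!: exI[of _ "{e}"] exI[of _ "\<lambda>_. 1"])
      then have "cinner h e = 0"
        by (intro h subsetD[OF closure_subset])
      then show ?thesis
        using cinner_commute[of e h] by simp
    qed
    then show "h = 0"
      using E by (simp add: orthonormal_basis_def)
  qed simp
  then have "f \<in> closure M" by simp
  then obtain s where s: "s \<in> M" "norm (s - f) < sqrt \<delta>"
    using \<open>\<delta> > 0\<close> unfolding closure_approachable dist_norm by (metis real_sqrt_gt_zero)
  then obtain D c where D: "finite D" "D \<subseteq> E" "s = (\<Sum>e\<in>D. c e *\<^sub>C e)"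
    by (auto simp: M_def)
  have "(norm f)\<^sup>2 - (\<Sum>e\<in>D. (cmod (cinner e f))\<^sup>2) \<le> (norm (f - s))\<^sup>2"
    using orthonormal_expansion[OF D(1) orthonormal_basis_family[OF E D(2)], of f c] D(3)
    by (simp add: sum_nonneg)
  also have "\<dots> \<le> (sqrt \<delta>)\<^sup>2"
    using s(2) by (intro power_mono) (auto simp: norm_minus_commute)
  finally show ?thesis
    using that[OF D(1,2)] \<open>\<delta> > 0\<close> by simp
qed

text \<open>
  A maximal orthonormal set: a nonzero vector orthogonal to it could be normalised and added.
\<close>

lemma orthonormal_basis_exists: "\<exists>E. orthonormal_basis E"
proof -
  define \<A> where "\<A> = {E. orthonormal_family E (\<lambda>e::l2. e)}"
  have chain: "\<Union>C \<in> \<A>" if C: "subset.chain \<A> C" for C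
    unfolding \<A>_def mem_Collect_eq orthonormal_family_def
  proof (intro ballI)
    fix e e' assume "e \<in> \<Union>C" "e' \<in> \<Union>C"
    then obtain X Y where XY: "X \<in> C" "Y \<in> C" "e \<in> X" "e' \<in> Y"
      by blast
    then have "X \<subseteq> Y \<or> Y \<subseteq> X" "X \<in> \<A>" "Y \<in> \<A>"
      using C by (auto simp: subset_chain_def)
    with XY show "cinner e e' = (if e = e' then 1 else 0)"
      unfolding \<A>_def orthonormal_family_def by blast
  qed
  have "\<exists>E\<in>\<A>. \<forall>X\<in>\<A>. E \<subseteq> X \<longrightarrow> X = E"
    by (rule subset_Zorn') (rule chain)
  then obtain E where E: "E \<in> \<A>" and max: "\<forall>X\<in>\<A>. E \<subseteq> X \<longrightarrow> X = E"
    by (rule bexE) (rule that)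
  have "f = 0" if f: "\<forall>e\<in>E. cinner e f = 0" for f
  proof (rule ccontr)
    assume "f \<noteq> 0"
    define g where "g = complex_of_real (1 / norm f) *\<^sub>C f"
    have gg: "cinner g g = 1"
      using \<open>f \<noteq> 0\<close> by (simp add: g_def cinner_self norm_scaleC norm_divide)
    have eg: "cinner e g = 0" "cinner g e = 0" if "e \<in> E" for e
      using f that cinner_commute[of f e] by (simp_all add: g_def cinner_scaleC_left cinner_scaleC_right)
    have "insert g E \<in> \<A>"
      using E gg eg by (auto simp: \<A>_def orthonormal_family_def)
    then have "g \<in> E"
      using max by blast
    then show False
      using eg gg by fastforce
  qed
  note complete = this
  have "\<forall>e\<in>E. \<forall>e'\<in>E. cinner e e' = (if e = e' then 1 else 0)"
    using E unfolding \<A>_def orthonormal_family_def by (rule CollectD)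
  note orthonormal = this
  show ?thesis
    unfolding orthonormal_basis_def
  proof (intro exI[of _ E] conjI allI impI)
    show "\<forall>e\<in>E. \<forall>e'\<in>E. cinner e e' = (if e = e' then 1 else 0)"
      by (rule orthonormal)
  qed (rule complete)
qed


section \<open>Multiplication operators\<close>

lemma L1_loc_measurable:
  assumes "V \<in> L1_loc"
  shows "V \<in> borel_measurable lebesgue"
proof (rule borel_measurable_LIMSEQ_metric)
  show "(\<lambda>x. indicator {- real n..real n} x *\<^sub>R V x) \<in> borel_measurable lebesgue" for n
    using assms by (intro borel_measurable_integrable) (auto simp: L1_loc_def set_integrable_def)
  show "(\<lambda>n. indicator {- real n..real n} x *\<^sub>R V x) \<longlonglongrightarrow> V x" for x
  proof (rule tendsto_eventually)
    obtain N where N: "\<bar>x\<bar> \<le> real N"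
      using real_arch_simple by blast
    show "\<forall>\<^sub>F n in sequentially. indicator {- real n..real n} x *\<^sub>R V x = V x"
      using eventually_ge_at_top[of N]
      by eventually_elim (use N in \<open>auto simp: indicator_def\<close>)
  qed
qed

lemma L1_loc_nn_integral:
  assumes "V \<in> L1_loc"
  shows "(\<integral>\<^sup>+x. ennreal \<bar>V x\<bar> * indicator {a..b} x \<partial>lebesgue) = ennreal (LINT x:{a..b}|lebesgue. \<bar>V x\<bar>)"
proof -
  have int: "integrable lebesgue (\<lambda>x. indicator {a..b} x *\<^sub>R \<bar>V x\<bar>)"
    using assms set_integrable_abs unfolding L1_loc_def set_integrable_def by blast
  have "(\<integral>\<^sup>+x. ennreal \<bar>V x\<bar> * indicator {a..b} x \<partial>lebesgue)
      = (\<integral>\<^sup>+x. ennreal (indicator {a..b} x *\<^sub>R \<bar>V x\<bar>) \<partial>lebesgue)"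
    by (intro nn_integral_cong) (auto simp: indicator_def)
  also have "\<dots> = ennreal (LINT x|lebesgue. indicator {a..b} x *\<^sub>R \<bar>V x\<bar>)"
    by (rule nn_integral_eq_integral[OF int]) (auto simp: indicator_def)
  finally show ?thesis
    by (simp add: set_lebesgue_integral_def)
qed

lemma L1_loc_diff_const:
  assumes "r \<in> L1_loc"
  shows "(\<lambda>x. r x - c) \<in> L1_loc"
proof -
  have "set_integrable lebesgue {a..b} (\<lambda>x. r x - c)" for a b
  proof (rule set_integral_diff(1))
    show "set_integrable lebesgue {a..b} r"
      using assms by (simp add: L1_loc_def)
    show "set_integrable lebesgue {a..b} (\<lambda>x. c)"
      unfolding set_integrable_def by (simp add: integrable_mult_left)
  qed
  then show ?thesis
    by (simp add: L1_loc_def)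
qed

lemma square_integrable_real_mult:
  assumes [measurable]: "W \<in> borel_measurable lebesgue" "k \<in> borel_measurable lebesgue"
    and fin: "(\<integral>\<^sup>+x. ennreal ((W x)\<^sup>2) * ennreal ((cmod (k x))\<^sup>2) \<partial>lebesgue) < \<infinity>"
  shows "square_integrable (\<lambda>x. complex_of_real (W x) * k x)"
  unfolding square_integrable_def
proof
  show "integrable lebesgue (\<lambda>x. (cmod (complex_of_real (W x) * k x))\<^sup>2)"
    using fin by (intro integrableI_bounded)
      (auto simp: norm_mult power_mult_distrib ennreal_mult)
qed measurable

lemma norm_real_mult:
  assumes "AE x in lebesgue. rep_l2 g x = complex_of_real (W x) * k x"
  shows "ennreal ((norm g)\<^sup>2) = (\<integral>\<^sup>+x. ennreal ((W x)\<^sup>2) * ennreal ((cmod (k x))\<^sup>2) \<partial>lebesgue)"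
  unfolding nn_integral_rep_l2_square[symmetric]
  by (rule nn_integral_cong_AE, use assms in eventually_elim)
    (simp add: norm_mult power_mult_distrib ennreal_mult)

lemma sgn_mult_op:
  fixes V :: "real \<Rightarrow> real"
  assumes [measurable]: "V \<in> borel_measurable lebesgue"
  obtains U where "bounded_clinear U" "symmetric_map U" "\<And>f. norm (U f) \<le> norm f"
    "mult_op (\<lambda>x. sgn (V x)) = fun_graph U"
proof -
  have sgn_sq: "(sgn y)\<^sup>2 \<le> 1" for y :: real
    by (simp add: sgn_real_def)
  have [measurable]: "(\<lambda>x. sgn (V x)) \<in> borel_measurable lebesgue"
    unfolding sgn_real_def by measurable
  have le: "(\<integral>\<^sup>+x. ennreal ((sgn (V x))\<^sup>2) * ennreal ((cmod (rep_l2 f x))\<^sup>2) \<partial>lebesgue) \<le> ennreal ((norm f)\<^sup>2)" for f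
    unfolding nn_integral_rep_l2_square[symmetric]
    using sgn_sq by (intro nn_integral_mono) (metis ennreal_1 ennreal_leI mult_1 mult_right_mono zero_le)
  define U where "U f = abs_l2 (\<lambda>x. complex_of_real (sgn (V x)) * rep_l2 f x)" for f
  have U: "AE x in lebesgue. rep_l2 (U f) x = complex_of_real (sgn (V x)) * rep_l2 f x" for f
    unfolding U_def
    by (intro rep_abs_l2 square_integrable_real_mult le_less_trans[OF le]) (auto simp: ennreal_less_top)
  have norm: "norm (U f) \<le> norm f" for f
  proof (rule power2_le_imp_le)
    have "ennreal ((norm (U f))\<^sup>2) \<le> ennreal ((norm f)\<^sup>2)"
      unfolding norm_real_mult[OF U] by (rule le)
    then show "(norm (U f))\<^sup>2 \<le> (norm f)\<^sup>2"
      by (subst (asm) ennreal_le_iff) auto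
  qed simp
  have "U (f + g) = U f + U g" for f g
    by (rule l2_eqI, use U[of "f + g"] U[of f] U[of g] rep_l2_add[of f g] rep_l2_add[of "U f" "U g"]
        in eventually_elim) (simp add: distrib_left)
  moreover have "U (c *\<^sub>C f) = c *\<^sub>C U f" for c f
    by (rule l2_eqI, use U[of "c *\<^sub>C f"] U[of f] rep_l2_scaleC[of c f] rep_l2_scaleC[of c "U f"]
        in eventually_elim) simp
  ultimately have "bounded_clinear U"
    unfolding bounded_clinear_def using norm by (auto intro!: exI[of _ 1])
  moreover have "symmetric_map U"
  proof (rule symmetric_mapI)
    show "cinner (U f) g = cinner f (U g)" for f g
      unfolding cinner_rep_l2
    proof (rule integral_cong_AE)
      show "AE x in lebesgue. cnj (rep_l2 (U f) x) * rep_l2 g x = cnj (rep_l2 f x) * rep_l2 (U g) x"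
        using U[of f] U[of g] by eventually_elim simp
    qed (intro borel_measurable_times borel_measurable_cnj rep_l2_measurable)+
  qed
  moreover have "mult_op (\<lambda>x. sgn (V x)) = fun_graph U"
  proof (intro set_eqI iffI)
    fix z assume "z \<in> mult_op (\<lambda>x. sgn (V x))"
    then have "AE x in lebesgue. rep_l2 (snd z) x = complex_of_real (sgn (V x)) * rep_l2 (fst z) x"
      by (auto simp: mult_op_def)
    then have "AE x in lebesgue. rep_l2 (snd z) x = rep_l2 (U (fst z)) x"
      using U[of "fst z"] by eventually_elim simp
    then have "snd z = U (fst z)"
      by (rule l2_eqI)
    then show "z \<in> fun_graph U"
      by (cases z) simp
  next
    fix z assume "z \<in> fun_graph U"
    then show "z \<in> mult_op (\<lambda>x. sgn (V x))"
      using U[of "fst z"] by (cases z) (simp add: mult_op_def)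
  qed
  ultimately show ?thesis
    using norm that by blast
qed


section \<open>Boundedness\<close>

text \<open>
  The operator \<open>R\<close> stands for \<open>T\<^sup>-\<^sup>1\<^sup>/\<^sup>2\<close>, whose range is the form domain of \<open>T\<close>.
\<close>

locale sobolev_parametrization =
  fixes R :: "l2 \<Rightarrow> l2"
  assumes R: "bounded_clinear R" and range_R: "range R = H1"
begin

lemma graph_inverse_closed_subspace:
  shows "closed ((fun_graph R)\<inverse>)" and "subspace ((fun_graph R)\<inverse>)"
proof -
  have eq: "(fun_graph R)\<inverse> = {p. fst p = R (snd p)}"
    by auto
  show "closed ((fun_graph R)\<inverse>)"
    unfolding eq by (intro closed_Collect_eq continuous_intros
        bounded_linear.continuous_on[OF bounded_clinear_imp_bounded_linear[OF R]])
  have "linear R"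
    by (intro bounded_linear.linear bounded_clinear_imp_bounded_linear R)
  then show "subspace ((fun_graph R)\<inverse>)"
    unfolding eq subspace_def by (auto simp: linear_add linear_cmul linear_0)
qed

text \<open>
  The weak derivative is bounded relative to \<open>R\<^sup>-\<^sup>1\<close>, since both are closed with domain \<open>H\<^sup>1\<close>.
\<close>

lemma H1_bound:
  obtains C where "C > 0"
    "\<And>h. \<exists>g. weak_derivative (R h) g \<and> 2 * (norm (R h))\<^sup>2 + 2 * (norm g)\<^sup>2 \<le> C * (norm h)\<^sup>2"
proof -
  have "\<exists>z. (x, z) \<in> {(f, g). weak_derivative f g}" if "(x, y) \<in> (fun_graph R)\<inverse>" for x y
    using that range_R by (auto simp: H1_iff[symmetric])
  then obtain D where D: "D > 0" "\<And>x y. (x, y) \<in> (fun_graph R)\<inverse> \<Longrightarrow>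
      \<exists>z. (x, z) \<in> {(f, g). weak_derivative f g} \<and> norm z \<le> D * norm (x, y)"
    using closed_subspace_relative_bound[OF graph_inverse_closed_subspace weak_derivative_closed_subspace]
    by blast
  obtain K where K: "K > 0" "\<And>h. norm (R h) \<le> K * norm h"
    using bounded_clinear_bound[OF R] by metis
  define C where "C = 2 * K\<^sup>2 + 2 * (D * (K + 1))\<^sup>2"
  have "C > 0"
    using K(1) D(1) by (simp add: C_def add_pos_nonneg)
  moreover have "\<exists>g. weak_derivative (R h) g \<and> 2 * (norm (R h))\<^sup>2 + 2 * (norm g)\<^sup>2 \<le> C * (norm h)\<^sup>2" for h
  proof -
    obtain g where g: "weak_derivative (R h) g" "norm g \<le> D * norm (R h, h)"
      using D(2)[of "R h" h] by auto
    have "norm (R h, h) \<le> (K + 1) * norm h"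
      using norm_Pair_le[of "R h" h] K(2)[of h] by (simp add: algebra_simps)
    then have "D * norm (R h, h) \<le> D * ((K + 1) * norm h)"
      using D(1) by (intro mult_left_mono) auto
    then have "norm g \<le> D * (K + 1) * norm h"
      using g(2) by (simp add: mult.assoc)
    then have "(norm g)\<^sup>2 \<le> (D * (K + 1) * norm h)\<^sup>2" "(norm (R h))\<^sup>2 \<le> (K * norm h)\<^sup>2"
      using K(2) by (auto intro!: power_mono)
    then have "2 * (norm (R h))\<^sup>2 + 2 * (norm g)\<^sup>2 \<le> C * (norm h)\<^sup>2"
      unfolding C_def power_mult_distrib by (simp add: distrib_right)
    then show ?thesis
      using g(1) by blast
  qed
  ultimately show ?thesis
    by (rule that)
qed

text \<open>
  The converse relative bound, applied to the translates of one smooth bump: their Sobolev norms do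
  not depend on the translation, hence the norms of their preimages under \<open>R\<close> are uniformly bounded.
\<close>

lemma bumps:
  obtains b where "b > 0"
    "\<And>a. \<exists>\<phi> h. (AE x in lebesgue. rep_l2 (R h) x = complex_of_real (\<phi> x)) \<and> norm h \<le> b \<and>
      (\<forall>x\<in>{a..a + 1}. \<phi> x = 1) \<and> (\<forall>x. x \<notin> {a - 1..a + 2} \<longrightarrow> \<phi> x = 0)"
proof -
  have "\<exists>z. (x, z) \<in> (fun_graph R)\<inverse>" if "(x, y) \<in> {(f, g). weak_derivative f g}" for x y
  proof -
    have "x \<in> range R"
      using that range_R by (auto simp: H1_iff)
    then show ?thesis by auto
  qed
  then obtain D where D: "D > 0" "\<And>x y. (x, y) \<in> {(f, g). weak_derivative f g} \<Longrightarrow>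
      \<exists>z. (x, z) \<in> (fun_graph R)\<inverse> \<and> norm z \<le> D * norm (x, y)"
    using closed_subspace_relative_bound[OF weak_derivative_closed_subspace graph_inverse_closed_subspace]
    by blast
  obtain P \<rho> :: "real \<Rightarrow> real" and B where
    P: "\<And>t. (P has_real_derivative \<rho> t) (at t)" "\<And>n. smooth_upto n \<rho>"
    and cont_\<rho>: "continuous_on UNIV \<rho>" and B: "B \<ge> 0" "\<And>t. \<bar>\<rho> t\<bar> \<le> B * indicator {0..1} t"
    and step: "\<And>t. t \<le> 0 \<or> t \<ge> 1 \<Longrightarrow> \<rho> t = 0"
    "\<And>t. t \<le> 0 \<Longrightarrow> P t = 0" "\<And>t. t \<ge> 1 \<Longrightarrow> P t = 1" "\<And>t. 0 \<le> P t \<and> P t \<le> 1"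
    by (fact smooth_step)
  have B': "\<bar>\<rho> t\<bar> \<le> B" for t
    using B(2)[of t] B(1) by (cases "t \<in> {0..1}") auto
  have norm_le: "norm (abs_l2 (\<lambda>x. complex_of_real (k x))) \<le> c * 2"
    if "square_integrable (\<lambda>x. complex_of_real (k x))" "c \<ge> 0" "\<And>x. \<bar>k x\<bar> \<le> c * indicator {a - 1..a + 2} x"
    for k a c
  proof (rule power2_le_imp_le)
    have "ennreal ((norm (abs_l2 (\<lambda>x. complex_of_real (k x))))\<^sup>2)
        \<le> (\<integral>\<^sup>+x. ennreal (c\<^sup>2) * indicator {a - 1..a + 2} x \<partial>lebesgue)"
      unfolding nn_integral_rep_l2_square[symmetric]
    proof (rule nn_integral_mono_AE, use rep_abs_l2[OF that(1)] in eventually_elim)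
      case (elim x)
      have "(k x)\<^sup>2 \<le> c\<^sup>2 * indicator {a - 1..a + 2} x"
        using power_mono[OF that(3)[of x], of 2] by (cases "x \<in> {a - 1..a + 2}") auto
      then show ?case
        unfolding elim by (cases "x \<in> {a - 1..a + 2}") (auto intro: ennreal_leI)
    qed
    also have "\<dots> = ennreal (c\<^sup>2 * 3)"
      by (subst nn_integral_cmult_indicator) (auto simp: emeasure_lborel_Icc_eq ennreal_mult)
    finally have "(norm (abs_l2 (\<lambda>x. complex_of_real (k x))))\<^sup>2 \<le> c\<^sup>2 * 3"
      by (subst (asm) ennreal_le_iff) auto
    also have "\<dots> \<le> c\<^sup>2 * 4"
      by (intro mult_left_mono) auto
    finally show "(norm (abs_l2 (\<lambda>x. complex_of_real (k x))))\<^sup>2 \<le> (c * 2)\<^sup>2"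
      by (simp add: power_mult_distrib)
  qed (use that(2) in simp)
  show ?thesis
  proof (rule that[of "D * (2 + 2 * B * 2)"])
    show "D * (2 + 2 * B * 2) > 0"
      using D(1) B(1) by (intro mult_pos_pos) auto
    fix a :: real
    define \<phi> where "\<phi> = (\<lambda>t. P (1 * (t - (a - 1))) - P (1 * (t - (a + 1))))"
    note diff = step_difference_test_function[OF P step(2,3) order_refl, where x = "a - 1" and y = "a + 1"]
    have test: "test_function \<phi>"
      unfolding \<phi>_def by (rule diff(1))
    have deriv: "deriv \<phi> t = \<rho> (t - (a - 1)) - \<rho> (t - (a + 1))" for t
      using fun_cong[OF diff(2), of t] by (simp add: \<phi>_def)
    have supp: "\<phi> x = 0" if "x \<notin> {a - 1..a + 2}" for x
      unfolding \<phi>_def by (rule diff(3)) (use that in auto)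
    have one: "\<phi> x = 1" if "x \<in> {a..a + 1}" for x
      using that step(3)[of "x - (a - 1)"] step(2)[of "x - (a + 1)"] by (simp add: \<phi>_def)
    define f where "f = abs_l2 (\<lambda>x. complex_of_real (\<phi> x))"
    define g where "g = abs_l2 (\<lambda>x. complex_of_real (deriv \<phi> x))"
    have "norm f \<le> 1 * 2"
      unfolding f_def
    proof (rule norm_le[where a = a, OF test_function_square_integrable(1)[OF test]])
      show "\<bar>\<phi> x\<bar> \<le> 1 * indicator {a - 1..a + 2} x" for x
        using supp[of x] step(4)[of "x - (a - 1)"] step(4)[of "x - (a + 1)"]
        by (cases "x \<in> {a - 1..a + 2}") (auto simp: \<phi>_def abs_le_iff simp del: atLeastAtMost_iff)
    qed simp
    moreover have "norm g \<le> (2 * B) * 2"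
      unfolding g_def
    proof (rule norm_le[where a = a, OF test_function_square_integrable(2)[OF test]])
      show "\<bar>deriv \<phi> x\<bar> \<le> 2 * B * indicator {a - 1..a + 2} x" for x
      proof (cases "x \<in> {a - 1..a + 2}")
        case True
        then show ?thesis
          using B'[of "x - (a - 1)"] B'[of "x - (a + 1)"] unfolding deriv by simp
      next
        case False
        then have "\<rho> (x - (a - 1)) = 0" "\<rho> (x - (a + 1)) = 0"
          by (intro step(1); auto)+
        then show ?thesis
          using False by (simp add: deriv)
      qed
    qed (use B(1) in simp)
    ultimately have "norm (f, g) \<le> 2 + 2 * B * 2"
      using norm_Pair_le[of f g] by simp
    moreover obtain h where h: "f = R h" "norm h \<le> D * norm (f, g)"
      using D(2)[of f g] weak_derivative_test_function[OF test] by (auto simp: f_def g_def)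
    moreover have "AE x in lebesgue. rep_l2 f x = complex_of_real (\<phi> x)"
      unfolding f_def by (rule rep_abs_l2[OF test_function_square_integrable(1)[OF test]])
    ultimately show "\<exists>\<phi> h. (AE x in lebesgue. rep_l2 (R h) x = complex_of_real (\<phi> x)) \<and>
        norm h \<le> D * (2 + 2 * B * 2) \<and> (\<forall>x\<in>{a..a + 1}. \<phi> x = 1) \<and> (\<forall>x. x \<notin> {a - 1..a + 2} \<longrightarrow> \<phi> x = 0)"
      using supp one D(1) by (intro exI[of _ \<phi>] exI[of _ h]) (auto intro: order_trans mult_left_mono)
  qed
qed

text \<open>
  The function \<open>F\<close> is the operator \<open>|V|\<^sup>1\<^sup>/\<^sup>2 R\<close> in case that operator is bounded; working with a
  function avoids the graph in the estimates.
\<close>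

definition weighted :: "(real \<Rightarrow> real) \<Rightarrow> (l2 \<Rightarrow> l2) \<Rightarrow> bool" where
  "weighted V F \<longleftrightarrow> bounded_clinear F \<and>
     (\<forall>h. AE x in lebesgue. rep_l2 (F h) x = complex_of_real (sqrt \<bar>V x\<bar>) * rep_l2 (R h) x)"

lemma sqrt_abs_mult_iff:
  "(h, g) \<in> sqrt_abs_mult V (fun_graph R) \<longleftrightarrow>
    (AE x in lebesgue. rep_l2 g x = complex_of_real (sqrt \<bar>V x\<bar>) * rep_l2 (R h) x)"
  by (auto simp: sqrt_abs_mult_def mult_op_def)

lemma weighted_fun_graph:
  assumes "weighted V F"
  shows "sqrt_abs_mult V (fun_graph R) = fun_graph F"
proof (intro set_eqI iffI)
  fix z assume "z \<in> sqrt_abs_mult V (fun_graph R)"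
  moreover obtain h g where z: "z = (h, g)"
    by fastforce
  ultimately have "AE x in lebesgue. rep_l2 g x = complex_of_real (sqrt \<bar>V x\<bar>) * rep_l2 (R h) x"
    by (simp add: sqrt_abs_mult_iff)
  moreover have "AE x in lebesgue. rep_l2 (F h) x = complex_of_real (sqrt \<bar>V x\<bar>) * rep_l2 (R h) x"
    using assms by (simp add: weighted_def)
  ultimately have "AE x in lebesgue. rep_l2 g x = rep_l2 (F h) x"
    by eventually_elim simp
  then show "z \<in> fun_graph F"
    using l2_eqI by (simp add: z)
next
  fix z assume "z \<in> fun_graph F"
  then show "z \<in> sqrt_abs_mult V (fun_graph R)"
    using assms by (cases z) (simp add: sqrt_abs_mult_iff weighted_def)
qed

lemma bounded_ops_imp_weighted:
  assumes "sqrt_abs_mult V (fun_graph R) \<in> bounded_ops"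
  obtains F where "weighted V F"
proof -
  obtain F where F: "bounded_clinear F" "sqrt_abs_mult V (fun_graph R) = fun_graph F"
    using bounded_opsE[OF assms] by metis
  have "(h, F h) \<in> sqrt_abs_mult V (fun_graph R)" for h
    by (simp add: F(2))
  then have "weighted V F"
    using F(1) by (simp add: weighted_def sqrt_abs_mult_iff)
  then show ?thesis by (rule that)
qed

lemma weighted_in_bounded_ops: "weighted V F \<Longrightarrow> sqrt_abs_mult V (fun_graph R) \<in> bounded_ops"
  by (simp add: weighted_fun_graph) (simp add: weighted_def fun_graph_in_bounded_ops)

lemma weighted_norm:
  assumes "weighted V F"
  shows "ennreal ((norm (F h))\<^sup>2) = (\<integral>\<^sup>+x. ennreal \<bar>V x\<bar> * ennreal ((cmod (rep_l2 (R h) x))\<^sup>2) \<partial>lebesgue)"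
  using assms norm_real_mult[of "F h" "\<lambda>x. sqrt \<bar>V x\<bar>" "rep_l2 (R h)"] by (simp add: weighted_def)

lemma weighted_exists:
  assumes [measurable]: "V \<in> borel_measurable lebesgue"
    and M: "\<And>n. cell_mass V n \<le> ennreal M"
  obtains F where "weighted V F"
proof -
  obtain C where C: "C > 0"
    "\<And>h. \<exists>g. weak_derivative (R h) g \<and> 2 * (norm (R h))\<^sup>2 + 2 * (norm g)\<^sup>2 \<le> C * (norm h)\<^sup>2"
    using H1_bound by metis
  define N where "N = max M 0"
  have bound: "(\<integral>\<^sup>+x. ennreal ((sqrt \<bar>V x\<bar>)\<^sup>2) * ennreal ((cmod (rep_l2 (R h) x))\<^sup>2) \<partial>lebesgue)
      \<le> ennreal (N * C * (norm h)\<^sup>2)" for h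
  proof -
    obtain g where g: "weak_derivative (R h) g" "2 * (norm (R h))\<^sup>2 + 2 * (norm g)\<^sup>2 \<le> C * (norm h)\<^sup>2"
      using C(2) by metis
    have "(\<integral>\<^sup>+x. ennreal \<bar>V x\<bar> * ennreal ((cmod (rep_l2 (R h) x))\<^sup>2) \<partial>lebesgue)
        \<le> ennreal M * ennreal (2 * (norm (R h))\<^sup>2 + 2 * (norm g)\<^sup>2)"
      by (rule H1_weighted_bound[OF g(1) _ M]) measurable
    also have "\<dots> \<le> ennreal N * ennreal (C * (norm h)\<^sup>2)"
      by (intro mult_mono ennreal_leI g(2)) (auto simp: N_def)
    also have "\<dots> = ennreal (N * C * (norm h)\<^sup>2)"
      using C(1) by (simp add: ennreal_mult[symmetric] N_def mult.assoc)
    finally show ?thesis by simp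
  qed
  define F where "F h = abs_l2 (\<lambda>x. complex_of_real (sqrt \<bar>V x\<bar>) * rep_l2 (R h) x)" for h
  have F: "AE x in lebesgue. rep_l2 (F h) x = complex_of_real (sqrt \<bar>V x\<bar>) * rep_l2 (R h) x" for h
    unfolding F_def
    by (intro rep_abs_l2 square_integrable_real_mult le_less_trans[OF bound]) (auto simp: ennreal_less_top)
  have "F (f + g) = F f + F g" for f g
  proof (rule l2_eqI)
    show "AE x in lebesgue. rep_l2 (F (f + g)) x = rep_l2 (F f + F g) x"
      using F[of "f + g"] F[of f] F[of g] rep_l2_add[of "R f" "R g"] rep_l2_add[of "F f" "F g"]
      unfolding bounded_clinear_add[OF R] by eventually_elim (simp add: distrib_left)
  qed
  moreover have "F (c *\<^sub>C f) = c *\<^sub>C F f" for c f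
  proof (rule l2_eqI)
    show "AE x in lebesgue. rep_l2 (F (c *\<^sub>C f)) x = rep_l2 (c *\<^sub>C F f) x"
      using F[of "c *\<^sub>C f"] F[of f] rep_l2_scaleC[of c "R f"] rep_l2_scaleC[of c "F f"]
      unfolding bounded_clinear_scaleC[OF R] by eventually_elim simp
  qed
  moreover have "norm (F h) \<le> sqrt (N * C) * norm h" for h
  proof (rule power2_le_imp_le)
    have "ennreal ((norm (F h))\<^sup>2) \<le> ennreal (N * C * (norm h)\<^sup>2)"
      unfolding norm_real_mult[OF F] by (rule bound)
    then have "(norm (F h))\<^sup>2 \<le> N * C * (norm h)\<^sup>2"
      using C(1) by (subst (asm) ennreal_le_iff) (auto simp: N_def)
    then show "(norm (F h))\<^sup>2 \<le> (sqrt (N * C) * norm h)\<^sup>2"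
      using C(1) by (simp add: power_mult_distrib N_def)
  qed (use C(1) in \<open>simp add: N_def\<close>)
  ultimately have "bounded_clinear F"
    unfolding bounded_clinear_def by blast
  then have "weighted V F"
    using F by (simp add: weighted_def)
  then show ?thesis by (rule that)
qed

lemma weighted_bump:
  assumes "weighted V F" "AE x in lebesgue. rep_l2 (R h) x = complex_of_real (\<phi> x)"
    "\<And>x. x \<in> A \<Longrightarrow> \<phi> x = 1"
  shows "(\<integral>\<^sup>+x. ennreal \<bar>V x\<bar> * indicator A x \<partial>lebesgue) \<le> ennreal ((norm (F h))\<^sup>2)"
  unfolding weighted_norm[OF assms(1)]
  by (rule nn_integral_mono_AE, use assms(2) in eventually_elim)
    (use assms(3) in \<open>auto simp: indicator_def\<close>)

lemma sym_product_fun_graph: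
  assumes V: "V \<in> borel_measurable lebesgue" and F: "weighted V F"
  obtains G U where "bounded_clinear G" "bounded_clinear U" "symmetric_map U"
    "\<And>f. norm (U f) \<le> norm f" "\<And>f g. cinner (G g) f = cinner g (F f)"
    "sym_product V (fun_graph R) = fun_graph (\<lambda>h. G (U (F h)))"
proof -
  have "bounded_clinear F"
    using F by (simp add: weighted_def)
  then obtain G where G: "bounded_clinear G" "\<And>f g. cinner (G g) f = cinner g (F f)"
    "adjoint_op (fun_graph F) = fun_graph G"
    using bounded_adjoint by metis
  obtain U where U: "bounded_clinear U" "symmetric_map U" "\<And>f. norm (U f) \<le> norm f"
    "mult_op (\<lambda>x. sgn (V x)) = fun_graph U"
    using sgn_mult_op[OF V] by metis
  have "sym_product V (fun_graph R) = fun_graph (\<lambda>h. G (U (F h)))"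
    by (simp add: sym_product_def weighted_fun_graph[OF F] G(3) U(4) fun_graph_comp)
  then show ?thesis
    using G U that by blast
qed

lemma sym_product_bounded:
  assumes V: "V \<in> borel_measurable lebesgue" and F: "weighted V F"
  shows "sym_product V (fun_graph R) \<in> bounded_ops"
proof -
  obtain G U where GU: "bounded_clinear G" "bounded_clinear U" "symmetric_map U"
    "\<And>f. norm (U f) \<le> norm f" "\<And>f g. cinner (G g) f = cinner g (F f)"
    "sym_product V (fun_graph R) = fun_graph (\<lambda>h. G (U (F h)))"
    by (fact sym_product_fun_graph[OF assms])
  have "bounded_clinear F"
    using F by (simp add: weighted_def)
  then have "bounded_clinear (\<lambda>h. G (U (F h)))"
    by (rule bounded_clinear_compose[OF GU(1) bounded_clinear_compose[OF GU(2)]])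
  then show ?thesis
    unfolding GU(6) by (rule fun_graph_in_bounded_ops)
qed

lemma unit_cell_le_Icc:
  "(\<integral>\<^sup>+x. f x * indicator (unit_cell n) x \<partial>lebesgue)
    \<le> (\<integral>\<^sup>+x. f x * indicator {real_of_int n..real_of_int n + 1} x \<partial>lebesgue)"
  by (intro nn_integral_mono) (auto simp: unit_cell_def indicator_def)

theorem bounded_iff_L1_loc_unif:
  assumes V: "V \<in> L1_loc"
  shows "sqrt_abs_mult V (fun_graph R) \<in> bounded_ops \<longleftrightarrow> V \<in> L1_loc_unif"
proof
  assume "V \<in> L1_loc_unif"
  then obtain M where M: "\<And>a. (LINT x:{a..a+1}|lebesgue. \<bar>V x\<bar>) \<le> M"
    by (auto simp: L1_loc_unif_def bdd_above_def)
  obtain F where "weighted V F"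
  proof (rule weighted_exists[OF L1_loc_measurable[OF V]])
    show "cell_mass V n \<le> ennreal M" for n
      using unit_cell_le_Icc[of "\<lambda>x. ennreal \<bar>V x\<bar>" n] ennreal_leI[OF M[of "real_of_int n"]]
      unfolding L1_loc_nn_integral[OF V] by (rule order_trans)
  qed
  then show "sqrt_abs_mult V (fun_graph R) \<in> bounded_ops"
    by (rule weighted_in_bounded_ops)
next
  assume "sqrt_abs_mult V (fun_graph R) \<in> bounded_ops"
  then obtain F where F: "weighted V F"
    using bounded_ops_imp_weighted by metis
  then obtain K where K: "K > 0" "\<And>h. norm (F h) \<le> K * norm h"
    using bounded_clinear_bound[of F] unfolding weighted_def by metis
  obtain b where b: "b > 0"
    "\<And>a. \<exists>\<phi> h. (AE x in lebesgue. rep_l2 (R h) x = complex_of_real (\<phi> x)) \<and> norm h \<le> b \<and>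
      (\<forall>x\<in>{a..a + 1}. \<phi> x = 1) \<and> (\<forall>x. x \<notin> {a - 1..a + 2} \<longrightarrow> \<phi> x = 0)"
    by (fact bumps)
  have "(LINT x:{a..a+1}|lebesgue. \<bar>V x\<bar>) \<le> (K * b)\<^sup>2" for a
  proof -
    obtain \<phi> h where h: "AE x in lebesgue. rep_l2 (R h) x = complex_of_real (\<phi> x)" "norm h \<le> b"
      "\<And>x. x \<in> {a..a + 1} \<Longrightarrow> \<phi> x = 1"
      using b(2)[of a] by blast
    have "ennreal (LINT x:{a..a+1}|lebesgue. \<bar>V x\<bar>) \<le> ennreal ((norm (F h))\<^sup>2)"
      unfolding L1_loc_nn_integral[OF V, symmetric] by (rule weighted_bump[OF F h(1,3)])
    also have "\<dots> \<le> ennreal ((K * b)\<^sup>2)"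
      using K h(2) by (intro ennreal_leI power_mono order_trans[OF K(2)] mult_left_mono) auto
    finally show ?thesis
      by (subst (asm) ennreal_le_iff) auto
  qed
  then show "V \<in> L1_loc_unif"
    using V by (auto simp: L1_loc_unif_def bdd_above_def)
qed

end

section \<open>Compactness\<close>

lemma compact_closure_if_approximable:
  fixes X :: "'a :: complete_space set"
  assumes approx: "\<And>\<epsilon>. \<epsilon> > 0 \<Longrightarrow> \<exists>S. compact S \<and> (\<forall>x\<in>X. \<exists>s\<in>S. dist x s \<le> \<epsilon>)"
  shows "compact (closure X)"
  unfolding compact_eq_totally_bounded
proof (intro conjI allI impI)
  show "complete (closure X)"
    by (simp add: complete_eq_closed)
  fix e :: real assume "e > 0"
  obtain S where S: "compact S" "\<And>x. x \<in> X \<Longrightarrow> \<exists>s\<in>S. dist x s \<le> e / 4"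
    using approx[of "e / 4"] \<open>e > 0\<close> by auto
  obtain k where k: "finite k" "S \<subseteq> (\<Union>x\<in>k. ball x (e / 4))"
    using S(1) \<open>e > 0\<close> unfolding compact_eq_totally_bounded by (meson zero_less_divide_iff zero_less_numeral)
  have "X \<subseteq> (\<Union>x\<in>k. cball x (e / 2))"
  proof
    fix x assume "x \<in> X"
    then obtain s where s: "s \<in> S" "dist x s \<le> e / 4"
      using S(2) by blast
    then obtain y where y: "y \<in> k" "dist y s < e / 4"
      using k(2) by (auto simp: subset_iff)
    have "dist y x \<le> dist y s + dist x s"
      by (metis dist_commute dist_triangle)
    then show "x \<in> (\<Union>x\<in>k. cball x (e / 2))"
      using s(2) y by (intro UN_I[of y]) auto
  qed
  then have "closure X \<subseteq> (\<Union>x\<in>k. cball x (e / 2))"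
    using k(1) by (intro closure_minimal closed_UN) auto
  also have "\<dots> \<subseteq> (\<Union>x\<in>k. ball x e)"
    using \<open>e > 0\<close> by (intro UN_mono) auto
  finally show "\<exists>k. finite k \<and> closure X \<subseteq> (\<Union>x\<in>k. ball x e)"
    using k(1) by blast
qed

lemma compact_coefficient_sums:
  assumes "finite J"
  shows "\<exists>S. compact S \<and> (\<forall>c. (\<forall>i\<in>J. cmod (c i) \<le> B) \<longrightarrow> (\<Sum>i\<in>J. c i *\<^sub>C e i) \<in> S)"
  using assms
proof induction
  case empty
  show ?case
    by (intro exI[of _ "{0}"]) auto
next
  case (insert j J)
  then obtain S where S: "compact S"
    "\<And>c. (\<forall>i\<in>J. cmod (c i) \<le> B) \<Longrightarrow> (\<Sum>i\<in>J. c i *\<^sub>C e i) \<in> S"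
    by blast
  define L where "L = (\<lambda>c. c *\<^sub>C e j) ` cball 0 B"
  have "bounded_linear (\<lambda>c. c *\<^sub>C e j)"
  proof (rule bounded_linear_intro[of _ "norm (e j)"])
    show "(a + b) *\<^sub>C e j = a *\<^sub>C e j + b *\<^sub>C e j" for a b
      by (rule scaleC_add_left)
    show "(r *\<^sub>R a) *\<^sub>C e j = r *\<^sub>R a *\<^sub>C e j" for r a
      by (simp add: scaleR_l2_def scaleC_scaleC scaleR_conv_of_real)
  qed (simp add: norm_scaleC)
  then have "compact L"
    unfolding L_def by (intro compact_continuous_image linear_continuous_on compact_cball)
  then have "compact {x + y | x y. x \<in> L \<and> y \<in> S}"
    using S(1) by (rule compact_sums)
  moreover have "(\<Sum>i\<in>insert j J. c i *\<^sub>C e i) \<in> {x + y | x y. x \<in> L \<and> y \<in> S}"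
    if "\<forall>i\<in>insert j J. cmod (c i) \<le> B" for c
  proof -
    have "c j *\<^sub>C e j \<in> L"
      using that by (auto simp: L_def intro!: imageI)
    moreover have "(\<Sum>i\<in>J. c i *\<^sub>C e i) \<in> S"
      using that by (intro S(2)) auto
    ultimately show ?thesis
      unfolding sum.insert[OF insert(1,2)] by blast
  qed
  ultimately show ?case
    by blast
qed

text \<open>
  On \<open>{-N..<N}\<close> the function \<open>R h\<close> is replaced by its values at the grid points \<open>i / k\<close>. By Hoelder
  continuity this costs at most \<open>C / k\<close> times the mass of \<open>|V|\<close> on that interval; outside, the weighted
  bound applies with the small cell masses. What is left are combinations of finitely many fixed
  vectors with bounded coefficients, which form a compact set.
\<close>

lemma (in sobolev_parametrization) weighted_approximation:
  assumes V[measurable]: "V \<in> borel_measurable lebesgue" and F: "weighted V F"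
    and loc: "\<And>a b. (\<integral>\<^sup>+x. ennreal \<bar>V x\<bar> * indicator {a..b} x \<partial>lebesgue) < \<infinity>"
    and tail: "\<And>\<eta>. \<eta> > 0 \<Longrightarrow> \<exists>N::nat. \<forall>n. int N \<le> \<bar>n\<bar> \<longrightarrow>
      cell_mass V n \<le> ennreal \<eta>"
    and "\<epsilon> > 0"
  shows "\<exists>S. compact S \<and> (\<forall>h. norm h \<le> 1 \<longrightarrow> (\<exists>s\<in>S. norm (F h - s) \<le> \<epsilon>))"
proof -
  obtain C where C: "C > 0"
    "\<And>h. \<exists>g. weak_derivative (R h) g \<and> 2 * (norm (R h))\<^sup>2 + 2 * (norm g)\<^sup>2 \<le> C * (norm h)\<^sup>2"
    by (fact H1_bound)
  \<comment> \<open>The mass \<open>\<eta>\<close> outside \<open>{-N..<N}\<close> and the mesh \<open>1 / k\<close> inside each contribute \<open>\<epsilon>\<^sup>2 / 2\<close> to the squared error.\<close>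
  define \<eta> where "\<eta> = \<epsilon>\<^sup>2 / (2 * C)"
  have "\<eta> > 0"
    using \<open>\<epsilon> > 0\<close> C(1) by (simp add: \<eta>_def)
  then obtain N :: nat where N: "\<And>n. int N \<le> \<bar>n\<bar> \<Longrightarrow>
      cell_mass V n \<le> ennreal \<eta>"
    using tail by blast
  define Z where "Z = {- real N..<real N}"
  have [measurable]: "Z \<in> sets lebesgue"
    by (simp add: Z_def)
  define I where "I = enn2real (\<integral>\<^sup>+x. ennreal \<bar>V x\<bar> * indicator Z x \<partial>lebesgue)"
  have "(\<integral>\<^sup>+x. ennreal \<bar>V x\<bar> * indicator Z x \<partial>lebesgue) \<le> (\<integral>\<^sup>+x. ennreal \<bar>V x\<bar> * indicator {- real N..real N} x \<partial>lebesgue)"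
    by (intro nn_integral_mono) (auto simp: Z_def indicator_def)
  then have fin: "(\<integral>\<^sup>+x. ennreal \<bar>V x\<bar> * indicator Z x \<partial>lebesgue) < \<infinity>"
    using loc[of "- real N" "real N"] by (rule le_less_trans)
  then have I: "(\<integral>\<^sup>+x. ennreal \<bar>V x\<bar> * indicator Z x \<partial>lebesgue) = ennreal I"
    by (simp add: I_def ennreal_enn2real_if)
  have "I \<ge> 0"
    by (simp add: I_def)
  obtain k0 :: nat where k0: "2 * C * I / \<epsilon>\<^sup>2 \<le> real k0"
    using real_arch_simple by blast
  define k where "k = real (Suc k0)"
  have "k > 0" "2 * C * I / \<epsilon>\<^sup>2 \<le> k"
    using k0 by (auto simp: k_def)
  then have k: "C * I / k \<le> \<epsilon>\<^sup>2 / 2"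
    using \<open>\<epsilon> > 0\<close> by (simp add: field_simps)
  define J :: "int set" where "J = {- (int N * int (Suc k0))..<int N * int (Suc k0)}"
  have J_iff: "\<lfloor>k * x\<rfloor> \<in> J \<longleftrightarrow> x \<in> Z" for x
  proof -
    have "\<lfloor>k * x\<rfloor> \<in> J \<longleftrightarrow> of_int (- (int N * int (Suc k0))) \<le> k * x \<and> k * x < of_int (int N * int (Suc k0))"
      unfolding J_def by (simp only: atLeastLessThan_iff le_floor_iff floor_less_iff)
    also have "\<dots> \<longleftrightarrow> k * (- real N) \<le> k * x \<and> k * x < k * real N"
      by (simp add: k_def mult.commute)
    also have "\<dots> \<longleftrightarrow> x \<in> Z"
      unfolding Z_def using \<open>k > 0\<close> by (simp only: mult_le_cancel_left_pos mult_less_cancel_left_pos atLeastLessThan_iff)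
    finally show ?thesis .
  qed
  define \<kappa> where "\<kappa> i x = (if \<lfloor>k * x\<rfloor> = i then 1 else 0 :: complex)" for i :: int and x :: real
  have [measurable]: "\<kappa> i \<in> borel_measurable lebesgue" for i
    unfolding \<kappa>_def by measurable
  define e where "e i = abs_l2 (\<lambda>x. complex_of_real (sqrt \<bar>V x\<bar>) * \<kappa> i x)" for i
  have e: "AE x in lebesgue. rep_l2 (e i) x = complex_of_real (sqrt \<bar>V x\<bar>) * \<kappa> i x" if "i \<in> J" for i
    unfolding e_def
  proof (intro rep_abs_l2 square_integrable_real_mult)
    have "(\<integral>\<^sup>+x. ennreal ((sqrt \<bar>V x\<bar>)\<^sup>2) * ennreal ((cmod (\<kappa> i x))\<^sup>2) \<partial>lebesgue)
        \<le> (\<integral>\<^sup>+x. ennreal \<bar>V x\<bar> * indicator Z x \<partial>lebesgue)"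
      using that J_iff by (intro nn_integral_mono) (auto simp: \<kappa>_def indicator_def)
    then show "(\<integral>\<^sup>+x. ennreal ((sqrt \<bar>V x\<bar>)\<^sup>2) * ennreal ((cmod (\<kappa> i x))\<^sup>2) \<partial>lebesgue) < \<infinity>"
      using fin by (rule le_less_trans)
  qed measurable
  have "finite J"
    by (simp add: J_def)
  obtain S where S: "compact S" "\<And>c. (\<forall>i\<in>J. cmod (c i) \<le> sqrt C) \<Longrightarrow> (\<Sum>i\<in>J. c i *\<^sub>C e i) \<in> S"
    using compact_coefficient_sums[OF \<open>finite J\<close>, of "sqrt C" e] by blast
  have "\<exists>s\<in>S. norm (F h - s) \<le> \<epsilon>" if h: "norm h \<le> 1" for h
  proof -
    obtain g where g: "weak_derivative (R h) g" "2 * (norm (R h))\<^sup>2 + 2 * (norm g)\<^sup>2 \<le> C * (norm h)\<^sup>2"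
      using C(2) by metis
    have "C * (norm h)\<^sup>2 \<le> C * 1"
      using h C(1) by (intro mult_left_mono power_le_one) auto
    then have C1: "2 * (norm (R h))\<^sup>2 + 2 * (norm g)\<^sup>2 \<le> C"
      using g(2) by simp
    then have gC: "(norm g)\<^sup>2 \<le> C"
      using zero_le_power2[of "norm (R h)"] zero_le_power2[of "norm g"] by linarith
    obtain u where u: "AE x in lebesgue. rep_l2 (R h) x = u x" "continuous_on UNIV u"
      "\<And>x. (cmod (u x))\<^sup>2 \<le> 2 * (norm (R h))\<^sup>2 + 2 * (norm g)\<^sup>2"
      "\<And>x y. (cmod (u x - u y))\<^sup>2 \<le> \<bar>x - y\<bar> * (norm g)\<^sup>2"
      by (fact H1_continuous_representative[OF g(1)])
    define s where "s = (\<Sum>i\<in>J. u (of_int i / k) *\<^sub>C e i)"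
    have "cmod (u x) \<le> sqrt C" for x
      using order_trans[OF u(3) C1] by (rule real_le_rsqrt)
    then have "s \<in> S"
      unfolding s_def by (intro S(2)) auto
    have "AE x in lebesgue. \<forall>i\<in>J. rep_l2 (u (of_int i / k) *\<^sub>C e i) x = u (of_int i / k) * rep_l2 (e i) x"
      using \<open>finite J\<close> by (intro AE_finite_allI rep_l2_scaleC)
    moreover have "AE x in lebesgue. \<forall>i\<in>J. rep_l2 (e i) x = complex_of_real (sqrt \<bar>V x\<bar>) * \<kappa> i x"
      using \<open>finite J\<close> by (intro AE_finite_allI e)
    moreover have "AE x in lebesgue. rep_l2 s x = (\<Sum>i\<in>J. rep_l2 (u (of_int i / k) *\<^sub>C e i) x)"
      unfolding s_def by (rule rep_l2_sum)
    ultimately have rep_s: "AE x in lebesgue. rep_l2 s x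
        = complex_of_real (sqrt \<bar>V x\<bar>) * (if x \<in> Z then u (of_int \<lfloor>k * x\<rfloor> / k) else 0)"
    proof eventually_elim
      case (elim x)
      have "rep_l2 s x = (\<Sum>i\<in>J. if \<lfloor>k * x\<rfloor> = i then complex_of_real (sqrt \<bar>V x\<bar>) * u (of_int i / k) else 0)"
        using elim by (auto simp: \<kappa>_def intro!: sum.cong)
      also have "\<dots> = (if \<lfloor>k * x\<rfloor> \<in> J then complex_of_real (sqrt \<bar>V x\<bar>) * u (of_int \<lfloor>k * x\<rfloor> / k) else 0)"
        using \<open>finite J\<close> by (rule sum.delta')
      finally show ?case
        by (simp add: J_iff)
    qed
    have rep_F: "AE x in lebesgue. rep_l2 (F h) x = complex_of_real (sqrt \<bar>V x\<bar>) * rep_l2 (R h) x"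
      using F by (simp add: weighted_def)
    have "AE x in lebesgue. rep_l2 (F h - s) x
        = complex_of_real (sqrt \<bar>V x\<bar>) * (rep_l2 (R h) x - (if x \<in> Z then u (of_int \<lfloor>k * x\<rfloor> / k) else 0))"
      using rep_l2_diff[of "F h" s] rep_F rep_s by eventually_elim (simp add: right_diff_distrib)
    then have "ennreal ((norm (F h - s))\<^sup>2) = (\<integral>\<^sup>+x. ennreal ((sqrt \<bar>V x\<bar>)\<^sup>2)
        * ennreal ((cmod (rep_l2 (R h) x - (if x \<in> Z then u (of_int \<lfloor>k * x\<rfloor> / k) else 0)))\<^sup>2) \<partial>lebesgue)"
      by (rule norm_real_mult)
    also have "\<dots> \<le> (\<integral>\<^sup>+x. ennreal (C / k) * (ennreal \<bar>V x\<bar> * indicator Z x)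
        + (ennreal \<bar>V x\<bar> * indicator (- Z) x) * ennreal ((cmod (rep_l2 (R h) x))\<^sup>2) \<partial>lebesgue)"
    proof (rule nn_integral_mono_AE, use u(1) in eventually_elim)
      case (elim x)
      show ?case
      proof (cases "x \<in> Z")
        case True
        have "\<bar>x - of_int \<lfloor>k * x\<rfloor> / k\<bar> = \<bar>k * x - of_int \<lfloor>k * x\<rfloor>\<bar> / k"
          using \<open>k > 0\<close> by (simp add: field_simps abs_divide)
        also have "\<dots> \<le> 1 / k"
          using \<open>k > 0\<close> by (intro divide_right_mono) linarith+
        finally have "(cmod (u x - u (of_int \<lfloor>k * x\<rfloor> / k)))\<^sup>2 \<le> (1 / k) * C"
          using \<open>k > 0\<close> by (intro order_trans[OF u(4)] mult_mono gC) auto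
        then have "ennreal ((cmod (u x - u (of_int \<lfloor>k * x\<rfloor> / k)))\<^sup>2) \<le> ennreal (C / k)"
          by (intro ennreal_leI) simp
        then have "ennreal \<bar>V x\<bar> * ennreal ((cmod (u x - u (of_int \<lfloor>k * x\<rfloor> / k)))\<^sup>2) \<le> ennreal \<bar>V x\<bar> * ennreal (C / k)"
          by (intro mult_left_mono) auto
        then show ?thesis
          using True elim by (simp add: mult.commute)
      qed simp
    qed
    also have "\<dots> = ennreal (C / k) * ennreal I
        + (\<integral>\<^sup>+x. (ennreal \<bar>V x\<bar> * indicator (- Z) x) * ennreal ((cmod (rep_l2 (R h) x))\<^sup>2) \<partial>lebesgue)"
      by (subst nn_integral_add, measurable, subst nn_integral_cmult, measurable, simp add: I)
    also have "\<dots> \<le> ennreal (C / k) * ennreal I + ennreal \<eta> * ennreal C"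
    proof (rule add_left_mono)
      have "(\<integral>\<^sup>+x. (ennreal \<bar>V x\<bar> * indicator (- Z) x) * ennreal ((cmod (rep_l2 (R h) x))\<^sup>2) \<partial>lebesgue)
          \<le> ennreal \<eta> * ennreal (2 * (norm (R h))\<^sup>2 + 2 * (norm g)\<^sup>2)"
      proof (rule H1_weighted_bound[OF g(1)])
        fix n :: int
        show "(\<integral>\<^sup>+x. ennreal \<bar>V x\<bar> * indicator (- Z) x * indicator (unit_cell n) x \<partial>lebesgue) \<le> ennreal \<eta>"
        proof (cases "int N \<le> \<bar>n\<bar>")
          case True
          have "(\<integral>\<^sup>+x. ennreal \<bar>V x\<bar> * indicator (- Z) x * indicator (unit_cell n) x \<partial>lebesgue)
              \<le> cell_mass V n"
            by (intro nn_integral_mono) (auto simp: indicator_def)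
          then show ?thesis
            using N[OF True] by (rule order_trans)
        next
          case False
          have "unit_cell n \<subseteq> Z"
          proof
            fix x assume "x \<in> unit_cell n"
            moreover have "- int N \<le> n" "n + 1 \<le> int N"
              using False by auto
            then have "- real N \<le> of_int n" "of_int n + 1 \<le> real N"
              by linarith+
            ultimately show "x \<in> Z"
              by (auto simp: unit_cell_def Z_def)
          qed
          then have "(\<integral>\<^sup>+x. ennreal \<bar>V x\<bar> * indicator (- Z) x * indicator (unit_cell n) x \<partial>lebesgue) = (\<integral>\<^sup>+x. 0 \<partial>(lebesgue :: real measure))"
            by (intro nn_integral_cong) (auto simp: indicator_def)
          then show ?thesis by simp
        qed
      qed measurable
      also have "\<dots> \<le> ennreal \<eta> * ennreal C"
        by (intro mult_left_mono ennreal_leI C1) auto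
      finally show "(\<integral>\<^sup>+x. (ennreal \<bar>V x\<bar> * indicator (- Z) x) * ennreal ((cmod (rep_l2 (R h) x))\<^sup>2) \<partial>lebesgue)
          \<le> ennreal \<eta> * ennreal C" .
    qed
    also have "\<dots> = ennreal (C * I / k + \<eta> * C)"
      using C(1) \<open>k > 0\<close> \<open>I \<ge> 0\<close> \<open>\<eta> > 0\<close> by (simp add: ennreal_mult[symmetric] ennreal_plus[symmetric] del: ennreal_plus)
    also have "\<dots> \<le> ennreal (\<epsilon>\<^sup>2)"
    proof (rule ennreal_leI)
      have "\<eta> * C = \<epsilon>\<^sup>2 / 2"
        using C(1) by (simp add: \<eta>_def)
      then show "C * I / k + \<eta> * C \<le> \<epsilon>\<^sup>2"
        using k by linarith
    qed
    finally have "(norm (F h - s))\<^sup>2 \<le> \<epsilon>\<^sup>2"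
      by (subst (asm) ennreal_le_iff) auto
    then have "norm (F h - s) \<le> \<epsilon>"
      using \<open>\<epsilon> > 0\<close> by (intro power2_le_imp_le[of "norm (F h - s)" \<epsilon>]) auto
    then show ?thesis
      using \<open>s \<in> S\<close> by blast
  qed
  then show ?thesis
    using S(1) by blast
qed

context sobolev_parametrization
begin

lemma bumps_orthogonal:
  assumes F: "weighted V F"
    and "AE x in lebesgue. rep_l2 (R h) x = complex_of_real (\<phi> x)"
      "AE x in lebesgue. rep_l2 (R k) x = complex_of_real (\<psi> x)"
    and "\<And>x. \<phi> x = 0 \<or> \<psi> x = 0"
  shows "cinner (F h) (F k) = 0"
proof -
  have "AE x in lebesgue. rep_l2 (F h) x = complex_of_real (sqrt \<bar>V x\<bar>) * rep_l2 (R h) x"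
    "AE x in lebesgue. rep_l2 (F k) x = complex_of_real (sqrt \<bar>V x\<bar>) * rep_l2 (R k) x"
    using F by (simp_all add: weighted_def)
  then have "AE x in lebesgue. cnj (rep_l2 (F h) x) * rep_l2 (F k) x = 0"
    using assms(2,3)
  proof eventually_elim
    case (elim x)
    then show ?case
      using assms(4)[of x] by auto
  qed
  then show ?thesis
    unfolding cinner_rep_l2 by (rule integral_eq_zero_AE)
qed

text \<open>
  If the averages do not vanish at infinity, bumps escaping to infinity have images of norm
  bounded below that are eventually mutually orthogonal, so no subsequence of them converges.
\<close>

lemma compact_imp_averages_vanish:
  assumes V: "V \<in> L1_loc" and F: "weighted V F" and cpt: "compact (closure (F ` cball 0 1))"
  shows "((\<lambda>a. LINT x:{a..a+1}|lebesgue. \<bar>V x\<bar>) \<longlongrightarrow> 0) at_infinity"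
proof (rule ccontr)
  define \<alpha> where "\<alpha> a = (LINT x:{a..a+1}|lebesgue. \<bar>V x\<bar>)" for a
  have "\<alpha> a \<ge> 0" for a
    unfolding \<alpha>_def set_lebesgue_integral_def by (intro Bochner_Integration.integral_nonneg) auto
  assume "\<not> ?thesis"
  then obtain \<epsilon> where \<epsilon>: "\<epsilon> > 0" "\<not> (\<forall>\<^sub>F a in at_infinity. dist (\<alpha> a) 0 < \<epsilon>)"
    unfolding tendsto_iff \<alpha>_def by blast
  have "\<exists>a. \<bar>a\<bar> \<ge> t \<and> \<alpha> a \<ge> \<epsilon>" for t
    using \<epsilon>(2) \<open>\<And>a. \<alpha> a \<ge> 0\<close> unfolding eventually_at_infinity by (auto simp: not_less) 
  then obtain a where a: "\<And>t. \<bar>a t\<bar> \<ge> t" "\<And>t. \<alpha> (a t) \<ge> \<epsilon>"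
    by metis
  obtain b where b: "b > 0"
    "\<And>a. \<exists>\<phi> h. (AE x in lebesgue. rep_l2 (R h) x = complex_of_real (\<phi> x)) \<and> norm h \<le> b \<and>
      (\<forall>x\<in>{a..a + 1}. \<phi> x = 1) \<and> (\<forall>x. x \<notin> {a - 1..a + 2} \<longrightarrow> \<phi> x = 0)"
    by (fact bumps)
  obtain \<phi> h where h: "\<And>a. AE x in lebesgue. rep_l2 (R (h a)) x = complex_of_real (\<phi> a x)"
    "\<And>a. norm (h a) \<le> b" "\<And>a x. x \<in> {a..a + 1} \<Longrightarrow> \<phi> a x = 1"
    "\<And>a x. x \<notin> {a - 1..a + 2} \<Longrightarrow> \<phi> a x = 0"
    using b(2) by metis
  have bF: "bounded_clinear F"
    using F by (simp add: weighted_def)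
  define y where "y n = (1 / b) *\<^sub>R F (h (a (real n)))" for n :: nat
  have y_eq: "y n = F ((1 / b) *\<^sub>R h (a (real n)))" for n
    by (simp add: y_def scaleR_l2_def bounded_clinear_scaleC[OF bF])
  have "y n \<in> closure (F ` cball 0 1)" for n
  proof -
    have "norm ((1 / b) *\<^sub>R h (a (real n))) \<le> 1"
      using h(2) b(1) by simp
    then show ?thesis
      unfolding y_eq by (intro subsetD[OF closure_subset] imageI) simp
  qed
  then obtain l s where l: "strict_mono s" "(y \<circ> s) \<longlonglongrightarrow> l"
    using cpt unfolding compact_def by metis
  define c where "c = \<epsilon> / b\<^sup>2"
  have "c > 0"
    using \<epsilon> b by (simp add: c_def)
  have y_lower: "(norm (y n))\<^sup>2 \<ge> c" for n
  proof -
    have "ennreal (\<alpha> (a (real n))) \<le> ennreal ((norm (F (h (a (real n)))))\<^sup>2)"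
      unfolding \<alpha>_def L1_loc_nn_integral[OF V, symmetric]
      by (rule weighted_bump[OF F h(1) h(3)])
    then have "\<alpha> (a (real n)) \<le> (norm (F (h (a (real n)))))\<^sup>2"
      by (subst (asm) ennreal_le_iff) auto
    then have "\<epsilon> \<le> (norm (F (h (a (real n)))))\<^sup>2"
      using a(2) order_trans by blast
    then show ?thesis
      using b(1) by (simp add: y_def c_def power_divide divide_right_mono)
  qed
  \<comment> \<open>The bumps have supports of length three.\<close>
  have far: "(norm (y n - y m))\<^sup>2 \<ge> c" if "\<bar>a (real m)\<bar> > \<bar>a (real n)\<bar> + 3" for n m
  proof -
    have "cinner (F (h (a (real n)))) (F (h (a (real m)))) = 0"
    proof (rule bumps_orthogonal[OF F h(1) h(1)])
      fix x
      have "x \<notin> {a (real n) - 1..a (real n) + 2} \<or> x \<notin> {a (real m) - 1..a (real m) + 2}"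
        using that by (auto simp: abs_if split: if_splits)
      then show "\<phi> (a (real n)) x = 0 \<or> \<phi> (a (real m)) x = 0"
        using h(4) by blast
    qed
    then have "inner (F (h (a (real n)))) (F (h (a (real m)))) = 0"
      by (simp add: inner_l2_def)
    then have "inner (y n) (y m) = 0"
      by (simp add: y_def)
    then have "(norm (y n - y m))\<^sup>2 = (norm (y n))\<^sup>2 + (norm (y m))\<^sup>2"
      by (simp add: power2_norm_eq_inner inner_diff_left inner_diff_right inner_commute)
    then show ?thesis
      using y_lower[of n] by (simp add: add_increasing2)
  qed
  have "Cauchy (y \<circ> s)"
    using l(2) by (rule LIMSEQ_imp_Cauchy)
  then obtain K where K: "\<And>m n. m \<ge> K \<Longrightarrow> n \<ge> K \<Longrightarrow> norm ((y \<circ> s) m - (y \<circ> s) n) < sqrt c"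
    using CauchyD[of "y \<circ> s" "sqrt c"] \<open>c > 0\<close> by auto
  obtain m0 :: nat where m0: "\<bar>a (real (s K))\<bar> + 3 < real m0"
    using reals_Archimedean2 by blast
  define m where "m = max K m0"
  have "real m0 \<le> real (s m)"
    using seq_suble[OF l(1), of m] by (simp add: m_def)
  also have "\<dots> \<le> \<bar>a (real (s m))\<bar>"
    by (rule a(1))
  finally have "(norm (y (s K) - y (s m)))\<^sup>2 \<ge> c"
    using m0 by (intro far) simp
  moreover have "(norm (y (s K) - y (s m)))\<^sup>2 < (sqrt c)\<^sup>2"
    using K[of K m] by (intro power_strict_mono) (auto simp: m_def)
  ultimately show False
    using \<open>c > 0\<close> by simp
qed

lemma averages_vanish_tail:
  assumes V: "V \<in> L1_loc" and lim: "((\<lambda>a. LINT x:{a..a+1}|lebesgue. \<bar>V x\<bar>) \<longlongrightarrow> 0) at_infinity"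
    and "\<eta> > 0"
  shows "\<exists>N::nat. \<forall>n. int N \<le> \<bar>n\<bar> \<longrightarrow>
    cell_mass V n \<le> ennreal \<eta>"
proof -
  have "\<forall>\<^sub>F a in at_infinity. dist (LINT x:{a..a+1}|lebesgue. \<bar>V x\<bar>) 0 < \<eta>"
    using lim \<open>\<eta> > 0\<close> unfolding tendsto_iff by blast
  then obtain b where b: "\<And>a. b \<le> \<bar>a\<bar> \<Longrightarrow> \<bar>LINT x:{a..a+1}|lebesgue. \<bar>V x\<bar>\<bar> < \<eta>"
    unfolding eventually_at_infinity by auto
  obtain N :: nat where N: "b \<le> real N"
    using real_arch_simple by blast
  have "cell_mass V n \<le> ennreal \<eta>" if "int N \<le> \<bar>n\<bar>" for n
  proof -
    have "real_of_int (int N) \<le> real_of_int \<bar>n\<bar>"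
      using that by (simp only: of_int_le_iff)
    then have "b \<le> \<bar>real_of_int n\<bar>"
      using N by simp
    then have "(LINT x:{real_of_int n..real_of_int n+1}|lebesgue. \<bar>V x\<bar>) \<le> \<eta>"
      using b[of "real_of_int n"] by linarith
    then show ?thesis
      using unit_cell_le_Icc[of "\<lambda>x. ennreal \<bar>V x\<bar>" n] ennreal_leI order_trans
      unfolding L1_loc_nn_integral[OF V] by blast
  qed
  then show ?thesis by blast
qed

lemma averages_vanish_imp_weighted:
  assumes V: "V \<in> L1_loc" and lim: "((\<lambda>a. LINT x:{a..a+1}|lebesgue. \<bar>V x\<bar>) \<longlongrightarrow> 0) at_infinity"
  obtains F where "weighted V F"
proof -
  obtain N :: nat where N: "\<And>n. int N \<le> \<bar>n\<bar> \<Longrightarrow>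
      cell_mass V n \<le> ennreal 1"
    using averages_vanish_tail[OF assms, of 1] by auto
  define M where "M = max 1 (LINT x:{- real N..real N}|lebesgue. \<bar>V x\<bar>)"
  show ?thesis
  proof (rule weighted_exists[OF L1_loc_measurable[OF V]])
    fix n :: int
    show "cell_mass V n \<le> ennreal M"
    proof (cases "int N \<le> \<bar>n\<bar>")
      case True
      have "cell_mass V n \<le> ennreal 1"
        by (rule N[OF True])
      also have "\<dots> \<le> ennreal M"
        by (intro ennreal_leI) (simp add: M_def)
      finally show ?thesis .
    next
      case False
      then have "- int N \<le> n" "n + 1 \<le> int N"
        by auto
      then have "- real N \<le> of_int n" "of_int n + 1 \<le> real N"
        by linarith+
      then have "cell_mass V n
          \<le> (\<integral>\<^sup>+x. ennreal \<bar>V x\<bar> * indicator {- real N..real N} x \<partial>lebesgue)"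
        by (intro nn_integral_mono) (auto simp: unit_cell_def indicator_def)
      also have "\<dots> \<le> ennreal M"
        unfolding L1_loc_nn_integral[OF V] by (intro ennreal_leI) (simp add: M_def)
      finally show ?thesis .
    qed
  qed (rule that)
qed

lemma averages_vanish_imp_compact:
  assumes V: "V \<in> L1_loc" and lim: "((\<lambda>a. LINT x:{a..a+1}|lebesgue. \<bar>V x\<bar>) \<longlongrightarrow> 0) at_infinity"
    and F: "weighted V F"
  shows "compact (closure (F ` cball 0 1))"
proof (rule compact_closure_if_approximable)
  fix \<epsilon> :: real assume "\<epsilon> > 0"
  have loc: "(\<integral>\<^sup>+x. ennreal \<bar>V x\<bar> * indicator {a..b} x \<partial>lebesgue) < \<infinity>" for a b
    unfolding L1_loc_nn_integral[OF V] by simp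
  have "\<exists>S. compact S \<and> (\<forall>h. norm h \<le> 1 \<longrightarrow> (\<exists>s\<in>S. norm (F h - s) \<le> \<epsilon>))"
    by (rule weighted_approximation[OF L1_loc_measurable[OF V] F])
      (rule loc, erule averages_vanish_tail[OF V lim], rule \<open>\<epsilon> > 0\<close>)
  then show "\<exists>S. compact S \<and> (\<forall>x\<in>F ` cball 0 1. \<exists>s\<in>S. dist x s \<le> \<epsilon>)"
    by (auto simp: dist_norm)
qed

theorem compact_iff_averages_vanish:
  assumes V: "V \<in> L1_loc"
  shows "sqrt_abs_mult V (fun_graph R) \<in> compact_ops \<longleftrightarrow>
    ((\<lambda>a. LINT x:{a..a+1}|lebesgue. \<bar>V x\<bar>) \<longlongrightarrow> 0) at_infinity"
proof
  assume *: "sqrt_abs_mult V (fun_graph R) \<in> compact_ops"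
  then obtain F where F: "weighted V F"
    using bounded_ops_imp_weighted unfolding compact_ops_def by blast
  then show "((\<lambda>a. LINT x:{a..a+1}|lebesgue. \<bar>V x\<bar>) \<longlongrightarrow> 0) at_infinity"
    using * by (intro compact_imp_averages_vanish[OF V F])
      (simp add: compact_ops_def weighted_fun_graph fun_graph_Image)
next
  assume *: "((\<lambda>a. LINT x:{a..a+1}|lebesgue. \<bar>V x\<bar>) \<longlongrightarrow> 0) at_infinity"
  obtain F where F: "weighted V F"
    by (fact averages_vanish_imp_weighted[OF V *])
  then show "sqrt_abs_mult V (fun_graph R) \<in> compact_ops"
    using averages_vanish_imp_compact[OF V * F] weighted_in_bounded_ops[OF F]
    by (simp add: compact_ops_def weighted_fun_graph fun_graph_Image)
qed

lemma sym_product_compact: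
  assumes V: "V \<in> L1_loc" and lim: "((\<lambda>a. LINT x:{a..a+1}|lebesgue. \<bar>V x\<bar>) \<longlongrightarrow> 0) at_infinity"
  shows "sym_product V (fun_graph R) \<in> compact_ops"
proof -
  note V' = L1_loc_measurable[OF V]
  obtain F where F: "weighted V F"
    by (fact averages_vanish_imp_weighted[OF V lim])
  obtain G U where GU: "bounded_clinear G" "bounded_clinear U" "symmetric_map U"
    "\<And>f. norm (U f) \<le> norm f" "\<And>f g. cinner (G g) f = cinner g (F f)"
    "sym_product V (fun_graph R) = fun_graph (\<lambda>h. G (U (F h)))"
    by (fact sym_product_fun_graph[OF V' F])
  define K where "K = (\<lambda>f. G (U f)) ` closure (F ` cball 0 1)"
  have "compact K"
    unfolding K_def
    by (rule compact_continuous_image[OF linear_continuous_on[OF bounded_clinear_imp_bounded_linear[OF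
            bounded_clinear_compose[OF GU(1,2)]]] averages_vanish_imp_compact[OF V lim F]])
  moreover have "closure ((\<lambda>h. G (U (F h))) ` cball 0 1) \<subseteq> K"
  proof (rule closure_minimal)
    show "(\<lambda>h. G (U (F h))) ` cball 0 1 \<subseteq> K"
      using closure_subset[of "F ` cball 0 1"] unfolding K_def by blast
    show "closed K"
      using \<open>compact K\<close> by (rule compact_imp_closed)
  qed
  ultimately have "compact (closure ((\<lambda>h. G (U (F h))) ` cball 0 1))"
    by (metis closed_closure compact_Int_closed inf.absorb_iff2)
  then show ?thesis
    using sym_product_bounded[OF V' F] by (simp add: compact_ops_def GU(6) fun_graph_Image)
qed

end

section \<open>Hilbert--Schmidt and trace class\<close>

text \<open>
  With \<open>B = F\<^sup>* U F\<close> and \<open>P = |B|\<close> the partial isometry of the polar decomposition is replaced by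
  the contraction \<open>W = B (P + \<delta>)\<^sup>-\<^sup>1\<close>, for which
  \<open>\<langle>e, P e\<rangle> \<le> |\<langle>F W e, U F e\<rangle>| + \<delta>\<close> holds at unit vectors.
\<close>

lemma abs_trace_estimate:
  assumes G: "\<And>f g. cinner (G g) f = cinner g (F f)" and U: "\<And>f. norm (U f) \<le> norm f"
    and B: "bounded_clinear (\<lambda>h. G (U (F h)))" "symmetric_map (\<lambda>h. G (U (F h)))"
    and P: "bounded_clinear P" "symmetric_map P" "positive_map P" "\<And>f. P (P f) = G (U (F (G (U (F f)))))"
    and "\<delta> > 0"
  obtains W where "bounded_clinear W" "\<And>f. norm (W f) \<le> norm f"
    "\<And>e. norm e = 1 \<Longrightarrow> inner e (P e) \<le> ((norm (F (W e)))\<^sup>2 + (norm (F e))\<^sup>2) / 2 + \<delta>"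
proof -
  define B where "B h = G (U (F h))" for h
  have bB: "bounded_clinear B" and sB: "symmetric_map B" and PP: "P (P f) = B (B f)" for f
    using B P(4) by (simp_all add: B_def[abs_def])
  define A where "A f = P f + complex_of_real \<delta> *\<^sub>C f" for f
  have A_eq: "A f = P f + \<delta> *\<^sub>R f" for f
    by (simp add: A_def scaleC_of_real)
  have A: "bounded_clinear A" "symmetric_map A"
  proof -
    obtain K where K: "\<And>f. norm (P f) \<le> K * norm f"
      using bounded_clinear_bound[OF P(1)] by metis
    have "norm (A f) \<le> (K + \<delta>) * norm f" for f
      unfolding A_eq using norm_triangle_ineq[of "P f" "\<delta> *\<^sub>R f"] K[of f] \<open>\<delta> > 0\<close>
      by (simp add: distrib_right)
    moreover have "A (f + g) = A f + A g" "A (c *\<^sub>C f) = c *\<^sub>C A f" for f g c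
      by (simp_all add: A_def bounded_clinear_add[OF P(1)] bounded_clinear_scaleC[OF P(1)]
          scaleC_add_right scaleC_scaleC mult.commute)
    ultimately show "bounded_clinear A"
      unfolding bounded_clinear_def by blast
    show "symmetric_map A"
      using P(2) by (simp add: symmetric_map_def A_eq inner_add_left inner_add_right)
  qed
  have "op_ge (fun_graph A) \<delta>"
  proof -
    have "cinner f (P f) \<in> \<real> \<and> 0 \<le> Re (cinner f (P f))" for f
      using op_ge_zero_fun_graph[OF P(1-3)] by (auto simp: op_ge_def)
    moreover have "cinner f (A f) = cinner f (P f) + complex_of_real (\<delta> * (norm f)\<^sup>2)" for f
      by (simp add: A_def cinner_add_right cinner_scaleC_right cinner_self)
    ultimately show ?thesis
      by (auto simp: op_ge_def intro!: Reals_add simp del: of_real_mult)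
  qed
  then obtain Q where Q: "bounded_clinear Q" "symmetric_map Q" "positive_map Q" "fun_graph A = (fun_graph Q)\<inverse>"
    using self_adjoint_coercive_inverse[OF self_adjoint_fun_graph[OF A] _ \<open>\<delta> > 0\<close>] by metis
  have QA: "Q (A f) = f" for f
  proof -
    have "(f, A f) \<in> (fun_graph Q)\<inverse>"
      unfolding Q(4)[symmetric] by simp
    then show ?thesis by simp
  qed
  have AQ: "A (Q f) = f" for f
  proof -
    have "(Q f, f) \<in> fun_graph A"
      unfolding Q(4) by simp
    then show ?thesis by simp
  qed
  have norm_B: "norm (B f) = norm (P f)" for f
  proof -
    have "inner (B f) (B f) = inner (P f) (P f)"
      using sB P(2) PP[of f] unfolding symmetric_map_def by metis
    then show ?thesis
      by (simp add: norm_eq_sqrt_inner)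
  qed
  have PQ: "norm (P (Q f)) \<le> norm f" for f
  proof -
    define x where "x = Q f"
    have pos: "0 \<le> inner (P x) x"
      using P(3) by (simp add: positive_map_def inner_commute)
    have "(norm f)\<^sup>2 = (norm (P x + \<delta> *\<^sub>R x))\<^sup>2"
      using AQ[of f] by (simp add: A_eq x_def)
    also have "\<dots> = (norm (P x))\<^sup>2 + 2 * \<delta> * inner (P x) x + \<delta>\<^sup>2 * (norm x)\<^sup>2"
      unfolding power2_norm_eq_inner
      by (simp add: inner_add_left inner_add_right inner_commute power2_eq_square algebra_simps)
    also have "\<dots> \<ge> (norm (P x))\<^sup>2"
      using pos \<open>\<delta> > 0\<close> by simp
    finally show ?thesis
      unfolding x_def using norm_ge_zero by (rule power2_le_imp_le)
  qed
  define W where "W f = B (Q f)" for f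
  have "bounded_clinear W"
    unfolding W_def[abs_def] by (rule bounded_clinear_compose[OF bB Q(1)])
  moreover have "norm (W f) \<le> norm f" for f
    unfolding W_def norm_B by (rule PQ)
  moreover have "inner e (P e) \<le> ((norm (F (W e)))\<^sup>2 + (norm (F e))\<^sup>2) / 2 + \<delta>" if "norm e = 1" for e
  proof -
    have "P e = Q (P (P e) + \<delta> *\<^sub>R P e)"
      using QA[of "P e"] by (simp add: A_eq)
    also have "\<dots> = Q (B (B e)) + \<delta> *\<^sub>R Q (P e)"
      by (simp add: bounded_clinear_add[OF Q(1)] bounded_clinear_scaleC[OF Q(1)] PP scaleR_l2_def)
    also have "Q (P e) = P (Q e)"
    proof -
      have "Q (P e) + \<delta> *\<^sub>R Q e = P (Q e) + \<delta> *\<^sub>R Q e"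
        using QA[of e] AQ[of e]
        by (simp add: A_eq bounded_clinear_add[OF Q(1)] bounded_clinear_scaleC[OF Q(1)] scaleR_l2_def)
      then show ?thesis by simp
    qed
    finally have "inner e (P e) = inner e (Q (B (B e))) + \<delta> * inner e (P (Q e))"
      by (metis inner_add_right inner_scaleR_right)
    moreover have "\<delta> * inner e (P (Q e)) \<le> \<delta> * 1"
      using norm_cauchy_schwarz[of e "P (Q e)"] PQ[of e] that \<open>\<delta> > 0\<close>
      by (intro mult_left_mono) auto
    moreover have "inner e (Q (B (B e))) = inner (W e) (B e)"
      using Q(2) sB unfolding symmetric_map_def W_def by metis
    moreover have "inner (W e) (B e) \<le> ((norm (F (W e)))\<^sup>2 + (norm (F e))\<^sup>2) / 2"
    proof -
      have "cinner (W e) (B e) = cinner (F (W e)) (U (F e))"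
        using cinner_commute[of "W e" "B e"] cinner_commute[of "F (W e)" "U (F e)"]
        by (simp add: B_def G)
      then have "inner (W e) (B e) = inner (F (W e)) (U (F e))"
        by (simp add: inner_l2_def)
      also have "\<dots> \<le> norm (F (W e)) * norm (U (F e))"
        by (rule norm_cauchy_schwarz)
      also have "\<dots> \<le> norm (F (W e)) * norm (F e)"
        by (intro mult_left_mono U) auto
      also have "\<dots> \<le> ((norm (F (W e)))\<^sup>2 + (norm (F e))\<^sup>2) / 2"
        using sum_squares_bound[of "norm (F (W e))" "norm (F e)"] by simp
      finally show ?thesis .
    qed
    ultimately show ?thesis
      by linarith
  qed
  ultimately show ?thesis
    by (rule that)
qed

context sobolev_parametrization
begin

text \<open>
  For a fixed point \<open>x\<close> the evaluation \<open>f \<mapsto> (R W f)(x)\<close> of the continuous representative is a bounded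
  functional, so the squares of its values on an orthonormal family sum up to at most the square
  of its norm. Integrating this against \<open>|V|\<close> gives the Hilbert--Schmidt bound. The contraction \<open>W\<close>
  is needed for the trace class estimate.
\<close>

lemma hilbert_schmidt_bound:
  assumes V[measurable]: "V \<in> borel_measurable lebesgue" and F: "weighted V F"
    and fin: "(\<integral>\<^sup>+x. ennreal \<bar>V x\<bar> \<partial>lebesgue) < \<infinity>"
  obtains K where "K \<ge> 0" "\<And>W (I :: 'i set) e. bounded_clinear W \<Longrightarrow> (\<And>f. norm (W f) \<le> norm f) \<Longrightarrow> finite I \<Longrightarrow>
    orthonormal_family I e \<Longrightarrow> (\<Sum>i\<in>I. (norm (F (W (e i))))\<^sup>2) \<le> K"
proof -
  obtain C where C: "C > 0"
    "\<And>h. \<exists>g. weak_derivative (R h) g \<and> 2 * (norm (R h))\<^sup>2 + 2 * (norm g)\<^sup>2 \<le> C * (norm h)\<^sup>2"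
    by (fact H1_bound)
  have representative: "\<exists>u. (AE x in lebesgue. rep_l2 (R h) x = u x) \<and> continuous_on UNIV u \<and>
      (\<forall>x. (cmod (u x))\<^sup>2 \<le> C * (norm h)\<^sup>2)" for h
  proof -
    obtain g where g: "weak_derivative (R h) g" "2 * (norm (R h))\<^sup>2 + 2 * (norm g)\<^sup>2 \<le> C * (norm h)\<^sup>2"
      using C(2) by metis
    obtain u where u: "AE x in lebesgue. rep_l2 (R h) x = u x" "continuous_on UNIV u"
      "\<And>x. (cmod (u x))\<^sup>2 \<le> 2 * (norm (R h))\<^sup>2 + 2 * (norm g)\<^sup>2"
      "\<And>x y. (cmod (u x - u y))\<^sup>2 \<le> \<bar>x - y\<bar> * (norm g)\<^sup>2"
      by (fact H1_continuous_representative[OF g(1)])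
    have "(cmod (u x))\<^sup>2 \<le> C * (norm h)\<^sup>2" for x
      using u(3) g(2) by (rule order_trans)
    then show ?thesis
      using u(1,2) by blast
  qed
  have "\<exists>v. \<forall>h. (AE x in lebesgue. rep_l2 (R h) x = v h x) \<and> continuous_on UNIV (v h) \<and>
      (\<forall>x. (cmod (v h x))\<^sup>2 \<le> C * (norm h)\<^sup>2)"
    by (rule choice) (intro allI representative)
  then obtain v where v: "\<And>h. AE x in lebesgue. rep_l2 (R h) x = v h x"
    "\<And>h. continuous_on UNIV (v h)" "\<And>h x. (cmod (v h x))\<^sup>2 \<le> C * (norm h)\<^sup>2"
    by blast
  define S where "S = enn2real (\<integral>\<^sup>+x. ennreal \<bar>V x\<bar> \<partial>lebesgue)"
  have S: "(\<integral>\<^sup>+x. ennreal \<bar>V x\<bar> \<partial>lebesgue) = ennreal S" "S \<ge> 0"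
    using fin by (simp_all add: S_def ennreal_enn2real_if)
  have "(\<Sum>i\<in>I. (norm (F (W (e i))))\<^sup>2) \<le> C * S"
    if W: "bounded_clinear W" "\<And>f. norm (W f) \<le> norm f" and e: "finite I" "orthonormal_family I e"
    for W and I :: "'i set" and e
  proof -
    \<comment> \<open>Evaluating at \<open>x\<close> the combination with the coefficients \<open>cnj (u i x)\<close> turns the functional bound into \<open>s\<^sup>2 \<le> C s\<close> for the sum \<open>s\<close>.\<close>
    define u where "u i = v (W (e i))" for i
    have u: "AE x in lebesgue. rep_l2 (R (W (e i))) x = u i x" "continuous_on UNIV (u i)" for i
      unfolding u_def by (rule v)+
    have point: "(\<Sum>i\<in>I. (cmod (u i x))\<^sup>2) \<le> C" for x
    proof -
      define c where "c i = cnj (u i x)" for i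
      define f where "f = (\<Sum>i\<in>I. c i *\<^sub>C e i)"
      have RWf: "R (W f) = (\<Sum>i\<in>I. c i *\<^sub>C R (W (e i)))"
        unfolding f_def
        by (simp add: bounded_clinear_sum[OF W(1)] bounded_clinear_sum[OF R]
            bounded_clinear_scaleC[OF W(1)] bounded_clinear_scaleC[OF R])
      have "AE y in lebesgue. \<forall>i\<in>I. rep_l2 (c i *\<^sub>C R (W (e i))) y = c i * rep_l2 (R (W (e i))) y"
        using e(1) by (intro AE_finite_allI rep_l2_scaleC)
      moreover have "AE y in lebesgue. \<forall>i\<in>I. rep_l2 (R (W (e i))) y = u i y"
        using e(1) by (intro AE_finite_allI u(1))
      moreover have "AE y in lebesgue. rep_l2 (R (W f)) y = (\<Sum>i\<in>I. rep_l2 (c i *\<^sub>C R (W (e i))) y)"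
        unfolding RWf by (rule rep_l2_sum)
      ultimately have "AE y in lebesgue. v (W f) y = (\<Sum>i\<in>I. c i * u i y)"
        using v(1)[of "W f"] by eventually_elim simp
      then have "v (W f) = (\<lambda>y. \<Sum>i\<in>I. c i * u i y)"
        by (intro continuous_AE_eq_imp_eq v(2) continuous_intros u(2))
      then have "v (W f) x = (\<Sum>i\<in>I. c i * u i x)"
        by (rule fun_cong)
      also have "\<dots> = complex_of_real (\<Sum>i\<in>I. (cmod (u i x))\<^sup>2)"
        unfolding of_real_sum complex_norm_square by (simp add: c_def mult.commute)
      finally have vx: "cmod (v (W f) x) = (\<Sum>i\<in>I. (cmod (u i x))\<^sup>2)"
        by (simp only: norm_of_real abs_of_nonneg sum_nonneg zero_le_power2)
      have "(\<Sum>i\<in>I. (cmod (u i x))\<^sup>2)\<^sup>2 \<le> C * (norm (W f))\<^sup>2"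
        using v(3)[of "W f" x] unfolding vx .
      also have "\<dots> \<le> C * (norm f)\<^sup>2"
        using C(1) W(2) by (intro mult_left_mono power_mono) auto
      also have "\<dots> = C * (\<Sum>i\<in>I. (cmod (u i x))\<^sup>2)"
        unfolding f_def norm_orthonormal_sum[OF e] by (simp add: c_def)
      finally have "(\<Sum>i\<in>I. (cmod (u i x))\<^sup>2) * (\<Sum>i\<in>I. (cmod (u i x))\<^sup>2) \<le> C * (\<Sum>i\<in>I. (cmod (u i x))\<^sup>2)"
        by (simp add: power2_eq_square)
      moreover have "0 \<le> (\<Sum>i\<in>I. (cmod (u i x))\<^sup>2)"
        by (simp add: sum_nonneg)
      ultimately show ?thesis
        using C(1) by (cases "(\<Sum>i\<in>I. (cmod (u i x))\<^sup>2) = 0") (auto simp: mult_le_cancel_right)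
    qed
    have "ennreal (\<Sum>i\<in>I. (norm (F (W (e i))))\<^sup>2) = (\<Sum>i\<in>I. ennreal ((norm (F (W (e i))))\<^sup>2))"
      by (rule sum_ennreal[symmetric]) simp
    also have "\<dots> = (\<integral>\<^sup>+x. (\<Sum>i\<in>I. ennreal \<bar>V x\<bar> * ennreal ((cmod (rep_l2 (R (W (e i))) x))\<^sup>2)) \<partial>lebesgue)"
      unfolding weighted_norm[OF F] by (rule nn_integral_sum[symmetric]) measurable
    also have "\<dots> \<le> (\<integral>\<^sup>+x. ennreal C * ennreal \<bar>V x\<bar> \<partial>lebesgue)"
    proof (rule nn_integral_mono_AE)
      have "AE x in lebesgue. \<forall>i\<in>I. rep_l2 (R (W (e i))) x = u i x"
        using e(1) by (intro AE_finite_allI u(1))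
      then show "AE x in lebesgue. (\<Sum>i\<in>I. ennreal \<bar>V x\<bar> * ennreal ((cmod (rep_l2 (R (W (e i))) x))\<^sup>2))
          \<le> ennreal C * ennreal \<bar>V x\<bar>"
      proof eventually_elim
        case (elim x)
        have "(\<Sum>i\<in>I. ennreal \<bar>V x\<bar> * ennreal ((cmod (rep_l2 (R (W (e i))) x))\<^sup>2))
            = ennreal \<bar>V x\<bar> * (\<Sum>i\<in>I. ennreal ((cmod (u i x))\<^sup>2))"
          unfolding sum_distrib_left by (intro sum.cong refl) (simp add: elim)
        also have "\<dots> = ennreal \<bar>V x\<bar> * ennreal (\<Sum>i\<in>I. (cmod (u i x))\<^sup>2)"
          by (subst sum_ennreal) auto
        also have "\<dots> \<le> ennreal \<bar>V x\<bar> * ennreal C"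
          by (intro mult_left_mono ennreal_leI point) auto
        finally show ?case
          by (simp add: mult.commute)
      qed
    qed
    also have "\<dots> = ennreal (C * S)"
      using C(1) S by (simp add: nn_integral_cmult ennreal_mult)
    finally show ?thesis
      using C(1) S(2) by (subst (asm) ennreal_le_iff) auto
  qed
  then show ?thesis
    using that[of "C * S"] C(1) S(2) by simp
qed

lemma integrable_imp_weighted:
  assumes [measurable]: "V \<in> borel_measurable lebesgue" and fin: "(\<integral>\<^sup>+x. ennreal \<bar>V x\<bar> \<partial>lebesgue) < \<infinity>"
  obtains F where "weighted V F"
proof (rule weighted_exists)
  fix n
  have "cell_mass V n \<le> (\<integral>\<^sup>+x. ennreal \<bar>V x\<bar> \<partial>lebesgue)"
    by (intro nn_integral_mono) (auto simp: indicator_def)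
  then show "cell_mass V n \<le> ennreal (enn2real (\<integral>\<^sup>+x. ennreal \<bar>V x\<bar> \<partial>lebesgue))"
    using fin by (simp add: ennreal_enn2real_if)
qed (use assms that in auto)

lemma integrable_imp_hilbert_schmidt:
  assumes V: "V \<in> borel_measurable lebesgue" and fin: "(\<integral>\<^sup>+x. ennreal \<bar>V x\<bar> \<partial>lebesgue) < \<infinity>"
  shows "sqrt_abs_mult V (fun_graph R) \<in> hilbert_schmidt_ops"
proof -
  obtain F where F: "weighted V F"
    by (fact integrable_imp_weighted[OF assms])
  obtain K where K: "K \<ge> 0" "\<And>W (I :: l2 set) e. bounded_clinear W \<Longrightarrow> (\<And>f. norm (W f) \<le> norm f) \<Longrightarrow> finite I \<Longrightarrow>
    orthonormal_family I e \<Longrightarrow> (\<Sum>i\<in>I. (norm (F (W (e i))))\<^sup>2) \<le> K"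
    by (fact hilbert_schmidt_bound[OF V F fin])
  obtain E where E: "orthonormal_basis E"
    using orthonormal_basis_exists by blast
  have id: "bounded_clinear (\<lambda>f. f)"
    by (auto simp: bounded_clinear_def intro!: exI[of _ 1])
  have "(\<lambda>e. (norm (F e))\<^sup>2) summable_on E"
  proof (rule nonneg_bdd_above_summable_on)
    show "bdd_above (sum (\<lambda>e. (norm (F e))\<^sup>2) ` {D. D \<subseteq> E \<and> finite D})"
    proof (rule bdd_aboveI2)
      fix D assume "D \<in> {D. D \<subseteq> E \<and> finite D}"
      then show "(\<Sum>e\<in>D. (norm (F e))\<^sup>2) \<le> K"
        using K(2)[OF id _ _ orthonormal_basis_family[OF E]] by simp
    qed
  qed simp
  then show ?thesis
    using E weighted_in_bounded_ops[OF F] unfolding hilbert_schmidt_ops_def weighted_fun_graph[OF F]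
    by auto
qed

text \<open>
  Tested on the normalised pieces \<open>h\<^sub>n\<close> of \<open>|V|\<^sup>1\<^sup>/\<^sup>2\<close> on the unit cells, the adjoint satisfies
  \<open>\<integral>|V| \<le> b\<^sup>2 \<parallel>F\<^sup>* h\<^sub>n\<parallel>\<^sup>2\<close> over the \<open>n\<close>-th cell because of the bump that equals one there; the pieces
  are orthonormal, so that these squares sum up to at most the squared Hilbert--Schmidt norm.
\<close>

lemma hilbert_schmidt_imp_integrable:
  assumes V: "V \<in> L1_loc" and hs: "sqrt_abs_mult V (fun_graph R) \<in> hilbert_schmidt_ops"
  shows "(\<integral>\<^sup>+x. ennreal \<bar>V x\<bar> \<partial>lebesgue) < \<infinity>"
proof -
  have [measurable]: "V \<in> borel_measurable lebesgue"
    by (rule L1_loc_measurable[OF V])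
  obtain F where F: "weighted V F"
    using hs bounded_ops_imp_weighted unfolding hilbert_schmidt_ops_def by blast
  have bF: "bounded_clinear F"
    using F by (simp add: weighted_def)
  obtain E where E: "orthonormal_basis E" "(\<lambda>e. (norm (F e))\<^sup>2) summable_on E"
    using hs by (auto simp: hilbert_schmidt_ops_def weighted_fun_graph[OF F])
  define M where "M = infsum (\<lambda>e. (norm (F e))\<^sup>2) E"
  have M: "(\<Sum>e\<in>D. (norm (F e))\<^sup>2) \<le> M" if "finite D" "D \<subseteq> E" for D
    unfolding M_def using E(2) that by (intro finite_sum_le_infsum) auto
  obtain G where G: "bounded_clinear G" "\<And>f g. cinner (G g) f = cinner g (F f)"
    "adjoint_op (fun_graph F) = fun_graph G"
    by (fact bounded_adjoint[OF bF])
  have adjoint_bound: "(\<Sum>i\<in>I. (norm (G (h i)))\<^sup>2) \<le> M"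
    if I: "finite I" "orthonormal_family I h" for I :: "int set" and h
  proof (rule field_le_epsilon)
    fix \<epsilon> :: real assume "\<epsilon> > 0"
    define \<delta> where "\<delta> = \<epsilon> / (real (card I) + 1)"
    have "\<delta> > 0"
      using \<open>\<epsilon> > 0\<close> by (simp add: \<delta>_def)
    have "\<exists>D. finite D \<and> D \<subseteq> E \<and> (norm (G (h i)))\<^sup>2 \<le> (\<Sum>e\<in>D. (cmod (cinner e (G (h i))))\<^sup>2) + \<delta>" for i
      using parseval_approximation[OF E(1) \<open>\<delta> > 0\<close>] by metis
    then obtain D where D: "\<And>i. finite (D i)" "\<And>i. D i \<subseteq> E"
      "\<And>i. (norm (G (h i)))\<^sup>2 \<le> (\<Sum>e\<in>D i. (cmod (cinner e (G (h i))))\<^sup>2) + \<delta>"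
      by metis
    define D' where "D' = (\<Union>i\<in>I. D i)"
    have D': "finite D'" "D' \<subseteq> E"
      using I(1) D(1,2) by (auto simp: D'_def)
    have swap: "cmod (cinner e (G g)) = cmod (cinner g (F e))" for e g
      using cinner_commute[of e "G g"] by (simp add: G(2))
    have "(\<Sum>i\<in>I. (norm (G (h i)))\<^sup>2) \<le> (\<Sum>i\<in>I. (\<Sum>e\<in>D'. (cmod (cinner (h i) (F e)))\<^sup>2) + \<delta>)"
    proof (rule sum_mono)
      fix i assume "i \<in> I"
      have "(\<Sum>e\<in>D i. (cmod (cinner (h i) (F e)))\<^sup>2) \<le> (\<Sum>e\<in>D'. (cmod (cinner (h i) (F e)))\<^sup>2)"
        using D'(1) \<open>i \<in> I\<close> by (intro sum_mono2) (auto simp: D'_def)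
      then show "(norm (G (h i)))\<^sup>2 \<le> (\<Sum>e\<in>D'. (cmod (cinner (h i) (F e)))\<^sup>2) + \<delta>"
        using D(3)[of i] by (simp add: swap)
    qed
    also have "\<dots> = (\<Sum>e\<in>D'. \<Sum>i\<in>I. (cmod (cinner (h i) (F e)))\<^sup>2) + real (card I) * \<delta>"
      unfolding sum.distrib by (subst sum.swap) simp
    also have "\<dots> \<le> M + \<epsilon>"
    proof (rule add_mono)
      have "(\<Sum>e\<in>D'. \<Sum>i\<in>I. (cmod (cinner (h i) (F e)))\<^sup>2) \<le> (\<Sum>e\<in>D'. (norm (F e))\<^sup>2)"
        by (intro sum_mono bessel_inequality I)
      also have "\<dots> \<le> M"
        by (rule M[OF D'])
      finally show "(\<Sum>e\<in>D'. \<Sum>i\<in>I. (cmod (cinner (h i) (F e)))\<^sup>2) \<le> M" .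
      show "real (card I) * \<delta> \<le> \<epsilon>"
        using \<open>\<epsilon> > 0\<close> by (simp add: \<delta>_def field_simps)
    qed
    finally show "(\<Sum>i\<in>I. (norm (G (h i)))\<^sup>2) \<le> M + \<epsilon>" .
  qed
  obtain b where b: "b > 0"
    "\<And>a. \<exists>\<phi> h. (AE x in lebesgue. rep_l2 (R h) x = complex_of_real (\<phi> x)) \<and> norm h \<le> b \<and>
      (\<forall>x\<in>{a..a + 1}. \<phi> x = 1) \<and> (\<forall>x. x \<notin> {a - 1..a + 2} \<longrightarrow> \<phi> x = 0)"
    by (fact bumps)
  define a where "a n = (LINT x|lebesgue. \<bar>V x\<bar> * indicator (unit_cell n) x)" for n
  have int_a: "integrable lebesgue (\<lambda>x. \<bar>V x\<bar> * indicator (unit_cell n) x)" for n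
  proof (rule Bochner_Integration.integrable_bound)
    show "integrable lebesgue (\<lambda>x. indicator {real_of_int n..real_of_int n + 1} x *\<^sub>R V x)"
      using V by (simp add: L1_loc_def set_integrable_def)
  qed (auto simp: unit_cell_def indicator_def)
  have a_nonneg: "a n \<ge> 0" for n
    unfolding a_def by (intro Bochner_Integration.integral_nonneg) auto
  have nn_a: "cell_mass V n = ennreal (a n)" for n
  proof -
    have "cell_mass V n
        = (\<integral>\<^sup>+x. ennreal (\<bar>V x\<bar> * indicator (unit_cell n) x) \<partial>lebesgue)"
      by (intro nn_integral_cong) (auto simp: indicator_def)
    also have "\<dots> = ennreal (a n)"
      unfolding a_def by (rule nn_integral_eq_integral[OF int_a]) simp
    finally show ?thesis .
  qed
  have cells: "(\<Sum>n\<in>J. a n) \<le> b\<^sup>2 * M" if "finite J" for J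
  proof -
    \<comment> \<open>Cells without mass are left out, as their pieces cannot be normalised.\<close>
    define I where "I = {n \<in> J. a n > 0}"
    have "finite I"
      using that by (simp add: I_def)
    define \<kappa> where "\<kappa> n x = sqrt \<bar>V x\<bar> / sqrt (a n) * indicator (unit_cell n) x" for n x
    have [measurable]: "\<kappa> n \<in> borel_measurable lebesgue" for n
      unfolding \<kappa>_def by measurable
    have \<kappa>_mult: "\<kappa> n x * \<kappa> n x = (1 / a n) * (\<bar>V x\<bar> * indicator (unit_cell n) x)" for n x
      using a_nonneg[of n] by (auto simp: \<kappa>_def indicator_def)
    have sq: "square_integrable (\<lambda>x. complex_of_real (\<kappa> n x))" for n
      unfolding square_integrable_def
    proof
      have "integrable lebesgue (\<lambda>x. (1 / a n) * (\<bar>V x\<bar> * indicator (unit_cell n) x))"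
        by (intro integrable_mult_right int_a)
      then show "integrable lebesgue (\<lambda>x. (cmod (complex_of_real (\<kappa> n x)))\<^sup>2)"
        by (simp add: \<kappa>_mult power2_eq_square)
    qed measurable
    define h where "h n = abs_l2 (\<lambda>x. complex_of_real (\<kappa> n x))" for n
    have h: "AE x in lebesgue. rep_l2 (h n) x = complex_of_real (\<kappa> n x)" for n
      unfolding h_def by (rule rep_abs_l2[OF sq])
    have test: "cinner (h n) f = (LINT x|lebesgue. rep_l2 f x * complex_of_real (\<kappa> n x))" for n f
      unfolding h_def by (rule cinner_real_function[OF sq])
    have "orthonormal_family I h"
      unfolding orthonormal_family_def
    proof (intro ballI)
      fix n m assume "n \<in> I" "m \<in> I"
      have "cinner (h n) (h m) = (LINT x|lebesgue. complex_of_real (\<kappa> m x * \<kappa> n x))"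
        unfolding test
      proof (rule integral_cong_AE)
        show "AE x in lebesgue. rep_l2 (h m) x * complex_of_real (\<kappa> n x) = complex_of_real (\<kappa> m x * \<kappa> n x)"
          using h[of m] by eventually_elim simp
      qed measurable
      also have "\<dots> = complex_of_real (LINT x|lebesgue. \<kappa> m x * \<kappa> n x)"
        by (rule integral_complex_of_real)
      also have "(LINT x|lebesgue. \<kappa> m x * \<kappa> n x) = (if n = m then 1 else 0)"
      proof (cases "n = m")
        case True
        have "(LINT x|lebesgue. \<kappa> n x * \<kappa> n x) = (1 / a n) * a n"
          unfolding \<kappa>_mult a_def by simp
        then show ?thesis
          using True \<open>n \<in> I\<close> by (simp add: I_def)
      next
        case False
        then have zero: "\<kappa> m x * \<kappa> n x = 0" for x
          by (auto simp: \<kappa>_def indicator_def in_unit_cell)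
        show ?thesis
          unfolding zero using False by simp
      qed
      finally show "cinner (h n) (h m) = (if n = m then 1 else 0)"
        by simp
    qed
    have a_le: "a n \<le> b\<^sup>2 * (norm (G (h n)))\<^sup>2" if "n \<in> I" for n
    proof -
      obtain \<phi> k where k: "AE x in lebesgue. rep_l2 (R k) x = complex_of_real (\<phi> x)" "norm k \<le> b"
        "\<And>x. x \<in> {real_of_int n..real_of_int n + 1} \<Longrightarrow> \<phi> x = 1"
        using b(2)[of "real_of_int n"] by blast
      have Fk: "AE x in lebesgue. rep_l2 (F k) x = complex_of_real (sqrt \<bar>V x\<bar>) * rep_l2 (R k) x"
        using F by (simp add: weighted_def)
      have "cinner (G (h n)) k = (LINT x|lebesgue. complex_of_real ((1 / sqrt (a n)) * (\<bar>V x\<bar> * indicator (unit_cell n) x)))"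
        unfolding G(2) test
      proof (rule integral_cong_AE)
        show "AE x in lebesgue. rep_l2 (F k) x * complex_of_real (\<kappa> n x)
            = complex_of_real ((1 / sqrt (a n)) * (\<bar>V x\<bar> * indicator (unit_cell n) x))"
          using Fk k(1)
        proof eventually_elim
          case (elim x)
          show ?case
          proof (cases "x \<in> unit_cell n")
            case True
            then have "\<phi> x = 1"
              by (intro k(3)) (auto simp: unit_cell_def)
            then have Fkx: "rep_l2 (F k) x = complex_of_real (sqrt \<bar>V x\<bar>)"
              using elim by simp
            have \<kappa>x: "\<kappa> n x = sqrt \<bar>V x\<bar> / sqrt (a n)"
              using True by (simp add: \<kappa>_def)
            have "rep_l2 (F k) x * complex_of_real (\<kappa> n x) = complex_of_real (sqrt \<bar>V x\<bar> * (sqrt \<bar>V x\<bar> / sqrt (a n)))"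
              unfolding Fkx \<kappa>x of_real_mult ..
            also have "sqrt \<bar>V x\<bar> * (sqrt \<bar>V x\<bar> / sqrt (a n)) = (1 / sqrt (a n)) * (\<bar>V x\<bar> * indicator (unit_cell n) x)"
              using True by simp
            finally show ?thesis .
          qed (simp add: \<kappa>_def)
        qed
      qed measurable
      also have "\<dots> = complex_of_real ((1 / sqrt (a n)) * a n)"
        unfolding integral_complex_of_real a_def by simp
      also have "(1 / sqrt (a n)) * a n = sqrt (a n)"
        using that by (simp add: I_def real_div_sqrt)
      finally have "sqrt (a n) = cmod (cinner (G (h n)) k)"
        using a_nonneg[of n] by simp
      also have "\<dots> \<le> norm (G (h n)) * norm k"
        by (rule cinner_cauchy_schwarz)
      also have "\<dots> \<le> norm (G (h n)) * b"
        by (intro mult_left_mono k(2)) auto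
      finally have "(sqrt (a n))\<^sup>2 \<le> (norm (G (h n)) * b)\<^sup>2"
        using a_nonneg[of n] by (intro power_mono) auto
      then show ?thesis
        using a_nonneg[of n] by (simp add: power_mult_distrib mult.commute)
    qed
    have "(\<Sum>n\<in>J. a n) = (\<Sum>n\<in>I. a n)"
    proof (rule sum.mono_neutral_right[OF that])
      show "\<forall>n\<in>J - I. a n = 0"
        using a_nonneg by (auto simp: I_def antisym not_less)
    qed (auto simp: I_def)
    also have "\<dots> \<le> (\<Sum>n\<in>I. b\<^sup>2 * (norm (G (h n)))\<^sup>2)"
      by (intro sum_mono a_le)
    also have "\<dots> = b\<^sup>2 * (\<Sum>n\<in>I. (norm (G (h n)))\<^sup>2)"
      by (simp add: sum_distrib_left)
    also have "\<dots> \<le> b\<^sup>2 * M"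
      by (intro mult_left_mono adjoint_bound \<open>finite I\<close> \<open>orthonormal_family I h\<close>) auto
    finally show ?thesis .
  qed
  have "(\<integral>\<^sup>+x. ennreal \<bar>V x\<bar> \<partial>lebesgue) = (\<Sum>k. ennreal (a (int_decode k)))"
    by (subst nn_integral_unit_cells) (simp_all add: nn_a)
  also have "\<dots> = (SUP n. \<Sum>k<n. ennreal (a (int_decode k)))"
    by (rule suminf_eq_SUP)
  also have "\<dots> \<le> ennreal (b\<^sup>2 * M)"
  proof (rule SUP_least)
    fix n :: nat
    have "(\<Sum>k<n. ennreal (a (int_decode k))) = ennreal (\<Sum>k<n. a (int_decode k))"
      by (rule sum_ennreal) (rule a_nonneg)
    also have "(\<Sum>k<n. a (int_decode k)) = (\<Sum>m\<in>int_decode ` {..<n}. a m)"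
      by (subst sum.reindex) (auto intro: inj_on_subset[OF inj_int_decode])
    finally show "(\<Sum>k<n. ennreal (a (int_decode k))) \<le> ennreal (b\<^sup>2 * M)"
      using cells[of "int_decode ` {..<n}"] by (simp add: ennreal_leI)
  qed
  also have "\<dots> < \<infinity>"
    by simp
  finally show ?thesis .
qed

lemma sym_product_trace_class:
  assumes V: "V \<in> borel_measurable lebesgue" and fin: "(\<integral>\<^sup>+x. ennreal \<bar>V x\<bar> \<partial>lebesgue) < \<infinity>"
  shows "sym_product V (fun_graph R) \<in> trace_class_ops"
proof -
  obtain F where F: "weighted V F"
    by (fact integrable_imp_weighted[OF assms])
  then have bF: "bounded_clinear F"
    by (simp add: weighted_def)
  obtain K where K: "K \<ge> 0" "\<And>W (I :: l2 set) e. bounded_clinear W \<Longrightarrow> (\<And>f. norm (W f) \<le> norm f) \<Longrightarrow> finite I \<Longrightarrow>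
    orthonormal_family I e \<Longrightarrow> (\<Sum>i\<in>I. (norm (F (W (e i))))\<^sup>2) \<le> K"
    by (fact hilbert_schmidt_bound[OF V F fin])
  obtain G U where GU: "bounded_clinear G" "bounded_clinear U" "symmetric_map U"
    "\<And>f. norm (U f) \<le> norm f" "\<And>f g. cinner (G g) f = cinner g (F f)"
    "sym_product V (fun_graph R) = fun_graph (\<lambda>h. G (U (F h)))"
    by (fact sym_product_fun_graph[OF V F])
  define B where "B h = G (U (F h))" for h
  have bB: "bounded_clinear B"
    unfolding B_def[abs_def] by (rule bounded_clinear_compose[OF GU(1) bounded_clinear_compose[OF GU(2) bF]])
  have sB: "symmetric_map B"
  proof (rule symmetric_mapI)
    fix f g
    have "cinner (B f) g = cinner (U (F f)) (F g)"
      by (simp add: B_def GU(5))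
    also have "\<dots> = cinner (F f) (U (F g))"
      by (rule symmetric_map_cinner[OF GU(3) bounded_clinear_scaleC[OF GU(2)]])
    also have "\<dots> = cinner f (B g)"
      using cinner_commute[of f "B g"] cinner_commute[of "F f" "U (F g)"] by (simp add: B_def GU(5))
    finally show "cinner (B f) g = cinner f (B g)" .
  qed
  have BB: "bounded_clinear (\<lambda>h. B (B h))" "symmetric_map (\<lambda>h. B (B h))" "positive_map (\<lambda>h. B (B h))"
  proof -
    show "bounded_clinear (\<lambda>h. B (B h))"
      by (rule bounded_clinear_compose[OF bB bB])
    show "symmetric_map (\<lambda>h. B (B h))"
      using sB unfolding symmetric_map_def by simp
    have "inner f (B (B f)) = inner (B f) (B f)" for f
      using sB unfolding symmetric_map_def by metis
    then show "positive_map (\<lambda>h. B (B h))"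
      by (simp add: positive_map_def)
  qed
  obtain P where P: "bounded_clinear P" "symmetric_map P" "positive_map P" "\<And>f. P (P f) = B (B f)"
    "op_sqrt (fun_graph (\<lambda>h. B (B h))) = fun_graph P"
    by (fact op_sqrt_bounded[OF BB])
  have "adjoint_op (fun_graph B) = fun_graph B"
    using self_adjoint_fun_graph[OF bB sB] by (simp add: self_adjoint_op_def)
  then have abs: "abs_op (fun_graph B) = fun_graph P"
    by (simp add: abs_op_def fun_graph_comp P(5))
  obtain E where E: "orthonormal_basis E"
    using orthonormal_basis_exists by blast
  have id: "bounded_clinear (\<lambda>f. f)"
    by (auto simp: bounded_clinear_def intro!: exI[of _ 1])
  have trace: "(\<Sum>e\<in>D. inner e (P e)) \<le> K" if D: "finite D" "D \<subseteq> E" for D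
  proof (rule field_le_epsilon)
    fix \<epsilon> :: real assume "\<epsilon> > 0"
    define \<delta> where "\<delta> = \<epsilon> / (real (card D) + 1)"
    have "\<delta> > 0"
      using \<open>\<epsilon> > 0\<close> by (simp add: \<delta>_def)
    obtain W where W: "bounded_clinear W" "\<And>f. norm (W f) \<le> norm f"
      "\<And>e. norm e = 1 \<Longrightarrow> inner e (P e) \<le> ((norm (F (W e)))\<^sup>2 + (norm (F e))\<^sup>2) / 2 + \<delta>"
      by (rule abs_trace_estimate[OF GU(5,4) bB[unfolded B_def[abs_def]] sB[unfolded B_def[abs_def]]
            P(1-3) P(4)[unfolded B_def] \<open>\<delta> > 0\<close>]) blast
    note D' = orthonormal_basis_family[OF E D(2)]
    have unit: "norm e = 1" if "e \<in> D" for e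
    proof -
      have "cinner e e = 1"
        using D' that by (simp add: orthonormal_family_def)
      then have "(norm e)\<^sup>2 = 1"
        unfolding cinner_self using of_real_eq_1_iff by blast
      then show ?thesis
        by (simp add: power2_eq_1_iff) (use norm_ge_zero[of e] in linarith)
    qed
    have "(\<Sum>e\<in>D. inner e (P e)) \<le> (\<Sum>e\<in>D. ((norm (F (W e)))\<^sup>2 + (norm (F e))\<^sup>2) / 2 + \<delta>)"
      by (intro sum_mono W(3) unit)
    also have "\<dots> = ((\<Sum>e\<in>D. (norm (F (W e)))\<^sup>2) + (\<Sum>e\<in>D. (norm (F e))\<^sup>2)) / 2 + real (card D) * \<delta>"
      by (simp add: sum.distrib sum_divide_distrib[symmetric])
    also have "\<dots> \<le> (K + K) / 2 + \<epsilon>"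
    proof (intro add_mono divide_right_mono)
      show "(\<Sum>e\<in>D. (norm (F (W e)))\<^sup>2) \<le> K"
        by (rule K(2)[OF W(1,2) D(1) D'])
      show "(\<Sum>e\<in>D. (norm (F e))\<^sup>2) \<le> K"
        by (rule K(2)[OF id order_refl D(1) D'])
      show "real (card D) * \<delta> \<le> \<epsilon>"
        using \<open>\<epsilon> > 0\<close> by (simp add: \<delta>_def field_simps)
    qed simp
    finally show "(\<Sum>e\<in>D. inner e (P e)) \<le> K + \<epsilon>"
      by simp
  qed
  have "(\<lambda>e. inner e (P e)) summable_on E"
  proof (rule nonneg_bdd_above_summable_on)
    show "0 \<le> inner e (P e)" for e
      using P(3) by (simp add: positive_map_def)
    show "bdd_above (sum (\<lambda>e. inner e (P e)) ` {D. D \<subseteq> E \<and> finite D})"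
      by (rule bdd_aboveI2) (use trace in auto)
  qed
  then have "(\<lambda>e. complex_of_real (inner e (P e))) summable_on E"
    by (rule summable_on_bounded_linear[OF bounded_linear_of_real])
  moreover have "cinner e (P e) = complex_of_real (inner e (P e))" for e
  proof -
    have "cinner e (P e) \<in> \<real>"
      using op_ge_zero_fun_graph[OF P(1-3)] by (auto simp: op_ge_def)
    then show ?thesis
      by (simp add: inner_l2_def)
  qed
  ultimately have "(\<lambda>e. cinner e (op_apply (abs_op (fun_graph B)) e)) summable_on E"
    by (simp add: abs)
  moreover have "sym_product V (fun_graph R) = fun_graph B"
    using GU(6) by (simp add: B_def[abs_def])
  ultimately show ?thesis
    using E fun_graph_in_bounded_ops[OF bB] by (auto simp: trace_class_ops_def)
qed

theorem hilbert_schmidt_iff_integrable: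
  assumes "V \<in> L1_loc"
  shows "sqrt_abs_mult V (fun_graph R) \<in> hilbert_schmidt_ops \<longleftrightarrow> (\<integral>\<^sup>+x. ennreal \<bar>V x\<bar> \<partial>lebesgue) < \<infinity>"
  using hilbert_schmidt_imp_integrable[OF assms] integrable_imp_hilbert_schmidt[OF L1_loc_measurable[OF assms]]
  by blast

end


section \<open>Sturm--Liouville operators with form domain \<open>H\<^sup>1\<close>\<close>

theorem theorem2p5:
  fixes p q r :: "real \<Rightarrow> real" and \<epsilon> :: real and T :: l2_op
  assumes p_pos: "AE x in lebesgue. p x > 0"
    and p_inv: "(\<lambda>x. 1 / p x) \<in> L1_loc"
    and q_loc: "q \<in> L1_loc"
    and r_loc: "r \<in> L1_loc"
    and r_nonzero: "emeasure lebesgue {x. r x \<noteq> 0} > 0"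
    and p_top: "filterlim (\<lambda>x. LINT t:{0..x}|lebesgue. 1 / sqrt (p t)) at_top at_top"
    and p_bot: "filterlim (\<lambda>x. LINT t:{x..0}|lebesgue. 1 / sqrt (p t)) at_top at_bot"
    and eps: "\<epsilon> > 0"
    and T_def: "T = SL_op p q"
    and T_min_ge: "op_ge (SL_min p q) \<epsilon>"
    and T_sa: "self_adjoint_op T"
    and T_ge: "op_ge T \<epsilon>"
    and form_domain: "Domain (op_sqrt T) = H1"
  shows
    "((sqrt_abs_mult r ((op_sqrt T)\<inverse>) \<in> bounded_ops \<longleftrightarrow> r \<in> L1_loc_unif) \<and>
      (r \<in> L1_loc_unif \<longrightarrow> sym_product r ((op_sqrt T)\<inverse>) \<in> bounded_ops)) \<and>
     (\<forall>r\<^sub>0::real.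
      (sqrt_abs_mult (\<lambda>x. r x - r\<^sub>0) ((op_sqrt T)\<inverse>) \<in> compact_ops \<longleftrightarrow>
        ((\<lambda>a. LINT x:{a..a+1}|lebesgue. \<bar>r x - r\<^sub>0\<bar>) \<longlongrightarrow> 0) at_infinity) \<and>
      (((\<lambda>a. LINT x:{a..a+1}|lebesgue. \<bar>r x - r\<^sub>0\<bar>) \<longlongrightarrow> 0) at_infinity \<longrightarrow>
        sym_product (\<lambda>x. r x - r\<^sub>0) ((op_sqrt T)\<inverse>) \<in> compact_ops)) \<and>
     (\<forall>r\<^sub>0::real.
      (sqrt_abs_mult (\<lambda>x. r x - r\<^sub>0) ((op_sqrt T)\<inverse>) \<in> hilbert_schmidt_ops \<longleftrightarrow>
        (\<integral>\<^sup>+x. ennreal \<bar>r x - r\<^sub>0\<bar> \<partial>lebesgue) < \<infinity>) \<and>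
      ((\<integral>\<^sup>+x. ennreal \<bar>r x - r\<^sub>0\<bar> \<partial>lebesgue) < \<infinity> \<longrightarrow>
        sym_product (\<lambda>x. r x - r\<^sub>0) ((op_sqrt T)\<inverse>) \<in> trace_class_ops))"
proof -
  obtain R where root: "bounded_clinear R" "symmetric_map R" "\<And>f. R f = 0 \<Longrightarrow> f = 0"
    "op_sqrt T = (fun_graph R)\<inverse>"
    by (fact op_sqrt_coercive[OF T_sa T_ge eps])
  have "Domain ((fun_graph R)\<inverse>) = range R"
    by (auto simp: fun_graph_def)
  then interpret sobolev_parametrization R
    using root(1,4) form_domain by unfold_locales simp_all
  have inverse: "(op_sqrt T)\<inverse> = fun_graph R"
    by (simp add: root(4))
  have bounded: "sym_product r (fun_graph R) \<in> bounded_ops" if "r \<in> L1_loc_unif"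
  proof -
    have "sqrt_abs_mult r (fun_graph R) \<in> bounded_ops"
      using that bounded_iff_L1_loc_unif[OF r_loc] by simp
    then obtain F where "weighted r F"
      using bounded_ops_imp_weighted by blast
    then show ?thesis
      by (rule sym_product_bounded[OF L1_loc_measurable[OF r_loc]])
  qed
  have shift: "(\<lambda>x. r x - r\<^sub>0) \<in> L1_loc" for r\<^sub>0
    by (rule L1_loc_diff_const[OF r_loc])
  show ?thesis
    unfolding inverse
    by (intro conjI allI impI bounded_iff_L1_loc_unif[OF r_loc] bounded
        compact_iff_averages_vanish[OF shift] sym_product_compact[OF shift]
        hilbert_schmidt_iff_integrable[OF shift] sym_product_trace_class[OF L1_loc_measurable[OF shift]])
qed

end
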